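(* Let $K$ be an infinite field and let $g\ge 1$. (a) The Witt class of any flat $SL(2,K)$-bundle over an oriented closed surface of genus $g$ has norm $\le 4(g-1)+2$. (b) The set of Witt classes of flat $SL(2,K)$-bundles over an oriented closed surface of genus $g$ contains the set of elements of $I^2(K)$ of norm $\le 4(g-1)$.
   Context: $K^*=K\setminus\{0\}$; $W(K)$ is the Witt ring of nondegenerate symmetric bilinear forms over $K$; for $a\in K^*$, $[a]\in W(K)$ is the class of the 1-dimensional form $\langle a\rangle$, and $[0]:=0$. $I(K)\subset W(K)$ is the fundamental ideal (classes of forms on even-dimensional spaces) and $I^2(K)$ is its square. The norm $\|x\|$ of $x\in W(K)$ is the dimension of the (unique up to isomorphism) anisotropic form representing $x$. The Witt class $w\in H^2(SL(2,K),W(K))$ (cohomology of the discrete group, constant coefficients) is represented by the non-homogeneous cocycle $w(a,b)=[-a_{21}\cdot(ab)_{21}\cdot b_{21}]$, where $m_{21}$ is the $(2,1)$ entry of $m$. A flat $SL(2,K)$-bundle over a connected closed oriented surface $\Sigma$ is a principal bundle for the discrete group $SL(2,K)$; it corresponds to a homomorphism $\rho\colon\pi_1(\Sigma)\to SL(2,K)$ up to conjugation (its monodromy). The Witt class of the bundle $P$ is $\langle w(P),[\Sigma]\rangle\in W(K)$, where $w(P)\in H^2(\Sigma,W(K))$ is the pull-back of $w$ under the classifying map $\Sigma\to BSL(2,K)$; it lies in $I^2(K)$. Concretely, let $a_1,b_1,\dots,a_g,b_g$ be loops with a common base point, cutting $\Sigma$ into a $4g$-gon whose boundary read counterclockwise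 is $\prod_i[a_i,b_i]$, where $[x,y]=xyx^{-1}y^{-1}$, with monodromies $A_i,B_i$ (monodromy is multiplicative in path order). Then the value is $\prod_{i=1}^g[\overline A_i,\overline B_i]$ computed in the central extension $SL(2,K)\times W(K)$ with multiplication $(g,u)(h,v)=(gh,u+v+w(g,h))$, where $\overline m=(m,0)$; this product lies in the central subgroup $\{1\}\times W(K)\cong W(K)$. *)

theory Defs
  imports "HOL-Algebra.Group" "Jordan_Normal_Form.Determinant"
begin

section \<open>Symmetric bilinear forms and the Witt ring\<close>

text \<open>
  A nondegenerate symmetric bilinear form on \<open>K\<^sup>n\<close> is given by its Gram matrix. No assumption is made
  on the characteristic. The zero form (\<open>n = 0\<close>) is included.
\<close>

definition nondeg_form :: "'a::field mat \<Rightarrow> bool" where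
  "nondeg_form A \<longleftrightarrow> transpose_mat A = A \<and> invertible_mat A"

definition isometric_forms :: "'a::field mat \<Rightarrow> 'a mat \<Rightarrow> bool" where
  "isometric_forms A B \<longleftrightarrow>
     (\<exists>P \<in> carrier_mat (dim_row A) (dim_row A). invertible_mat P \<and> B = transpose_mat P * A * P)"

definition orth_sum :: "'a::field mat \<Rightarrow> 'a mat \<Rightarrow> 'a mat" where
  "orth_sum A B =
     four_block_mat A (0\<^sub>m (dim_row A) (dim_col B)) (0\<^sub>m (dim_row B) (dim_col A)) B"

definition tensor_form :: "'a::field mat \<Rightarrow> 'a mat \<Rightarrow> 'a mat" where
  "tensor_form A B = mat (dim_row A * dim_row B) (dim_col A * dim_col B)
     (\<lambda>(i, j). A $$ (i div dim_row B, j div dim_col B) * B $$ (i mod dim_row B, j mod dim_col B))"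

text \<open>
  A form is metabolic if it has a totally isotropic subspace of half the dimension, i.e. if in
  some basis the first half of the basis vectors are isotropic and pairwise orthogonal.
  (In characteristic \<open>2\<close> this is weaker than being a sum of hyperbolic planes.)
\<close>

definition metabolic :: "'a::field mat \<Rightarrow> bool" where
  "metabolic M \<longleftrightarrow> nondeg_form M \<and>
     (\<exists>n N. dim_row M = 2 * n \<and> isometric_forms M N \<and> (\<forall>i<n. \<forall>j<n. N $$ (i, j) = 0))"

definition witt_equiv :: "'a::field mat \<Rightarrow> 'a mat \<Rightarrow> bool" where
  "witt_equiv A B \<longleftrightarrow> nondeg_form A \<and> nondeg_form B \<and>
     (\<exists>M N. metabolic M \<and> metabolic N \<and> isometric_forms (orth_sum A M) (orth_sum B N))"

definition anisotropic :: "'a::field mat \<Rightarrow> bool" where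
  "anisotropic A \<longleftrightarrow>
     (\<forall>v \<in> carrier_vec (dim_row A). v \<noteq> 0\<^sub>v (dim_row A) \<longrightarrow> v \<bullet> (A *\<^sub>v v) \<noteq> 0)"

lemma invertible_mat_iff:
  fixes A :: "'a::field mat"
  assumes A: "A \<in> carrier_mat n n"
  shows "invertible_mat A \<longleftrightarrow> (\<exists>B \<in> carrier_mat n n. A * B = 1\<^sub>m n \<and> B * A = 1\<^sub>m n)"
proof
  assume "invertible_mat A"
  then obtain B where AB: "A * B = 1\<^sub>m n" and BA: "B * A = 1\<^sub>m (dim_row B)"
    using A by (auto simp: invertible_mat_def inverts_mat_def)
  have "dim_col B = n" using arg_cong[OF AB, of dim_col] by simp
  moreover have "dim_row B = n" using arg_cong[OF BA, of dim_col] A by simp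
  ultimately show "\<exists>B \<in> carrier_mat n n. A * B = 1\<^sub>m n \<and> B * A = 1\<^sub>m n"
    using AB BA by (intro bexI[of _ B]) auto
next
  assume "\<exists>B \<in> carrier_mat n n. A * B = 1\<^sub>m n \<and> B * A = 1\<^sub>m n"
  then show "invertible_mat A"
    using A by (auto simp: invertible_mat_def inverts_mat_def)
qed

lemma invertible_matI:
  fixes A :: "'a::field mat"
  assumes "A \<in> carrier_mat n n" "B \<in> carrier_mat n n" "A * B = 1\<^sub>m n"
  shows "invertible_mat A"
  using assms mat_mult_left_right_inverse[OF assms] by (auto simp: invertible_mat_iff)

lemma invertible_matE:
  fixes A :: "'a::field mat"
  assumes "invertible_mat A" "A \<in> carrier_mat n n"
  obtains B where "B \<in> carrier_mat n n" "A * B = 1\<^sub>m n" "B * A = 1\<^sub>m n"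
  using assms invertible_mat_iff by blast

lemma invertible_one_mat: "invertible_mat (1\<^sub>m n :: 'a::field mat)"
  by (rule invertible_matI[of _ n "1\<^sub>m n"]) auto

lemma assoc_square:
  fixes A :: "'a::field mat"
  shows "A \<in> carrier_mat n n \<Longrightarrow> B \<in> carrier_mat n n \<Longrightarrow> C \<in> carrier_mat n n \<Longrightarrow>
    A * B * C = A * (B * C)"
  by (rule assoc_mult_mat)

lemma invertible_mult:
  fixes A :: "'a::field mat"
  assumes A: "A \<in> carrier_mat n n" "invertible_mat A" and B: "B \<in> carrier_mat n n" "invertible_mat B"
  shows "invertible_mat (A * B)"
proof -
  obtain A' where A': "A' \<in> carrier_mat n n" "A * A' = 1\<^sub>m n" using A by (auto elim: invertible_matE)
  obtain B' where B': "B' \<in> carrier_mat n n" "B * B' = 1\<^sub>m n" using B by (auto elim: invertible_matE)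
  have "(A * B) * (B' * A') = A * (B * B' * A')"
    using A(1) B(1) A'(1) B'(1) by (simp add: assoc_square[where n = n] mult_carrier_mat[of _ n n _ n])
  also have "\<dots> = 1\<^sub>m n" using A' B' A(1) by simp
  finally show ?thesis
    using A(1) B(1) A'(1) B'(1) by (intro invertible_matI[of _ n "B' * A'"]) auto
qed

lemma invertible_transpose:
  fixes A :: "'a::field mat"
  assumes A: "A \<in> carrier_mat n n" "invertible_mat A"
  shows "invertible_mat (transpose_mat A)"
proof -
  obtain A' where A': "A' \<in> carrier_mat n n" "A' * A = 1\<^sub>m n" using A by (auto elim: invertible_matE)
  have "transpose_mat A * transpose_mat A' = transpose_mat (A' * A)"
    using A(1) A'(1) by (simp add: transpose_mult)
  then show ?thesis using A' A(1) by (intro invertible_matI[of _ n "transpose_mat A'"]) auto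
qed

lemma nondeg_form_carrier: "nondeg_form A \<Longrightarrow> A \<in> carrier_mat (dim_row A) (dim_row A)"
  by (auto simp: nondeg_form_def invertible_mat_def)

lemma nondeg_form_dim_col [simp]: "nondeg_form A \<Longrightarrow> dim_col A = dim_row A"
  using nondeg_form_carrier by auto

lemma nondeg_form_sym:
  "nondeg_form A \<Longrightarrow> i < dim_row A \<Longrightarrow> j < dim_row A \<Longrightarrow> A $$ (i, j) = A $$ (j, i)"
  by (metis index_transpose_mat(1) nondeg_form_def nondeg_form_dim_col)

lemma isometricI:
  assumes "A \<in> carrier_mat n n" "P \<in> carrier_mat n n" "invertible_mat P"
    "B = transpose_mat P * A * P"
  shows "isometric_forms A B"
  using assms by (auto simp: isometric_forms_def)

lemma isometric_dim: "isometric_forms A B \<Longrightarrow> dim_row B = dim_row A"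
  by (auto simp: isometric_forms_def)

lemma isometric_refl: "nondeg_form A \<Longrightarrow> isometric_forms A A"
  by (rule isometricI[OF nondeg_form_carrier one_carrier_mat invertible_one_mat])
     (simp_all add: nondeg_form_carrier left_mult_one_mat' right_mult_one_mat')

lemma isometric_trans:
  assumes A: "A \<in> carrier_mat n n" and AB: "isometric_forms A B" and BC: "isometric_forms B C"
  shows "isometric_forms A C"
proof -
  obtain P where P: "P \<in> carrier_mat n n" "invertible_mat P" "B = transpose_mat P * A * P"
    using AB A by (auto simp: isometric_forms_def)
  then have "dim_row B = n" by simp
  then obtain Q where Q: "Q \<in> carrier_mat n n" "invertible_mat Q" "C = transpose_mat Q * B * Q"
    using BC by (auto simp: isometric_forms_def)
  have "C = transpose_mat (P * Q) * A * (P * Q)"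
    unfolding Q(3) P(3) transpose_mult[OF P(1) Q(1)]
    using P(1) Q(1) A by (simp add: assoc_square[where n = n] mult_carrier_mat[of _ n n _ n])
  then show ?thesis
    by (rule isometricI[OF A mult_carrier_mat[OF P(1) Q(1)] invertible_mult[OF P(1,2) Q(1,2)]])
qed

lemma isometric_sym:
  assumes A: "A \<in> carrier_mat n n" and AB: "isometric_forms A B"
  shows "isometric_forms B A"
proof -
  obtain P where P: "P \<in> carrier_mat n n" "invertible_mat P" "B = transpose_mat P * A * P"
    using AB A by (auto simp: isometric_forms_def)
  obtain Q where Q: "Q \<in> carrier_mat n n" "P * Q = 1\<^sub>m n" "Q * P = 1\<^sub>m n"
    using P by (auto elim: invertible_matE)
  have *: "transpose_mat Q * transpose_mat P = 1\<^sub>m n"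
    using transpose_mult[OF P(1) Q(1)] Q(2) by simp
  have "transpose_mat Q * B * Q = (transpose_mat Q * transpose_mat P) * A * (P * Q)"
    unfolding P(3) using P(1) Q(1) A by (simp add: assoc_square[where n = n] mult_carrier_mat[of _ n n _ n])
  also have "\<dots> = A" unfolding * Q(2) using A by simp
  finally have "A = transpose_mat Q * B * Q" by simp
  moreover have "B \<in> carrier_mat n n" using P A by simp
  ultimately show ?thesis using isometricI[OF _ Q(1) invertible_matI[OF Q(1) P(1) Q(3)]] by blast
qed

lemma isometric_nondeg:
  assumes A: "nondeg_form A" and AB: "isometric_forms A B"
  shows "nondeg_form B"
proof -
  obtain n where Ac: "A \<in> carrier_mat n n" using nondeg_form_carrier[OF A] by blast
  have A': "invertible_mat A" "transpose_mat A = A" using A by (auto simp: nondeg_form_def)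
  obtain P where P: "P \<in> carrier_mat n n" "invertible_mat P" "B = transpose_mat P * A * P"
    using AB Ac by (auto simp: isometric_forms_def)
  have Pt: "transpose_mat P \<in> carrier_mat n n" "invertible_mat (transpose_mat P)"
    using P(1) invertible_transpose[OF P(1,2)] by simp_all
  have PA: "transpose_mat P * A \<in> carrier_mat n n" using mult_carrier_mat[OF Pt(1) Ac] .
  have "invertible_mat B" unfolding P(3)
    by (rule invertible_mult[OF PA invertible_mult[OF Pt Ac A'(1)] P(1,2)])
  moreover have "transpose_mat B = B"
    unfolding P(3) transpose_mult[OF PA P(1)] transpose_mult[OF Pt(1) Ac] A'(2) transpose_transpose
    by (rule assoc_square[OF Pt(1) Ac P(1), symmetric])
  ultimately show ?thesis by (simp add: nondeg_form_def)
qed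

lemma nondeg_isometric_trans:
  "nondeg_form A \<Longrightarrow> isometric_forms A B \<Longrightarrow> isometric_forms B C \<Longrightarrow> isometric_forms A C"
  by (rule isometric_trans[OF nondeg_form_carrier])

lemma nondeg_isometric_sym: "nondeg_form A \<Longrightarrow> isometric_forms A B \<Longrightarrow> isometric_forms B A"
  by (rule isometric_sym[OF nondeg_form_carrier])

text \<open>Reordering the basis.\<close>

lemma isometric_perm:
  fixes A :: "'a::field mat"
  assumes A: "A \<in> carrier_mat n n" and s: "bij_betw s {..<n} {..<n}"
  shows "isometric_forms A (mat n n (\<lambda>(i, j). A $$ (s i, s j)))"
proof -
  define P where "P = (mat n n (\<lambda>(i, j). if i = s j then 1 else 0) :: 'a mat)"
  have P: "P \<in> carrier_mat n n" by (simp add: P_def)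
  have s_lt: "s i < n" if "i < n" for i using s that by (auto simp: bij_betw_def)
  have s_inj: "s i = s j \<longleftrightarrow> i = j" if "i < n" "j < n" for i j
    using s that by (auto simp: bij_betw_def inj_on_def)
  have col: "(X * P) $$ (i, j) = X $$ (i, s j)" if "X \<in> carrier_mat m n" "i < m" "j < n" for X m i j
  proof -
    have "(X * P) $$ (i, j) = (\<Sum>k\<in>{0..<n}. X $$ (i, k) * (if k = s j then 1 else 0))"
      using that by (auto simp: P_def scalar_prod_def intro!: sum.cong)
    also have "\<dots> = (\<Sum>k\<in>{0..<n}. if k = s j then X $$ (i, k) else 0)"
      by (intro sum.cong) auto
    finally show ?thesis using s_lt[OF that(3)] by simp
  qed
  have row: "(transpose_mat P * X) $$ (i, j) = X $$ (s i, j)" if "X \<in> carrier_mat n m" "i < n" "j < m" for X m i j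
  proof -
    have "(transpose_mat P * X) $$ (i, j) = (\<Sum>k\<in>{0..<n}. (if k = s i then 1 else 0) * X $$ (k, j))"
      using that by (auto simp: P_def scalar_prod_def intro!: sum.cong)
    also have "\<dots> = (\<Sum>k\<in>{0..<n}. if k = s i then X $$ (k, j) else 0)"
      by (intro sum.cong) auto
    finally show ?thesis using s_lt[OF that(2)] by simp
  qed
  have "transpose_mat P * P = 1\<^sub>m n"
  proof (intro eq_matI)
    fix i j assume "i < dim_row (1\<^sub>m n)" "j < dim_col (1\<^sub>m n)"
    then have ij: "i < n" "j < n" by simp_all
    show "(transpose_mat P * P) $$ (i, j) = 1\<^sub>m n $$ (i, j)"
      unfolding row[OF P ij] using ij s_lt[OF ij(1)] s_inj[OF ij] by (simp add: P_def)
  qed (use P in auto)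
  then have "invertible_mat P"
    using P mat_mult_left_right_inverse[of "transpose_mat P" n P]
    by (intro invertible_matI[of P n "transpose_mat P"]) auto
  moreover have "mat n n (\<lambda>(i, j). A $$ (s i, s j)) = transpose_mat P * A * P"
  proof (intro eq_matI)
    fix i j assume "i < dim_row (transpose_mat P * A * P)" "j < dim_col (transpose_mat P * A * P)"
    then have ij: "i < n" "j < n" using P by simp_all
    have PA: "transpose_mat P * A \<in> carrier_mat n n" using P A by simp
    show "mat n n (\<lambda>(i, j). A $$ (s i, s j)) $$ (i, j) = (transpose_mat P * A * P) $$ (i, j)"
      unfolding col[OF PA ij] row[OF A ij(1) s_lt[OF ij(2)]] using ij by simp
  qed (use P in auto)
  ultimately show ?thesis using isometricI[OF A P] by blast
qed

lemma isometric_permI: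
  fixes A B :: "'a::field mat"
  assumes A: "A \<in> carrier_mat n n" and B: "B \<in> carrier_mat n n"
    and s: "\<And>i. i < n \<Longrightarrow> s i < n" "\<And>i. i < n \<Longrightarrow> t i < n" "\<And>i. i < n \<Longrightarrow> t (s i) = i" 
      "\<And>i. i < n \<Longrightarrow> s (t i) = i"
    and eq: "\<And>i j. i < n \<Longrightarrow> j < n \<Longrightarrow> B $$ (i, j) = A $$ (s i, s j)"
  shows "isometric_forms A B"
proof -
  have "bij_betw s {..<n} {..<n}"
    using s by (intro bij_betw_byWitness[of _ t]) auto
  moreover have "B = mat n n (\<lambda>(i, j). A $$ (s i, s j))" using B eq by (intro eq_matI) auto
  ultimately show ?thesis using isometric_perm[OF A] by simp
qed

subsection \<open>Orthogonal sums\<close>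

lemma orth_sum_dim [simp]:
  "dim_row (orth_sum A B) = dim_row A + dim_row B"
  "dim_col (orth_sum A B) = dim_col A + dim_col B"
  by (auto simp: orth_sum_def)

lemma orth_sum_carrier:
  "A \<in> carrier_mat n n \<Longrightarrow> B \<in> carrier_mat m m \<Longrightarrow> orth_sum A B \<in> carrier_mat (n + m) (n + m)"
  by auto

lemma orth_sum_index:
  assumes "i < dim_row A + dim_row B" "j < dim_col A + dim_col B"
  shows "orth_sum A B $$ (i, j) =
    (if i < dim_row A then if j < dim_col A then A $$ (i, j) else 0
     else if j < dim_col A then 0 else B $$ (i - dim_row A, j - dim_col A))"
  using assms by (auto simp: orth_sum_def)

lemma orth_sum_transpose:
  "transpose_mat (orth_sum A B) = orth_sum (transpose_mat A) (transpose_mat B)"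
  by (intro eq_matI) (auto simp: orth_sum_index)

lemma orth_sum_mult:
  assumes "A \<in> carrier_mat n n" "A' \<in> carrier_mat n n" "B \<in> carrier_mat m m" "B' \<in> carrier_mat m m"
  shows "orth_sum A B * orth_sum A' B' = orth_sum (A * A') (B * B')"
  unfolding orth_sum_def using assms
  by (subst mult_four_block_mat[of _ n n _ m _ m _ _ n _ m]) auto

lemma orth_sum_one: "orth_sum (1\<^sub>m n) (1\<^sub>m m) = 1\<^sub>m (n + m)"
  by (intro eq_matI) (auto simp: orth_sum_index)

lemma orth_sum_assoc: "orth_sum (orth_sum A B) C = orth_sum A (orth_sum B C)"
proof (rule eq_matI)
  fix i j assume "i < dim_row (orth_sum A (orth_sum B C))" "j < dim_col (orth_sum A (orth_sum B C))"
  then have ij: "i < dim_row A + (dim_row B + dim_row C)" "j < dim_col A + (dim_col B + dim_col C)"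
    by simp_all
  have *: "k - a < b \<longleftrightarrow> k < a + b" if "\<not> k < a" for k a b :: nat using that by auto
  show "orth_sum (orth_sum A B) C $$ (i, j) = orth_sum A (orth_sum B C) $$ (i, j)"
    using ij *[of i "dim_row A"] *[of j "dim_col A"]
    by (cases "i < dim_row A"; cases "j < dim_col A"; cases "i < dim_row A + dim_row B";
        cases "j < dim_col A + dim_col B") (simp_all add: orth_sum_index)
qed simp_all

lemma orth_sum_invertible:
  assumes "A \<in> carrier_mat n n" "B \<in> carrier_mat m m" "invertible_mat A" "invertible_mat B"
  shows "invertible_mat (orth_sum A B)"
proof -
  obtain A' where A': "A' \<in> carrier_mat n n" "A * A' = 1\<^sub>m n" using assms by (auto elim: invertible_matE)
  obtain B' where B': "B' \<in> carrier_mat m m" "B * B' = 1\<^sub>m m" using assms by (auto elim: invertible_matE)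
  show ?thesis using assms A' B'
    by (intro invertible_matI[of _ "n + m" "orth_sum A' B'"])
       (auto simp: orth_sum_mult[of _ n _ _ m] orth_sum_one)
qed

lemma orth_sum_nondeg: "nondeg_form A \<Longrightarrow> nondeg_form B \<Longrightarrow> nondeg_form (orth_sum A B)"
  using orth_sum_invertible[OF nondeg_form_carrier nondeg_form_carrier, of A B]
  by (auto simp: nondeg_form_def orth_sum_transpose)

lemma orth_sum_isometric:
  assumes A: "nondeg_form A" "isometric_forms A A'" and B: "nondeg_form B" "isometric_forms B B'"
  shows "isometric_forms (orth_sum A B) (orth_sum A' B')"
proof -
  obtain n m where c: "A \<in> carrier_mat n n" "B \<in> carrier_mat m m"
    using nondeg_form_carrier[OF A(1)] nondeg_form_carrier[OF B(1)] by blast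
  obtain P where P: "P \<in> carrier_mat n n" "invertible_mat P" "A' = transpose_mat P * A * P"
    using A c by (auto simp: isometric_forms_def)
  obtain Q where Q: "Q \<in> carrier_mat m m" "invertible_mat Q" "B' = transpose_mat Q * B * Q"
    using B c by (auto simp: isometric_forms_def)
  have "orth_sum A' B' = transpose_mat (orth_sum P Q) * orth_sum A B * orth_sum P Q"
    unfolding P(3) Q(3) orth_sum_transpose
    using c P(1) Q(1) by (simp add: orth_sum_mult[of _ n _ _ m] mult_carrier_mat[of _ n n _ n] mult_carrier_mat[of _ m m _ m])
  then show ?thesis
    using orth_sum_invertible[OF P(1) Q(1) P(2) Q(2)] c P(1) Q(1)
    by (intro isometricI[of _ "n + m" "orth_sum P Q"]) auto
qed

lemma orth_sum_comm:
  assumes "nondeg_form A" "nondeg_form B"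
  shows "isometric_forms (orth_sum A B) (orth_sum B A)"
  using assms
  by (intro isometric_permI[where n = "dim_row A + dim_row B"
        and s = "\<lambda>i. if i < dim_row B then i + dim_row A else i - dim_row B"
        and t = "\<lambda>i. if i < dim_row A then i + dim_row B else i - dim_row A"])
     (auto simp: orth_sum_index)

lemma metabolic_nondeg: "metabolic M \<Longrightarrow> nondeg_form M"
  by (simp add: metabolic_def)

lemma metabolic_isometric:
  assumes M: "metabolic M" and MN: "isometric_forms M N"
  shows "metabolic N"
proof -
  note c = nondeg_form_carrier[OF metabolic_nondeg[OF M]]
  obtain n L where L: "dim_row M = 2 * n" "isometric_forms M L" "\<forall>i<n. \<forall>j<n. L $$ (i, j) = 0"
    using M by (auto simp: metabolic_def)
  have N: "nondeg_form N" using isometric_nondeg[OF metabolic_nondeg[OF M] MN] .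
  then have "isometric_forms N L"
    using isometric_trans[OF nondeg_form_carrier isometric_sym[OF c MN] L(2)] by blast
  then show ?thesis using L N isometric_dim[OF MN] by (auto simp: metabolic_def)
qed

lemma metabolicI:
  assumes "nondeg_form M" "dim_row M = 2 * n" "\<And>i j. i < n \<Longrightarrow> j < n \<Longrightarrow> M $$ (i, j) = 0"
  shows "metabolic M"
  using assms isometric_refl[OF assms(1)] by (auto simp: metabolic_def)

lemma metabolicE:
  assumes "metabolic M"
  obtains n N where "dim_row M = 2 * n" "isometric_forms M N" "nondeg_form N" "metabolic N"
    "dim_row N = 2 * n" "\<And>i j. i < n \<Longrightarrow> j < n \<Longrightarrow> N $$ (i, j) = 0"
proof -
  note nd = metabolic_nondeg[OF assms]
  obtain n N where N: "dim_row M = 2 * n" "isometric_forms M N" "\<forall>i<n. \<forall>j<n. N $$ (i, j) = 0"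
    using assms by (auto simp: metabolic_def)
  then show thesis
    using that[of n N] isometric_nondeg[OF nd N(2)] metabolic_isometric[OF assms N(2)] isometric_dim[OF N(2)]
    by simp
qed

lemma metabolic_orth_sum:
  assumes M: "metabolic M" and N: "metabolic N"
  shows "metabolic (orth_sum M N)"
proof -
  obtain m M' where M': "dim_row M = 2 * m" "isometric_forms M M'" "nondeg_form M'"
    "dim_row M' = 2 * m" "\<And>i j. i < m \<Longrightarrow> j < m \<Longrightarrow> M' $$ (i, j) = 0"
    using M by (rule metabolicE) blast
  obtain n N' where N': "dim_row N = 2 * n" "isometric_forms N N'" "nondeg_form N'"
    "dim_row N' = 2 * n" "\<And>i j. i < n \<Longrightarrow> j < n \<Longrightarrow> N' $$ (i, j) = 0"
    using N by (rule metabolicE) blast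
  note nd = metabolic_nondeg[OF M] metabolic_nondeg[OF N]
  define s where "s i = (if i < m then i else if i < m + n then i + m 
    else if i < 2 * m + n then i - n else i)" for i
  define t where "t i = (if i < m then i else if i < 2 * m then i + n 
    else if i < 2 * m + n then i - m else i)" for i
  define L where "L = mat (2 * (m + n)) (2 * (m + n)) (\<lambda>(i, j). orth_sum M' N' $$ (s i, s j))"
  have "isometric_forms (orth_sum M' N') L"
    using nondeg_form_dim_col[OF M'(3)] nondeg_form_dim_col[OF N'(3)] M'(4) N'(4)
    by (intro isometric_permI[where n = "2 * (m + n)" and s = s and t = t])
       (auto simp: s_def t_def L_def)
  moreover have "isometric_forms (orth_sum M N) (orth_sum M' N')"
    using orth_sum_isometric nd M'(2) N'(2) by blast
  ultimately have "isometric_forms (orth_sum M N) L"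
    using nondeg_isometric_trans[OF orth_sum_nondeg[OF nd]] by blast
  moreover have "L $$ (i, j) = 0" if "i < m + n" "j < m + n" for i j
    using that M'(4,5) N'(4,5) nondeg_form_dim_col[OF M'(3)] nondeg_form_dim_col[OF N'(3)]
    by (auto simp: L_def s_def orth_sum_index)
  ultimately show ?thesis
    unfolding metabolic_def using orth_sum_nondeg[OF nd] M'(1) N'(1)
    by (intro conjI exI[of _ "m + n"] exI[of _ L]) auto
qed

subsection \<open>Tensor products\<close>

lemma tensor_dim [simp]:
  "dim_row (tensor_form A B) = dim_row A * dim_row B"
  "dim_col (tensor_form A B) = dim_col A * dim_col B"
  by (auto simp: tensor_form_def)

lemma less_mult_mod_nat: "i < n * m \<Longrightarrow> i mod m < (m::nat)"
  by (cases "m = 0") auto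

lemma tensor_index:
  "i < dim_row A * dim_row B \<Longrightarrow> j < dim_col A * dim_col B \<Longrightarrow>
   tensor_form A B $$ (i, j) =
     A $$ (i div dim_row B, j div dim_col B) * B $$ (i mod dim_row B, j mod dim_col B)"
  by (simp add: tensor_form_def)

lemma tensor_transpose:
  "transpose_mat (tensor_form A B) = tensor_form (transpose_mat A) (transpose_mat B)"
  by (intro eq_matI)
     (auto simp: tensor_index less_mult_imp_div_less less_mult_mod_nat)

lemma sum_div_mod:
  fixes f g :: "nat \<Rightarrow> 'a::semiring_0"
  shows "(\<Sum>k\<in>{0..<n * m}. h (k div m) (k mod m)) = (\<Sum>i\<in>{0..<n}. \<Sum>j\<in>{0..<m}. h i (j::nat) :: 'a)"
proof -
  have "(\<Sum>i\<in>{0..<n}. \<Sum>j\<in>{0..<m}. h i j) = (\<Sum>(i, j)\<in>{0..<n} \<times> {0..<m}. h i j)"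
    by (simp add: sum.cartesian_product)
  also have "\<dots> = (\<Sum>k\<in>{0..<n * m}. h (k div m) (k mod m))"
  proof (rule sum.reindex_bij_witness[of _ "\<lambda>k. (k div m, k mod m)" "\<lambda>(i, j). i * m + j"])
    fix a assume "a \<in> {0..<n} \<times> {0..<m}"
    then obtain i j where a: "a = (i, j)" "i < n" "j < m" by auto
    have "i * m + j < (i + 1) * m" using a by simp
    also have "\<dots> \<le> n * m" using a by (intro mult_right_mono) auto
    finally show "(case a of (i, j) \<Rightarrow> i * m + j) \<in> {0..<n * m}" using a by simp
  qed (auto simp: less_mult_imp_div_less less_mult_mod_nat)
  finally show ?thesis by simp
qed

lemma tensor_mult:
  fixes A A' B B' :: "'a::field mat"
  assumes c: "A \<in> carrier_mat n n" "A' \<in> carrier_mat n n" "B \<in> carrier_mat m m" "B' \<in> carrier_mat m m"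
  shows "tensor_form A B * tensor_form A' B' = tensor_form (A * A') (B * B')"
proof (rule eq_matI)
  fix i j assume "i < dim_row (tensor_form (A * A') (B * B'))" "j < dim_col (tensor_form (A * A') (B * B'))"
  then have ij: "i < n * m" "j < n * m" using c by auto
  note lt = less_mult_imp_div_less[OF ij(1)] less_mult_imp_div_less[OF ij(2)]
    less_mult_mod_nat[OF ij(1)] less_mult_mod_nat[OF ij(2)]
  have "(tensor_form A B * tensor_form A' B') $$ (i, j) = 
    (\<Sum>k\<in>{0..<n * m}. (A $$ (i div m, k div m) * B $$ (i mod m, k mod m)) 
      * (A' $$ (k div m, j div m) * B' $$ (k mod m, j mod m)))"
    using c ij by (auto simp: scalar_prod_def tensor_index intro!: sum.cong)
  also have "\<dots> = (\<Sum>p\<in>{0..<n}. \<Sum>q\<in>{0..<m}. (A $$ (i div m, p) * B $$ (i mod m, q)) 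
      * (A' $$ (p, j div m) * B' $$ (q, j mod m)))"
    by (rule sum_div_mod)
  also have "\<dots> = (\<Sum>p\<in>{0..<n}. A $$ (i div m, p) * A' $$ (p, j div m))
    * (\<Sum>q\<in>{0..<m}. B $$ (i mod m, q) * B' $$ (q, j mod m))"
    by (simp add: sum_product mult_ac)
  also have "\<dots> = tensor_form (A * A') (B * B') $$ (i, j)"
    using c ij lt by (simp add: tensor_index scalar_prod_def)
  finally show "(tensor_form A B * tensor_form A' B') $$ (i, j) = tensor_form (A * A') (B * B') $$ (i, j)" .
qed (use c in auto)

lemma div_mod_eqI: "i div m = j div m \<Longrightarrow> i mod m = j mod m \<Longrightarrow> i = (j::nat)"
  by (metis div_mult_mod_eq)

lemma tensor_one: "tensor_form (1\<^sub>m n) (1\<^sub>m m) = 1\<^sub>m (n * m)"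
  by (intro eq_matI)
     (auto simp: tensor_index less_mult_imp_div_less less_mult_mod_nat dest: div_mod_eqI)

lemma tensor_one_left: "tensor_form (1\<^sub>m 1) A = (A :: 'a::field mat)"
  by (intro eq_matI) (auto simp: tensor_index)

lemma tensor_invertible:
  assumes "A \<in> carrier_mat n n" "B \<in> carrier_mat m m" "invertible_mat A" "invertible_mat B"
  shows "invertible_mat (tensor_form A B)"
proof -
  obtain A' where A': "A' \<in> carrier_mat n n" "A * A' = 1\<^sub>m n" using assms by (auto elim: invertible_matE)
  obtain B' where B': "B' \<in> carrier_mat m m" "B * B' = 1\<^sub>m m" using assms by (auto elim: invertible_matE)
  show ?thesis using assms A' B'
    by (intro invertible_matI[of _ "n * m" "tensor_form A' B'"])
       (auto simp: tensor_mult[of _ n _ _ m] tensor_one)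
qed

lemma tensor_nondeg: "nondeg_form A \<Longrightarrow> nondeg_form B \<Longrightarrow> nondeg_form (tensor_form A B)"
  using tensor_invertible[OF nondeg_form_carrier nondeg_form_carrier, of A B]
  by (auto simp: nondeg_form_def tensor_transpose)

lemma tensor_isometric:
  assumes A: "nondeg_form A" "isometric_forms A A'" and B: "nondeg_form B" "isometric_forms B B'"
  shows "isometric_forms (tensor_form A B) (tensor_form A' B')"
proof -
  obtain n m where c: "A \<in> carrier_mat n n" "B \<in> carrier_mat m m"
    using nondeg_form_carrier[OF A(1)] nondeg_form_carrier[OF B(1)] by blast
  obtain P where P: "P \<in> carrier_mat n n" "invertible_mat P" "A' = transpose_mat P * A * P"
    using A c by (auto simp: isometric_forms_def)
  obtain Q where Q: "Q \<in> carrier_mat m m" "invertible_mat Q" "B' = transpose_mat Q * B * Q"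
    using B c by (auto simp: isometric_forms_def)
  have "tensor_form A' B' = transpose_mat (tensor_form P Q) * tensor_form A B * tensor_form P Q"
    unfolding P(3) Q(3) tensor_transpose
    using c P(1) Q(1) by (simp add: tensor_mult[of _ n _ _ m] mult_carrier_mat[of _ n n _ n] mult_carrier_mat[of _ m m _ m])
  then show ?thesis
    using tensor_invertible[OF P(1) Q(1) P(2) Q(2)] c P(1) Q(1)
    by (intro isometricI[of _ "n * m" "tensor_form P Q"]) auto
qed

lemma swap_div_mod:
  fixes i n m :: nat
  assumes "i < n * m"
  shows "(i mod m) * n + i div m < n * m" "((i mod m) * n + i div m) div n = i mod m"
    "((i mod m) * n + i div m) mod n = i div m"
proof -
  have d: "i div m < n" "i mod m < m"
    using assms less_mult_imp_div_less less_mult_mod_nat by blast+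
  have "(i mod m) * n + i div m < (i mod m + 1) * n" using d by simp
  also have "\<dots> \<le> m * n" using d by (intro mult_right_mono) auto
  finally show "(i mod m) * n + i div m < n * m" by (simp add: mult.commute)
  show "((i mod m) * n + i div m) div n = i mod m" "((i mod m) * n + i div m) mod n = i div m"
    using d by auto
qed

lemma tensor_comm:
  assumes A: "nondeg_form A" and B: "nondeg_form B"
  shows "isometric_forms (tensor_form A B) (tensor_form B A)"
proof -
  define n m where "n = dim_row A" and "m = dim_row B"
  define s t where "s = (\<lambda>i. (i mod n) * m + i div n)" and "t = (\<lambda>i. (i mod m) * n + i div m)"
  have dims: "dim_row A = n" "dim_col A = n" "dim_row B = m" "dim_col B = m"
    using A B by (simp_all add: n_def m_def)
  have s: "s i < n * m" "s i div m = i mod n" "s i mod m = i div n" if "i < n * m" for i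
    using swap_div_mod[of i m n] that by (simp_all add: s_def mult.commute[of m n])
  have t: "t i < n * m" "t i div n = i mod m" "t i mod n = i div m" if "i < n * m" for i
    using swap_div_mod[of i n m] that by (simp_all add: t_def)
  show ?thesis
  proof (rule isometric_permI[where n = "n * m" and s = s and t = t])
    show "t (s i) = i" if "i < n * m" for i
      using s[OF that] unfolding t_def by simp
    show "s (t i) = i" if "i < n * m" for i
      using t[OF that] unfolding s_def by simp
    fix i j assume ij: "i < n * m" "j < n * m"
    show "tensor_form B A $$ (i, j) = tensor_form A B $$ (s i, s j)"
      using ij s[OF ij(1)] s[OF ij(2)] by (simp add: tensor_index dims mult.commute)
  qed (use s t in \<open>auto simp: dims mult.commute\<close>)
qed

lemma div_mod_mult_nat: "k div c mod b = k mod (b * c) div (c::nat)"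
proof (cases "c = 0")
  case False
  have "k mod (b * c) = c * (k div c mod b) + k mod c"
    using mod_mult2_eq[of k c b] by (simp add: mult.commute)
  then show ?thesis using False by simp
qed simp

lemma tensor_assoc:
  fixes A B C :: "'a::field mat"
  shows "tensor_form (tensor_form A B) C = tensor_form A (tensor_form B C)"
proof (rule eq_matI)
  fix i j assume ij0: "i < dim_row (tensor_form A (tensor_form B C))"
    "j < dim_col (tensor_form A (tensor_form B C))"
  then have i: "i < dim_row A * dim_row B * dim_row C" and j: "j < dim_col A * dim_col B * dim_col C"
    by (simp_all add: mult.assoc)
  have d: "k div c div b = k div (b * c)" for k b c :: nat
    by (simp add: div_mult2_eq mult.commute[of b])
  have m: "k mod (b * c) mod c = k mod c" for k b c :: nat
    by (simp add: mod_mod_cancel)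
  have L: "tensor_form (tensor_form A B) C $$ (i, j) =
    A $$ (i div (dim_row B * dim_row C), j div (dim_col B * dim_col C)) *
    B $$ (i div dim_row C mod dim_row B, j div dim_col C mod dim_col B) *
    C $$ (i mod dim_row C, j mod dim_col C)"
    using i j less_mult_imp_div_less[OF i] less_mult_imp_div_less[OF j] 
    by (simp add: tensor_index d)
  have "i mod (dim_row B * dim_row C) < dim_row B * dim_row C" 
    "j mod (dim_col B * dim_col C) < dim_col B * dim_col C"
    using ij0 less_mult_mod_nat by simp_all
  then have R: "tensor_form A (tensor_form B C) $$ (i, j) =
    A $$ (i div (dim_row B * dim_row C), j div (dim_col B * dim_col C)) *
    (B $$ (i mod (dim_row B * dim_row C) div dim_row C, j mod (dim_col B * dim_col C) div dim_col C) *
    C $$ (i mod dim_row C, j mod dim_col C))"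
    using ij0 by (simp add: tensor_index m)
  show "tensor_form (tensor_form A B) C $$ (i, j) = tensor_form A (tensor_form B C) $$ (i, j)"
    unfolding L R div_mod_mult_nat[of i] div_mod_mult_nat[of j] by (simp only: mult.assoc)
qed (simp_all add: mult.assoc)

lemma tensor_distrib:
  "tensor_form (orth_sum A B) C = orth_sum (tensor_form A C) (tensor_form B C)"
proof -
  have 1: "i div c < a \<longleftrightarrow> i < a * c" if "i < (a + b) * c" for i a b c :: nat
    using that by (cases "c = 0") (auto simp: div_less_iff_less_mult)
  have 2: "(i - a * c) div c = i div c - a" "(i - a * c) mod c = i mod c" 
    if "i < (a + b) * c" "\<not> i < a * c" for i a b c :: nat
  proof -
    have "a * c \<le> i" using that by simp
    then obtain k where k: "i = a * c + k" using le_Suc_ex by blast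
    have "c \<noteq> 0" using that by (cases "c = 0") auto
    then show "(i - a * c) div c = i div c - a" "(i - a * c) mod c = i mod c"
      by (simp_all add: k)
  qed
  show ?thesis
  proof (intro eq_matI)
    fix i j assume ij: "i < dim_row (orth_sum (tensor_form A C) (tensor_form B C))"
      "j < dim_col (orth_sum (tensor_form A C) (tensor_form B C))"
    then have i: "i < (dim_row A + dim_row B) * dim_row C" 
      and j: "j < (dim_col A + dim_col B) * dim_col C" by (auto simp: algebra_simps)
    show "tensor_form (orth_sum A B) C $$ (i, j) = orth_sum (tensor_form A C) (tensor_form B C) $$ (i, j)"
      using i j ij less_mult_imp_div_less[OF i] less_mult_imp_div_less[OF j]
      by (auto simp: tensor_index orth_sum_index 1[OF i] 1[OF j] 2(1)[OF i] 2(1)[OF j] 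
            2(2)[OF i] 2(2)[OF j])
  qed (auto simp: algebra_simps)
qed

lemma metabolic_tensor:
  assumes M: "metabolic M" and A: "nondeg_form A"
  shows "metabolic (tensor_form M A)"
proof -
  obtain m N where N: "dim_row M = 2 * m" "isometric_forms M N" "nondeg_form N"
    "dim_row N = 2 * m" "\<And>i j. i < m \<Longrightarrow> j < m \<Longrightarrow> N $$ (i, j) = 0"
    using M by (rule metabolicE) blast
  note nd = metabolic_nondeg[OF M]
  have "tensor_form N A $$ (i, j) = 0" if "i < m * dim_row A" "j < m * dim_row A" for i j
    using that N(4,5) nondeg_form_dim_col[OF N(3)] nondeg_form_dim_col[OF A]
    by (auto simp: tensor_index less_mult_imp_div_less)
  then have "metabolic (tensor_form N A)"
    using N(4) by (intro metabolicI[where n = "m * dim_row A"] tensor_nondeg N A) auto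
  moreover have "isometric_forms (tensor_form N A) (tensor_form M A)"
    by (rule tensor_isometric[OF N(3) nondeg_isometric_sym[OF nd N(2)] A isometric_refl[OF A]])
  ultimately show ?thesis by (rule metabolic_isometric)
qed

subsection \<open>Witt equivalence\<close>

lemma unit_form_nondeg: "nondeg_form (1\<^sub>m n :: 'a::field mat)"
  by (simp add: nondeg_form_def invertible_one_mat)

lemma metabolic_zero: "metabolic (1\<^sub>m 0 :: 'a::field mat)"
  by (intro metabolicI[where n = 0] unit_form_nondeg) auto

lemma orth_sum_zero_left [simp]: "orth_sum (1\<^sub>m 0) A = (A :: 'a::field mat)"
  by (intro eq_matI) (auto simp: orth_sum_index)

lemma orth_sum_zero_right [simp]: "orth_sum A (1\<^sub>m 0) = (A :: 'a::field mat)"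
  by (intro eq_matI) (auto simp: orth_sum_index)

lemma isometric_witt_equiv: "nondeg_form A \<Longrightarrow> isometric_forms A B \<Longrightarrow> witt_equiv A B"
  unfolding witt_equiv_def using isometric_nondeg metabolic_zero
  by (intro conjI exI[of _ "1\<^sub>m 0"]) auto

lemma metabolic_witt_zero: "metabolic M \<Longrightarrow> witt_equiv M (1\<^sub>m 0)"
  unfolding witt_equiv_def using metabolic_nondeg unit_form_nondeg metabolic_zero isometric_refl
  by (intro conjI exI[of _ "1\<^sub>m 0"] exI[of _ M]) auto

lemma witt_equiv_refl: "nondeg_form A \<Longrightarrow> witt_equiv A A"
  by (simp add: isometric_refl isometric_witt_equiv)

lemma witt_equiv_sym: "witt_equiv A B \<Longrightarrow> witt_equiv B A"
  unfolding witt_equiv_def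
  using nondeg_isometric_sym[OF orth_sum_nondeg[OF _ metabolic_nondeg]] by blast

lemma orth_sum_swap:
  assumes "nondeg_form A" "nondeg_form B" "nondeg_form C"
  shows "isometric_forms (orth_sum (orth_sum A B) C) (orth_sum (orth_sum A C) B)"
  using assms by (simp add: orth_sum_assoc orth_sum_isometric orth_sum_comm isometric_refl orth_sum_nondeg)

lemma witt_equiv_trans:
  assumes AB: "witt_equiv A B" and BC: "witt_equiv B C"
  shows "witt_equiv A C"
proof -
  obtain M N where MN: "metabolic M" "metabolic N" "isometric_forms (orth_sum A M) (orth_sum B N)"
    using AB by (auto simp: witt_equiv_def)
  obtain M' N' where MN': "metabolic M'" "metabolic N'" "isometric_forms (orth_sum B M') (orth_sum C N')"
    using BC by (auto simp: witt_equiv_def)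
  have nd: "nondeg_form A" "nondeg_form B" "nondeg_form C" "nondeg_form M" "nondeg_form N" 
    "nondeg_form M'" "nondeg_form N'"
    using AB BC MN MN' by (auto simp: witt_equiv_def metabolic_nondeg)
  note t = nondeg_isometric_trans[OF orth_sum_nondeg[OF orth_sum_nondeg]]
  have "isometric_forms (orth_sum (orth_sum A M) M') (orth_sum (orth_sum B N) M')"
    using orth_sum_isometric[OF orth_sum_nondeg MN(3) _ isometric_refl] nd by blast
  moreover have "isometric_forms (orth_sum (orth_sum B N) M') (orth_sum (orth_sum B M') N)"
    using nd by (intro orth_sum_swap)
  moreover have "isometric_forms (orth_sum (orth_sum B M') N) (orth_sum (orth_sum C N') N)"
    using orth_sum_isometric[OF orth_sum_nondeg MN'(3) _ isometric_refl] nd by blast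
  ultimately have "isometric_forms (orth_sum A (orth_sum M M')) (orth_sum C (orth_sum N' N))"
    using t[OF nd(1,4,6)] by (simp only: orth_sum_assoc) blast
  then show ?thesis using nd MN MN' metabolic_orth_sum unfolding witt_equiv_def by blast
qed

lemma witt_equiv_orth_sum:
  assumes A: "witt_equiv A A'" and B: "witt_equiv B B'"
  shows "witt_equiv (orth_sum A B) (orth_sum A' B')"
proof -
  have *: "witt_equiv (orth_sum A B) (orth_sum A' B)" if A: "witt_equiv A A'" and B: "nondeg_form B" 
    for A A' B :: "'a mat"
  proof -
    obtain M N where MN: "metabolic M" "metabolic N" "isometric_forms (orth_sum A M) (orth_sum A' N)"
      using A by (auto simp: witt_equiv_def)
    have nd: "nondeg_form A" "nondeg_form A'" "nondeg_form M" "nondeg_form N"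
      using A MN by (auto simp: witt_equiv_def metabolic_nondeg)
    have "isometric_forms (orth_sum (orth_sum A B) M) (orth_sum (orth_sum A M) B)"
      using nd B by (intro orth_sum_swap)
    moreover have "isometric_forms (orth_sum (orth_sum A M) B) (orth_sum (orth_sum A' N) B)"
      using orth_sum_isometric[OF orth_sum_nondeg MN(3) _ isometric_refl] nd B by blast
    moreover have "isometric_forms (orth_sum (orth_sum A' N) B) (orth_sum (orth_sum A' B) N)"
      using nd B by (intro orth_sum_swap)
    ultimately have "isometric_forms (orth_sum (orth_sum A B) M) (orth_sum (orth_sum A' B) N)"
      using nondeg_isometric_trans[OF orth_sum_nondeg[OF orth_sum_nondeg[OF nd(1) B] nd(3)]] by blast
    then show ?thesis using nd MN B orth_sum_nondeg unfolding witt_equiv_def by blast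
  qed
  have nd: "nondeg_form A" "nondeg_form A'" "nondeg_form B" "nondeg_form B'"
    using A B by (auto simp: witt_equiv_def)
  have "witt_equiv (orth_sum A B) (orth_sum A' B)" using * A nd by blast
  moreover have "witt_equiv (orth_sum A' B) (orth_sum B A')"
    using nd by (intro isometric_witt_equiv orth_sum_comm orth_sum_nondeg)
  moreover have "witt_equiv (orth_sum B A') (orth_sum B' A')" using * B nd by blast
  moreover have "witt_equiv (orth_sum B' A') (orth_sum A' B')"
    using nd by (intro isometric_witt_equiv orth_sum_comm orth_sum_nondeg)
  ultimately show ?thesis using witt_equiv_trans by blast
qed

lemma witt_equiv_tensor:
  assumes A: "witt_equiv A A'" and B: "witt_equiv B B'"
  shows "witt_equiv (tensor_form A B) (tensor_form A' B')"
proof -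
  have *: "witt_equiv (tensor_form A B) (tensor_form A' B)" if A: "witt_equiv A A'" and B: "nondeg_form B" 
    for A A' B :: "'a mat"
  proof -
    obtain M N where MN: "metabolic M" "metabolic N" "isometric_forms (orth_sum A M) (orth_sum A' N)"
      using A by (auto simp: witt_equiv_def)
    have nd: "nondeg_form A" "nondeg_form A'" "nondeg_form M" "nondeg_form N"
      using A MN by (auto simp: witt_equiv_def metabolic_nondeg)
    have "isometric_forms (tensor_form (orth_sum A M) B) (tensor_form (orth_sum A' N) B)"
      using tensor_isometric[OF orth_sum_nondeg MN(3) _ isometric_refl] nd B by blast
    then show ?thesis
      using nd B MN metabolic_tensor tensor_nondeg unfolding tensor_distrib witt_equiv_def by blast
  qed
  have nd: "nondeg_form A" "nondeg_form A'" "nondeg_form B" "nondeg_form B'"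
    using A B by (auto simp: witt_equiv_def)
  have "witt_equiv (tensor_form A B) (tensor_form A' B)" using * A nd by blast
  moreover have "witt_equiv (tensor_form A' B) (tensor_form B A')"
    using nd by (intro isometric_witt_equiv tensor_comm tensor_nondeg)
  moreover have "witt_equiv (tensor_form B A') (tensor_form B' A')" using * B nd by blast
  moreover have "witt_equiv (tensor_form B' A') (tensor_form A' B')"
    using nd by (intro isometric_witt_equiv tensor_comm tensor_nondeg)
  ultimately show ?thesis using witt_equiv_trans by blast
qed

lemma uminus_nondeg: "nondeg_form A \<Longrightarrow> nondeg_form (- A)"
proof -
  assume A: "nondeg_form A"
  obtain n where c: "A \<in> carrier_mat n n" using nondeg_form_carrier[OF A] by blast
  obtain B where B: "B \<in> carrier_mat n n" "A * B = 1\<^sub>m n"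
    using A c by (auto simp: nondeg_form_def elim: invertible_matE)
  have "(- A) * (- B) = 1\<^sub>m n" using B c by simp
  then have "invertible_mat (- A)" using B c by (intro invertible_matI[of _ n "- B"]) auto
  then show ?thesis using A c by (auto simp: nondeg_form_def transpose_uminus)
qed

lemma metabolic_uminus:
  fixes A :: "'a::field mat"
  assumes A: "nondeg_form A"
  shows "metabolic (orth_sum A (- A))"
proof -
  obtain n where c: "A \<in> carrier_mat n n" using nondeg_form_carrier[OF A] by blast
  have uc: "- A \<in> carrier_mat n n" using c by simp
  define P where "P = (four_block_mat (1\<^sub>m n) (0\<^sub>m n n) (1\<^sub>m n) (1\<^sub>m n) :: 'a mat)"
  define Q where "Q = (four_block_mat (1\<^sub>m n) (0\<^sub>m n n) (- 1\<^sub>m n) (1\<^sub>m n) :: 'a mat)"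
  have P: "P \<in> carrier_mat (2 * n) (2 * n)" by (simp add: P_def mult_2)
  have Q: "Q \<in> carrier_mat (2 * n) (2 * n)" by (simp add: Q_def mult_2)
  have "P * Q = 1\<^sub>m (2 * n)"
    unfolding P_def Q_def
    by (subst mult_four_block_mat[of _ n n _ n _ n _ _ n _ n])
       (auto simp: mult_2 intro!: eq_matI)
  then have inv: "invertible_mat P" using P Q by (intro invertible_matI)
  have Pt: "transpose_mat P = four_block_mat (1\<^sub>m n) (1\<^sub>m n) (0\<^sub>m n n) (1\<^sub>m n)"
    unfolding P_def by (subst transpose_four_block_mat[of _ n n _ n _ n]) auto
  have S: "orth_sum A (- A) = four_block_mat A (0\<^sub>m n n) (0\<^sub>m n n) (- A)"
    using c by (simp add: orth_sum_def)
  have "transpose_mat P * orth_sum A (- A) = four_block_mat A (- A) (0\<^sub>m n n) (- A)"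
    unfolding Pt S using c uc
    by (subst mult_four_block_mat[of _ n n _ n _ n _ _ n _ n]) auto
  then have "transpose_mat P * orth_sum A (- A) * P = 
    four_block_mat (A + - A) (- A) (- A) (- A)"
    unfolding P_def using c uc
    by (simp, subst mult_four_block_mat[of _ n n _ n _ n _ _ n _ n]) auto
  then have "(transpose_mat P * orth_sum A (- A) * P) $$ (i, j) = 0" if "i < n" "j < n" for i j
    using that c by simp
  moreover have "isometric_forms (orth_sum A (- A)) (transpose_mat P * orth_sum A (- A) * P)"
    using c by (intro isometricI[OF _ P inv]) (auto simp: mult_2)
  ultimately show ?thesis
    unfolding metabolic_def using orth_sum_nondeg[OF A uminus_nondeg[OF A]] c
    by (intro conjI exI[of _ n] exI[of _ "transpose_mat P * orth_sum A (- A) * P"]) (auto simp: mult_2)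
qed

lemma witt_zero_uminus:
  assumes "nondeg_form A"
  shows "witt_equiv (orth_sum A (- A)) (1\<^sub>m 0)" "witt_equiv (orth_sum (- A) A) (1\<^sub>m 0)"
proof -
  show *: "witt_equiv (orth_sum A (- A)) (1\<^sub>m 0)"
    by (rule metabolic_witt_zero[OF metabolic_uminus[OF assms]])
  show "witt_equiv (orth_sum (- A) A) (1\<^sub>m 0)"
    using isometric_witt_equiv[OF orth_sum_nondeg orth_sum_comm] uminus_nondeg assms
      witt_equiv_trans[OF _ *] by blast
qed

lemma witt_equiv_uminus:
  assumes "witt_equiv A B"
  shows "witt_equiv (- A) (- B)"
proof -
  have nd: "nondeg_form A" "nondeg_form B" using assms by (auto simp: witt_equiv_def)
  note nd' = uminus_nondeg[OF nd(1)] uminus_nondeg[OF nd(2)]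
  have "witt_equiv (orth_sum (orth_sum (- A) A) (- B)) (orth_sum (1\<^sub>m 0) (- B))"
    by (intro witt_equiv_orth_sum witt_zero_uminus witt_equiv_refl nd nd')
  then have 1: "witt_equiv (orth_sum (- A) (orth_sum A (- B))) (- B)"
    by (simp add: orth_sum_assoc)
  have "witt_equiv (orth_sum A (- B)) (1\<^sub>m 0)"
    by (rule witt_equiv_trans[OF witt_equiv_orth_sum[OF assms witt_equiv_refl[OF nd'(2)]] 
          witt_zero_uminus(1)[OF nd(2)]])
  then have "witt_equiv (orth_sum (- A) (orth_sum A (- B))) (orth_sum (- A) (1\<^sub>m 0))"
    by (intro witt_equiv_orth_sum witt_equiv_refl nd')
  then have 2: "witt_equiv (orth_sum (- A) (orth_sum A (- B))) (- A)" by simp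
  show ?thesis by (rule witt_equiv_trans[OF witt_equiv_sym[OF 2] 1])
qed

lemma witt_equiv_parity:
  assumes "witt_equiv A B"
  shows "even (dim_row A) \<longleftrightarrow> even (dim_row B)"
proof -
  obtain M N where MN: "metabolic M" "metabolic N" "isometric_forms (orth_sum A M) (orth_sum B N)"
    using assms by (auto simp: witt_equiv_def)
  have "even (dim_row M)" "even (dim_row N)" using MN by (auto simp: metabolic_def)
  moreover have "dim_row B + dim_row N = dim_row A + dim_row M" using isometric_dim[OF MN(3)] by simp
  ultimately show ?thesis by (metis even_add)
qed

subsection \<open>The Witt ring\<close>

quotient_type (overloaded) 'a witt = "'a::field mat" / partial: witt_equiv
proof (rule part_equivpI)
  show "\<exists>A :: 'a mat. witt_equiv A A" using witt_equiv_refl unit_form_nondeg by blast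
  show "symp (witt_equiv :: 'a mat \<Rightarrow> _)" using witt_equiv_sym by (blast intro: sympI)
  show "transp (witt_equiv :: 'a mat \<Rightarrow> _)" using witt_equiv_trans by (blast intro: transpI)
qed

instantiation witt :: (field) comm_ring_1
begin

lift_definition zero_witt :: "'a witt" is "1\<^sub>m 0"
  by (simp add: witt_equiv_refl unit_form_nondeg)

lift_definition one_witt :: "'a witt" is "1\<^sub>m 1"
  by (simp add: witt_equiv_refl unit_form_nondeg)

lift_definition plus_witt :: "'a witt \<Rightarrow> 'a witt \<Rightarrow> 'a witt" is orth_sum
  by (rule witt_equiv_orth_sum)

lift_definition uminus_witt :: "'a witt \<Rightarrow> 'a witt" is uminus
  by (rule witt_equiv_uminus)

definition minus_witt :: "'a witt \<Rightarrow> 'a witt \<Rightarrow> 'a witt" where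
  "minus_witt x y = x + (- y)"

lift_definition times_witt :: "'a witt \<Rightarrow> 'a witt \<Rightarrow> 'a witt" is tensor_form
  by (rule witt_equiv_tensor)

instance
proof
  fix a b c :: "'a witt"
  have [simp]: "witt_equiv A A \<longleftrightarrow> nondeg_form A" for A :: "'a mat"
    using witt_equiv_refl by (auto simp: witt_equiv_def)
  show "a + b + c = a + (b + c)"
    by transfer (simp add: orth_sum_assoc orth_sum_nondeg)
  show "a + b = b + a"
    by transfer (simp add: isometric_witt_equiv orth_sum_comm orth_sum_nondeg)
  show "0 + a = a" by transfer simp
  show "- a + a = 0"
    by transfer (simp add: witt_zero_uminus)
  show "a - b = a + - b" by (simp add: minus_witt_def)
  show "a * b * c = a * (b * c)"
    by transfer (simp add: tensor_assoc tensor_nondeg)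
  show "a * b = b * a"
    by transfer (simp add: isometric_witt_equiv tensor_comm tensor_nondeg)
  show "1 * a = a" by transfer (simp add: tensor_one_left[simplified])
  show "(a + b) * c = a * c + b * c"
    by transfer (simp add: tensor_distrib tensor_nondeg orth_sum_nondeg)
  show "(0 :: 'a witt) \<noteq> 1"
    by transfer (use witt_equiv_parity in fastforce)
qed

end

lemma line_nondeg:
  fixes a :: "'a::field"
  assumes "a \<noteq> 0"
  shows "nondeg_form (mat 1 1 (\<lambda>_. a))"
proof -
  have "mat 1 1 (\<lambda>_. a) * mat 1 1 (\<lambda>_. inverse a) = 1\<^sub>m 1"
    using assms by (intro eq_matI) (auto simp: scalar_prod_def)
  then have "invertible_mat (mat 1 1 (\<lambda>_. a))"
    by (intro invertible_matI[of _ 1 "mat 1 1 (\<lambda>_. inverse a)"]) auto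
  moreover have "transpose_mat (mat 1 1 (\<lambda>_. a)) = mat 1 1 (\<lambda>_. a)" by (intro eq_matI) auto
  ultimately show ?thesis by (simp add: nondeg_form_def)
qed

text \<open>The class \<open>[a]\<close> of \<open>\<langle>a\<rangle>\<close>, extended by \<open>[0] = 0\<close>.\<close>

lift_definition witt_line :: "'a::field \<Rightarrow> 'a witt" is
  "\<lambda>a. if a = 0 then 1\<^sub>m 0 else mat 1 1 (\<lambda>_. a)"
  using line_nondeg unit_form_nondeg by (intro witt_equiv_refl) auto

text \<open>
  \<^const>\<open>abs_witt\<close> sends a nondegenerate form to its Witt class; it is unspecified on other matrices.
\<close>

definition witt_norm :: "'a::field witt \<Rightarrow> nat" where
  "witt_norm x =
     (THE n. \<exists>A. nondeg_form A \<and> anisotropic A \<and> abs_witt A = x \<and> dim_row A = n)"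

definition fund_ideal :: "'a::field witt set" where
  "fund_ideal = {abs_witt A | A. nondeg_form A \<and> even (dim_row A)}"

definition fund_ideal_sq :: "'a::field witt set" where
  "fund_ideal_sq = {\<Sum>(x, y)\<leftarrow>ps. x * y | ps. set ps \<subseteq> fund_ideal \<times> fund_ideal}"


section \<open>The Witt cocycle on \<open>SL(2,K)\<close>\<close>

definition SL2 :: "'a::field mat monoid" where
  "SL2 = \<lparr>carrier = {m \<in> carrier_mat 2 2. det m = 1}, monoid.mult = (*), one = 1\<^sub>m 2\<rparr>"

text \<open>Matrix indices start at \<open>0\<close>, so the \<open>(2,1)\<close> entry of \<open>m\<close> is \<open>m $$ (1, 0)\<close>.\<close>

definition witt_cocycle :: "'a::field mat \<Rightarrow> 'a mat \<Rightarrow> 'a witt" where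
  "witt_cocycle a b = witt_line (- (a $$ (1, 0)) * (a * b) $$ (1, 0) * b $$ (1, 0))"

definition witt_extension :: "('a::field mat \<times> 'a witt) monoid" where
  "witt_extension =
     \<lparr>carrier = carrier SL2 \<times> UNIV,
      monoid.mult = (\<lambda>(g, u) (h, v). (g * h, u + v + witt_cocycle g h)),
      one = (1\<^sub>m 2, 0)\<rparr>"

definition commutator :: "('b, 'c) monoid_scheme \<Rightarrow> 'b \<Rightarrow> 'b \<Rightarrow> 'b" where
  "commutator G x y = x \<otimes>\<^bsub>G\<^esub> y \<otimes>\<^bsub>G\<^esub> inv\<^bsub>G\<^esub> x \<otimes>\<^bsub>G\<^esub> inv\<^bsub>G\<^esub> y"


section \<open>Surface groups and flat bundles\<close>

text \<open>
  Group presentations: a letter \<open>(x, True)\<close> stands for the generator \<open>x\<close> and \<open>(x, False)\<close> for its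
  inverse. The elements of the presented group are the classes of words under the congruence
  generated by free cancellation and the relators.
\<close>

definition words :: "'x set \<Rightarrow> ('x \<times> bool) list set" where
  "words S = lists (S \<times> UNIV)"

inductive presented_eq :: "'x set \<Rightarrow> ('x \<times> bool) list set \<Rightarrow>
    ('x \<times> bool) list \<Rightarrow> ('x \<times> bool) list \<Rightarrow> bool" for S R where
  refl: "w \<in> words S \<Longrightarrow> presented_eq S R w w"
| sym: "presented_eq S R v w \<Longrightarrow> presented_eq S R w v"
| trans: "presented_eq S R u v \<Longrightarrow> presented_eq S R v w \<Longrightarrow> presented_eq S R u w"
| cancel: "u \<in> words S \<Longrightarrow> v \<in> words S \<Longrightarrow> x \<in> S \<Longrightarrow>
    presented_eq S R (u @ [(x, e), (x, \<not> e)] @ v) (u @ v)"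
| relator: "u \<in> words S \<Longrightarrow> v \<in> words S \<Longrightarrow> r \<in> R \<Longrightarrow> presented_eq S R (u @ r @ v) (u @ v)"

definition word_class :: "'x set \<Rightarrow> ('x \<times> bool) list set \<Rightarrow> ('x \<times> bool) list \<Rightarrow> ('x \<times> bool) list set"
  where "word_class S R w = {v. presented_eq S R w v}"

definition presented_group :: "'x set \<Rightarrow> ('x \<times> bool) list set \<Rightarrow> ('x \<times> bool) list set monoid" where
  "presented_group S R =
     \<lparr>carrier = word_class S R ` words S,
      monoid.mult = (\<lambda>X Y. \<Union>x\<in>X. \<Union>y\<in>Y. word_class S R (x @ y)),
      one = word_class S R []\<rparr>"

datatype surface_loop = LoopA nat | LoopB nat

definition surface_loops :: "nat \<Rightarrow> surface_loop set" where
  "surface_loops g = LoopA ` {..<g} \<union> LoopB ` {..<g}"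

definition surface_relator :: "nat \<Rightarrow> (surface_loop \<times> bool) list" where
  "surface_relator g = concat (map
     (\<lambda>i. [(LoopA i, True), (LoopB i, True), (LoopA i, False), (LoopB i, False)]) [0..<g])"

text \<open>
  The fundamental group of the closed connected oriented surface of genus \<open>g\<close>, with respect to
  loops \<open>a\<^sub>i, b\<^sub>i\<close> (here \<open>i < g\<close>) that cut the surface into a \<open>4g\<close>-gon with counterclockwise boundary
  \<open>\<Prod>\<^sub>i [a\<^sub>i, b\<^sub>i]\<close>.
\<close>

definition surface_group :: "nat \<Rightarrow> (surface_loop \<times> bool) list set monoid" where
  "surface_group g = presented_group (surface_loops g) {surface_relator g}"

definition loop_class :: "nat \<Rightarrow> surface_loop \<Rightarrow> (surface_loop \<times> bool) list set" where
  "loop_class g x = word_class (surface_loops g) {surface_relator g} [(x, True)]"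

text \<open>
  A flat \<open>SL(2,K)\<close>-bundle over this surface is given by its monodromy
  \<open>\<rho> \<in> hom (surface_group g) SL2\<close>, unique up to conjugation. Its Witt class is the second component
  of the product of the commutators \<open>[(A\<^sub>i, 0), (B\<^sub>i, 0)]\<close> in the central extension, where
  \<open>A\<^sub>i = \<rho> a\<^sub>i\<close> and \<open>B\<^sub>i = \<rho> b\<^sub>i\<close>.
\<close>

definition flat_bundle_witt_class ::
    "nat \<Rightarrow> ((surface_loop \<times> bool) list set \<Rightarrow> 'a::field mat) \<Rightarrow> 'a witt" where
  "flat_bundle_witt_class g \<rho> =
     snd (foldr (\<lambda>i p. commutator witt_extension
                    (\<rho> (loop_class g (LoopA i)), 0) (\<rho> (loop_class g (LoopB i)), 0)
                  \<otimes>\<^bsub>witt_extension\<^esub> p)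
            [0..<g] \<one>\<^bsub>witt_extension\<^esub>)"

end

theory Submission
  imports Defs
begin

text \<open>
  In the Witt ring \<open>[a s\<^sup>2] = [a]\<close>, \<open>[a] + [- a] = 0\<close> and \<open>[a] + [b] = [a + b] + [a b (a + b)]\<close>. With these
  relations a sum of lines \<open>[a]\<close> whose diagonal form is isotropic can be shortened by two
  (\<open>isotropic_reduce\<close>), and an anisotropic form has the least dimension in its Witt class
  (\<open>anisotropic_dim_le\<close>). Hence the norm is the least number of lines with a given sum, in every
  characteristic.

  For (a), every value of the cocycle is a single line. A product of \<open>g\<close> commutators is computed by a fan
  triangulation of the \<open>4g\<close>-gon: three lines for each commutator and \<open>g - 1\<close> for the multiplications between
  them, and the line of the last step vanishes because the product is the identity. So \<open>4 g - 2\<close> lines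
  suffice (\<open>closed_commutator_product_eq_line_sum\<close>).

  For (b), an element of \<open>I\<^sup>2\<close> of norm at most \<open>4 n\<close>, where \<open>n = g - 1\<close>, is a sum of exactly \<open>4 n\<close> lines
  \<open>[p\<^sub>1], [p\<^sub>2], \<dots>\<close> for which the product of all \<open>p\<^sub>i\<close> is a square, by the discriminant
  (\<open>fund_ideal_sq_line_sum_of_norm_le\<close>). One commutator realises any three lines
  (\<open>three_line_commutator\<close>), and conjugation by an upper unipotent matrix, which changes neither the
  class nor the \<open>(2,1)\<close> entry of a commutator, makes its multiplication with the others contribute any
  prescribed fourth line. So \<open>n\<close> commutators realise \<open>4 n - 1\<close> arbitrary lines, and the \<open>(2,1)\<close>
  entry of their product \<open>m\<close> is minus the product of these (\<open>exists_commutator_product\<close>). Over an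
  infinite field every matrix in \<open>SL(2,K)\<close> with \<open>(2,1)\<close> entry \<open>c \<noteq> 0\<close> is itself a commutator with the single
  line \<open>[c]\<close> (\<open>commutator_with_one_line\<close>). The commutator equal to \<open>m\<inverse>\<close> closes the surface, and its
  line is the missing one, since the two entries agree up to a square.
\<close>

section \<open>Linear functionals on a coordinate space\<close>

text \<open>
  On the hyperplane \<open>f = 0\<close> the coordinate \<open>j\<^sub>0\<close> is a function of the others; here \<open>v'\<close> is the
  point of the hyperplane over \<open>v\<close>, and the coefficients on the right are those of \<open>h\<close> restricted to it.
\<close>

lemma eliminate_coordinate:
  fixes f h v :: "'j \<Rightarrow> 'a::field"
  assumes J: "finite J" "j\<^sub>0 \<in> J" and f: "f j\<^sub>0 \<noteq> 0"
  defines "v' \<equiv> v(j\<^sub>0 := - (\<Sum>j\<in>J - {j\<^sub>0}. f j * v j) / f j\<^sub>0)"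
  shows "(\<Sum>j\<in>J. h j * v' j) = (\<Sum>j\<in>J - {j\<^sub>0}. (h j - h j\<^sub>0 / f j\<^sub>0 * f j) * v j)"
proof -
  have "(\<Sum>j\<in>J. h j * v' j) = h j\<^sub>0 * v' j\<^sub>0 + (\<Sum>j\<in>J - {j\<^sub>0}. h j * v' j)"
    using J by (simp add: sum.remove)
  also have "(\<Sum>j\<in>J - {j\<^sub>0}. h j * v' j) = (\<Sum>j\<in>J - {j\<^sub>0}. h j * v j)"
    by (intro sum.cong) (auto simp: v'_def)
  also have "h j\<^sub>0 * v' j\<^sub>0 = - (\<Sum>j\<in>J - {j\<^sub>0}. h j\<^sub>0 / f j\<^sub>0 * f j * v j)"
    by (simp add: v'_def sum_distrib_left mult.assoc sum_divide_distrib sum_negf)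
  finally show ?thesis
    by (simp add: sum_subtractf left_diff_distrib)
qed

text \<open>
  Each functional is used to eliminate one coordinate.
\<close>

lemma card_le_of_trivial_common_kernel:
  fixes h :: "'i \<Rightarrow> 'j \<Rightarrow> 'a::field"
  assumes "finite I" "finite J"
    and "\<And>v. (\<And>i. i \<in> I \<Longrightarrow> (\<Sum>j\<in>J. h i j * v j) = 0) \<Longrightarrow> (\<And>j. j \<in> J \<Longrightarrow> v j = 0)"
  shows "card J \<le> card I"
  using assms
proof (induction I arbitrary: J h rule: finite_induct)
  case empty
  have "J = {}" using empty(2)[of "\<lambda>_. 1"] by auto
  then show ?case by simp
next
  case (insert i I J h)
  show ?case
  proof (cases "\<forall>j\<in>J. h i j = 0")
    case True
    then have "(\<Sum>j\<in>J. h i j * v j) = 0" for v by simp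
    then have "card J \<le> card I"
      using insert.prems(2) by (intro insert.IH[of J h, OF insert.prems(1)]) blast
    then show ?thesis using insert.hyps by simp
  next
    case False
    then obtain k where k: "k \<in> J" "h i k \<noteq> 0" by blast
    define h' where "h' i' j = h i' j - h i' k / h i k * h i j" for i' j
    have "card (J - {k}) \<le> card I"
    proof (rule insert.IH[of _ h'])
      fix v j assume v: "\<And>i'. i' \<in> I \<Longrightarrow> (\<Sum>j\<in>J - {k}. h' i' j * v j) = 0" and j: "j \<in> J - {k}"
      define v' where "v' = v(k := - (\<Sum>j\<in>J - {k}. h i j * v j) / h i k)"
      have e: "(\<Sum>j\<in>J. h i' j * v' j) = (\<Sum>j\<in>J - {k}. h' i' j * v j)" for i'
        unfolding v'_def h'_def by (rule eliminate_coordinate[where f = "h i", OF insert.prems(1) k])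
      have "h' i j = 0" for j using k by (simp add: h'_def)
      then have "(\<Sum>j\<in>J. h i' j * v' j) = 0" if "i' \<in> insert i I" for i'
        using that v unfolding e by auto
      then have "v' j = 0" using insert.prems(2) j by blast
      then show "v j = 0" using j by (simp add: v'_def)
    qed (use insert.prems in auto)
    then show ?thesis using insert.hyps k insert.prems by simp
  qed
qed

text \<open>
  The dimension count behind the bound for totally isotropic subspaces. Let \<open>F\<close> and \<open>G\<close> be the linear
  maps from \<open>K\<^sup>J\<close> to \<open>K\<^sup>I\<close> with coordinates \<open>f\<close> and \<open>g\<close>. The hypotheses say that \<open>G\<close> maps the kernel of \<open>F\<close>
  injectively into the annihilator of the image of \<open>F\<close>, so \<open>|J| - rank F \<le> |I| - rank F\<close>.
  The proof removes a functional \<open>f i \<noteq> 0\<close> together with one coordinate: on the hyperplane \<open>f i = 0\<close> the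
  last hypothesis, applied to a \<open>w\<close> off the hyperplane, makes \<open>g i\<close> redundant. When no \<open>f i\<close>
  is left, the \<open>g i\<close> alone have trivial common kernel.
\<close>

lemma card_le_of_isotropic_functionals:
  fixes f g :: "'i \<Rightarrow> 'j \<Rightarrow> 'a::field"
  assumes "finite I" "finite J"
    and "\<And>v j. (\<And>i. i \<in> I \<Longrightarrow> (\<Sum>j\<in>J. f i j * v j) = 0) \<Longrightarrow> (\<And>i. i \<in> I \<Longrightarrow> (\<Sum>j\<in>J. g i j * v j) = 0)
       \<Longrightarrow> j \<in> J \<Longrightarrow> v j = 0"
    and "\<And>v w. (\<And>i. i \<in> I \<Longrightarrow> (\<Sum>j\<in>J. f i j * v j) = 0)
       \<Longrightarrow> (\<Sum>i\<in>I. (\<Sum>j\<in>J. f i j * w j) * (\<Sum>j\<in>J. g i j * v j)) = 0"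
  shows "card J \<le> card I"
  using assms
proof (induction "card I" arbitrary: I J f g rule: less_induct)
  case (less I J f g)
  show ?case
  proof (cases "\<forall>i\<in>I. \<forall>j\<in>J. f i j = 0")
    case True
    then have "(\<Sum>j\<in>J. f i j * v j) = 0" if "i \<in> I" for i v using that by simp
    then show ?thesis
      using less.prems(3) by (intro card_le_of_trivial_common_kernel[OF less.prems(1,2), of g]) blast
  next
    case False
    then obtain i k where i: "i \<in> I" and k: "k \<in> J" "f i k \<noteq> 0" by blast
    define el where "el h j = h j - h k / f i k * f i j" for h :: "'j \<Rightarrow> 'a" and j
    define ext where "ext v = v(k := - (\<Sum>j\<in>J - {k}. f i j * v j) / f i k)" for v :: "'j \<Rightarrow> 'a"
    have e: "(\<Sum>j\<in>J. h j * ext v j) = (\<Sum>j\<in>J - {k}. el h j * v j)" for h v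
      unfolding ext_def el_def by (rule eliminate_coordinate[where f = "f i", OF less.prems(2) k])
    have "el (f i) j = 0" for j using k by (simp add: el_def)
    then have fi: "(\<Sum>j\<in>J. f i j * ext v j) = 0" for v unfolding e by simp
    have fI: "(\<Sum>j\<in>J. f i' j * ext v j) = 0"
      if "\<And>i'. i' \<in> I - {i} \<Longrightarrow> (\<Sum>j\<in>J - {k}. el (f i') j * v j) = 0" "i' \<in> I" for v i'
      using that fi e by (cases "i' = i") auto
    have c: "card (I - {i}) < card I" using less.prems(1) i by (rule card_Diff1_less)
    have "card (J - {k}) \<le> card (I - {i})"
    proof (rule less.hyps[OF c, of _ "\<lambda>i. el (f i)" "\<lambda>i. el (g i)"])
      fix v w :: "'j \<Rightarrow> 'a"
      assume fv: "\<And>i'. i' \<in> I - {i} \<Longrightarrow> (\<Sum>j\<in>J - {k}. el (f i') j * v j) = 0"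
      note z = less.prems(4)[of "ext v", OF fI[OF fv]]
      show "(\<Sum>i\<in>I - {i}. (\<Sum>j\<in>J - {k}. el (f i) j * w j) * (\<Sum>j\<in>J - {k}. el (g i) j * v j)) = 0"
        using z[of "ext w"] sum.remove[OF less.prems(1) i, of "\<lambda>i. (\<Sum>j\<in>J. f i j * ext w j) * (\<Sum>j\<in>J. g i j * ext v j)"]
        by (simp add: fi e)
      fix j
      assume gv: "\<And>i'. i' \<in> I - {i} \<Longrightarrow> (\<Sum>j\<in>J - {k}. el (g i') j * v j) = 0" and j: "j \<in> J - {k}"
      have w: "(\<Sum>j\<in>J. h j * (if j = k then 1 else 0)) = h k" for h :: "'j \<Rightarrow> 'a"
        using less.prems(2) k(1) by (simp add: if_distrib cong: if_cong)
      have "(\<Sum>i'\<in>I - {i}. f i' k * (\<Sum>j\<in>J. g i' j * ext v j)) = 0"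
        using gv e by (intro sum.neutral) auto
      then have "f i k * (\<Sum>j\<in>J. g i j * ext v j) = 0"
        using z[of "\<lambda>j. if j = k then 1 else 0"] sum.remove[OF less.prems(1) i, of "\<lambda>i. f i k * (\<Sum>j\<in>J. g i j * ext v j)"]
        unfolding w by simp
      then have "(\<Sum>j\<in>J. g i' j * ext v j) = 0" if "i' \<in> I" for i'
        using that gv e k by (cases "i' = i") auto
      then have "ext v j = 0" using less.prems(3)[of "ext v" j] fI[OF fv] j by blast
      then show "v j = 0" using j by (simp add: ext_def)
    qed (use less.prems in auto)
    then show ?thesis
      using card_Suc_Diff1[OF less.prems(1) i] card_Suc_Diff1[OF less.prems(2) k(1)] by linarith
  qed
qed

section \<open>Witt classes of diagonal forms\<close>

definition mat2 :: "'a \<Rightarrow> 'a \<Rightarrow> 'a \<Rightarrow> 'a \<Rightarrow> 'a mat" where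
  "mat2 a b c d = mat 2 2 (\<lambda>(i, j). if i = 0 then if j = 0 then a else b else if j = 0 then c else d)"

lemma mat2_carrier [simp]: "mat2 a b c d \<in> carrier_mat 2 2"
  by (simp add: mat2_def)

lemma mat2_dim [simp]: "dim_row (mat2 a b c d) = 2" "dim_col (mat2 a b c d) = 2"
  by (simp_all add: mat2_def)

lemma mat2_index [simp]:
  "mat2 a b c d $$ (0, 0) = a" "mat2 a b c d $$ (0, Suc 0) = b"
  "mat2 a b c d $$ (Suc 0, 0) = c" "mat2 a b c d $$ (Suc 0, Suc 0) = d"
  by (simp_all add: mat2_def)

lemma eq_mat2:
  assumes "m \<in> carrier_mat 2 2"
  shows "m = mat2 (m $$ (0, 0)) (m $$ (0, 1)) (m $$ (1, 0)) (m $$ (1, 1))"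
  using assms by (intro eq_matI) (auto simp: mat2_def less_2_cases_iff)

lemma mat2_eq_iff: "mat2 a b c d = mat2 a' b' c' d' \<longleftrightarrow> a = a' \<and> b = b' \<and> c = c' \<and> d = d'"
  by (metis mat2_index)

lemma mat2_mult [simp]:
  "mat2 a b c d * mat2 a' b' c' d' =
     mat2 (a * a' + b * c') (a * b' + b * d') (c * a' + d * c') (c * b' + d * (d' :: 'a::comm_ring_1))"
  by (intro eq_matI)
     (auto simp: mat2_def scalar_prod_def less_2_cases_iff atLeast0_lessThan_Suc numeral_2_eq_2)

lemma one_mat2: "1\<^sub>m 2 = mat2 1 0 0 1"
  by (intro eq_matI) (auto simp: mat2_def)

lemma transpose_mat2: "transpose_mat (mat2 a b c d) = mat2 a c b d"
  by (intro eq_matI) (auto simp: mat2_def)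

definition line_form :: "'a::field \<Rightarrow> 'a mat" where
  "line_form a = mat 1 1 (\<lambda>_. a)"

lemma line_form_dim [simp]: "dim_row (line_form a) = 1" "dim_col (line_form a) = 1"
  by (simp_all add: line_form_def)

lemma line_form_index [simp]: "line_form a $$ (0, 0) = a"
  by (simp add: line_form_def)

lemma line_form_nondeg: "a \<noteq> 0 \<Longrightarrow> nondeg_form (line_form a)"
  unfolding line_form_def by (rule line_nondeg)

fun diag_form :: "'a::field list \<Rightarrow> 'a mat" where
  "diag_form [] = 1\<^sub>m 0"
| "diag_form (a # as) = orth_sum (line_form a) (diag_form as)"

definition line_sum :: "'a::field list \<Rightarrow> 'a witt" where
  "line_sum as = (\<Sum>a\<leftarrow>as. witt_line a)"

lemma line_sum_simps [simp]:
  "line_sum [] = 0" "line_sum (a # as) = witt_line a + line_sum as"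
  "line_sum (as @ bs) = line_sum as + line_sum bs"
  by (simp_all add: line_sum_def)

lemma dim_diag_form [simp]:
  "dim_row (diag_form as) = length as" "dim_col (diag_form as) = length as"
  by (induction as) auto

lemma index_diag_form:
  "i < length as \<Longrightarrow> j < length as \<Longrightarrow> diag_form as $$ (i, j) = (if i = j then as ! i else 0)"
proof (induction as arbitrary: i j)
  case (Cons a as)
  then show ?case by (cases i; cases j) (auto simp: orth_sum_index)
qed simp

lemma nondeg_diag_form: "0 \<notin> set as \<Longrightarrow> nondeg_form (diag_form as)"
  by (induction as) (auto intro: orth_sum_nondeg line_form_nondeg simp: unit_form_nondeg)

lemma abs_witt_eq_iff:
  assumes "nondeg_form A" "nondeg_form B"
  shows "abs_witt A = abs_witt B \<longleftrightarrow> witt_equiv A B"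
  using Quotient_rel[OF Quotient_witt, of A B] witt_equiv_refl[OF assms(1)] witt_equiv_refl[OF assms(2)]
  by simp

lemma abs_witt_orth_sum:
  "nondeg_form A \<Longrightarrow> nondeg_form B \<Longrightarrow> abs_witt (orth_sum A B) = abs_witt A + abs_witt B"
  by (simp add: plus_witt.abs_eq witt_equiv_refl)

lemma abs_witt_zero: "abs_witt (1\<^sub>m 0) = 0"
  by (simp add: zero_witt_def)

lemma abs_witt_line: "a \<noteq> 0 \<Longrightarrow> abs_witt (line_form a) = witt_line a"
  unfolding line_form_def by (simp add: witt_line_def)

lemma witt_line_zero [simp]: "witt_line 0 = 0"
  by transfer (simp add: witt_equiv_refl[OF unit_form_nondeg])

lemma abs_witt_isometric:
  "nondeg_form A \<Longrightarrow> isometric_forms A B \<Longrightarrow> abs_witt A = abs_witt B"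
  by (simp add: abs_witt_eq_iff isometric_nondeg isometric_witt_equiv)

lemma abs_witt_metabolic: "metabolic M \<Longrightarrow> abs_witt M = 0"
  by (metis abs_witt_eq_iff abs_witt_zero metabolic_nondeg metabolic_witt_zero unit_form_nondeg)

lemma abs_witt_diag_form: "0 \<notin> set as \<Longrightarrow> abs_witt (diag_form as) = line_sum as"
  by (induction as)
     (auto simp: abs_witt_zero abs_witt_orth_sum abs_witt_line line_form_nondeg nondeg_diag_form)

lemma witt_line_mult_square:
  fixes a s :: "'a::field"
  assumes "s \<noteq> 0"
  shows "witt_line (a * s * s) = witt_line a"
proof (cases "a = 0")
  case False
  have "isometric_forms (line_form a) (line_form (a * s * s))"
  proof (rule isometricI[where n = 1 and P = "line_form s"])
    show "invertible_mat (line_form s)"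
      using line_form_nondeg[OF assms] by (simp add: nondeg_form_def)
  qed (auto simp: line_form_def scalar_prod_def)
  then show ?thesis
    using abs_witt_isometric[OF line_form_nondeg[OF False]] False assms by (simp flip: abs_witt_line)
qed simp

lemma witt_line_cong_square:
  fixes a b t :: "'a::field"
  assumes "a * b = t * t"
  shows "a \<noteq> 0 \<Longrightarrow> b \<noteq> 0 \<Longrightarrow> witt_line a = witt_line b"
proof -
  assume nz: "a \<noteq> 0" "b \<noteq> 0"
  then have "b = a * (t / a) * (t / a)" using assms by (simp add: field_simps)
  moreover have "t / a \<noteq> 0" using nz assms by auto
  ultimately show ?thesis using witt_line_mult_square by metis
qed

lemma witt_line_times: "witt_line a * witt_line b = witt_line (a * b)"
proof (cases "a = 0 \<or> b = 0")
  case False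
  have "tensor_form (line_form a) (line_form b) = line_form (a * b)"
    by (intro eq_matI) (auto simp: tensor_index)
  then show ?thesis
    using False times_witt.abs_eq[OF witt_equiv_refl witt_equiv_refl, OF line_form_nondeg line_form_nondeg, of a b]
    by (simp add: abs_witt_line)
qed auto

text \<open>
  The vectors \<open>(1, 1)\<close> and \<open>(- b, a)\<close> form an orthogonal basis of \<open>\<langle>a, b\<rangle>\<close>. This is the move by which
  the partial sums of an isotropic vector are collected in a single entry.
\<close>

lemma witt_line_add:
  fixes a b :: "'a::field"
  assumes ab: "a + b \<noteq> 0"
  shows "witt_line a + witt_line b = witt_line (a + b) + witt_line (a * b * (a + b))"
proof (cases "a = 0 \<or> b = 0")
  case False
  define P where "P = mat2 1 (- b) 1 a"
  have "P * mat2 (a / (a + b)) (b / (a + b)) (- 1 / (a + b)) (1 / (a + b)) = 1\<^sub>m 2"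
    using ab by (simp add: P_def one_mat2 mat2_eq_iff divide_simps)
  then have inv: "invertible_mat P"
    by (rule invertible_matI[where n = 2, rotated 2]) (auto simp: P_def)
  have diag2: "diag_form [c, d] = mat2 c 0 0 d" for c d :: 'a
    by (subst eq_mat2) (auto simp: index_diag_form simp del: diag_form.simps)
  have "diag_form [a + b, a * b * (a + b)] = transpose_mat P * diag_form [a, b] * P"
    unfolding diag2 P_def transpose_mat2 mat2_mult by (simp add: mat2_eq_iff algebra_simps)
  then have iso: "isometric_forms (diag_form [a, b]) (diag_form [a + b, a * b * (a + b)])"
    by (intro isometricI[where n = 2 and P = P] inv) (auto simp: P_def)
  have "nondeg_form (diag_form [a, b])" using False by (intro nondeg_diag_form) auto
  from abs_witt_isometric[OF this iso] show ?thesis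
    using False ab by (subst (asm) (1 2) abs_witt_diag_form) auto
qed auto

lemma witt_line_uminus: "witt_line (- a) = - witt_line (a::'a::field)"
proof (cases "a = 0")
  case False
  have "- line_form a = line_form (- a)" by (intro eq_matI) auto
  then have "witt_line a + witt_line (- a) = 0"
    using abs_witt_metabolic[OF metabolic_uminus[OF line_form_nondeg[OF False]]] False
    by (simp add: abs_witt_orth_sum line_form_nondeg abs_witt_line)
  then show ?thesis by (simp add: add_eq_0_iff)
qed simp

section \<open>Reduction of diagonal forms to anisotropic ones\<close>

definition isotropic_list :: "'a::field list \<Rightarrow> bool" where
  "isotropic_list as \<longleftrightarrow>
     (\<exists>vs. length vs = length as \<and> (\<exists>v\<in>set vs. v \<noteq> 0) \<and> (\<Sum>(a, v)\<leftarrow>zip as vs. a * v * v) = 0)"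

text \<open>
  The value \<open>s\<close> collects the partial sums of \<open>\<Sum> a\<^sub>i v\<^sub>i\<^sup>2\<close>. While the next partial sum \<open>s + b\<close> is nonzero,
  \<open>\<langle>s, b\<rangle>\<close> is replaced by \<open>\<langle>s + b, s b (s + b)\<rangle>\<close>; when it vanishes, \<open>\<langle>s, - s\<rangle>\<close> splits off.
  The last equation tracks the discriminant: only the splitting changes it, by \<open>- 1\<close>.
\<close>

lemma isotropic_reduce_aux:
  fixes s :: "'a::field"
  assumes "length vs = length as" "s \<noteq> 0" "0 \<notin> set as" "s + (\<Sum>(a, v)\<leftarrow>zip as vs. a * v * v) = 0"
  shows "\<exists>cs t. 0 \<notin> set cs \<and> length cs + 1 = length as \<and> t \<noteq> 0 \<and>
     line_sum cs = witt_line s + line_sum as \<and> prod_list cs = - (s * prod_list as * t * t)"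
  using assms
proof (induction vs as arbitrary: s rule: list_induct2)
  case Nil
  then show ?case by simp
next
  case (Cons v vs a as)
  show ?case
  proof (cases "v = 0")
    case True
    then obtain cs t where cs: "0 \<notin> set cs" "length cs + 1 = length as" "t \<noteq> 0"
      "line_sum cs = witt_line s + line_sum as" "prod_list cs = - (s * prod_list as * t * t)"
      using Cons.IH[of s] Cons.prems by auto
    then show ?thesis using Cons.prems
      by (intro exI[of _ "a # cs"] exI[of _ t]) (auto simp: algebra_simps)
  next
    case False
    define b where "b = a * v * v"
    have b: "b \<noteq> 0" "witt_line b = witt_line a"
      using False Cons.prems witt_line_mult_square[of v a] by (auto simp: b_def)
    show ?thesis
    proof (cases "s + b = 0")
      case True
      then have "s = - b" by (simp add: add_eq_0_iff2)
      then show ?thesis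
        using b False Cons.prems
        by (intro exI[of _ as] exI[of _ "1 / (a * v)"])
           (auto simp: b_def witt_line_uminus field_simps)
    next
      case sb: False
      then obtain cs t where cs: "0 \<notin> set cs" "length cs + 1 = length as" "t \<noteq> 0"
        "line_sum cs = witt_line (s + b) + line_sum as" "prod_list cs = - ((s + b) * prod_list as * t * t)"
        using Cons.IH[of "s + b"] Cons.prems by (auto simp: b_def add.assoc)
      have "witt_line (s * b * (s + b)) + line_sum cs = witt_line s + line_sum (a # as)"
        using witt_line_add[OF sb] cs(4) b(2) by (simp add: algebra_simps)
      moreover have "prod_list (s * b * (s + b) # cs)
          = - (s * prod_list (a # as) * (v * (s + b) * t) * (v * (s + b) * t))"
        unfolding prod_list.Cons cs(5) b_def by (simp add: ac_simps)
      ultimately show ?thesis using cs sb b False Cons.prems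
        by (intro exI[of _ "s * b * (s + b) # cs"] exI[of _ "v * (s + b) * t"]) auto
    qed
  qed
qed

lemma isotropic_reduce:
  fixes as :: "'a::field list"
  assumes "isotropic_list as" "0 \<notin> set as"
  shows "\<exists>cs t. 0 \<notin> set cs \<and> length cs + 2 = length as \<and> t \<noteq> 0 \<and>
     line_sum cs = line_sum as \<and> prod_list cs = - (prod_list as * t * t)"
proof -
  obtain vs where vs: "length vs = length as" "\<exists>v\<in>set vs. v \<noteq> 0" "(\<Sum>(a, v)\<leftarrow>zip as vs. a * v * v) = 0"
    using assms(1) by (auto simp: isotropic_list_def)
  then show ?thesis using assms(2)
  proof (induction vs as rule: list_induct2)
    case (Cons v vs a as)
    show ?case
    proof (cases "v = 0")
      case True
      then obtain cs t where cs: "0 \<notin> set cs" "length cs + 2 = length as" "t \<noteq> 0"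
        "line_sum cs = line_sum as" "prod_list cs = - (prod_list as * t * t)"
        using Cons.IH Cons.prems by auto
      then show ?thesis using Cons.prems
        by (intro exI[of _ "a # cs"] exI[of _ t]) (auto simp: algebra_simps)
    next
      case False
      then obtain cs t where cs: "0 \<notin> set cs" "length cs + 1 = length as" "t \<noteq> 0"
        "line_sum cs = witt_line a + line_sum as"
        "prod_list cs = - (a * v * v * prod_list as * t * t)"
        using isotropic_reduce_aux[OF Cons.hyps, of "a * v * v"] Cons.prems
        by (auto simp: witt_line_mult_square)
      then show ?thesis using False
        by (intro exI[of _ cs] exI[of _ "v * t"]) (auto simp: witt_line_mult_square[of v a] ac_simps)
    qed
  qed simp
qed

text \<open>
  Besides the existence of an anisotropic diagonal form, this contains the signed discriminant: removing
  \<open>k\<close> hyperbolic planes multiplies the product of the entries by \<open>(- 1)\<^sup>k\<close>, up to squares.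
\<close>

lemma anisotropic_reduction:
  fixes as :: "'a::field list"
  assumes "0 \<notin> set as"
  shows "\<exists>cs k t. 0 \<notin> set cs \<and> \<not> isotropic_list cs \<and> length as = length cs + 2 * k \<and> t \<noteq> 0 \<and>
     line_sum cs = line_sum as \<and> prod_list cs = (- 1) ^ k * prod_list as * t * t"
  using assms
proof (induction "length as" arbitrary: as rule: less_induct)
  case less
  show ?case
  proof (cases "isotropic_list as")
    case True
    obtain bs s where bs: "0 \<notin> set bs" "length bs + 2 = length as" "s \<noteq> 0"
      "line_sum bs = line_sum as" "prod_list bs = - (prod_list as * s * s)"
      using isotropic_reduce[OF True less.prems] by blast
    then obtain cs k t where cs: "0 \<notin> set cs" "\<not> isotropic_list cs" "length bs = length cs + 2 * k"
      "t \<noteq> 0" "line_sum cs = line_sum bs" "prod_list cs = (- 1) ^ k * prod_list bs * t * t"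
      using less.hyps[of bs] by auto
    then show ?thesis using bs
      by (intro exI[of _ cs] exI[of _ "Suc k"] exI[of _ "s * t"]) (auto simp: algebra_simps)
  next
    case False
    then show ?thesis using less.prems
      by (intro exI[of _ as] exI[of _ 0] exI[of _ 1]) auto
  qed
qed

section \<open>Every Witt class is a sum of lines\<close>

lemma unipotent_block_inverse:
  fixes X :: "'a::field mat"
  assumes "X \<in> carrier_mat k m"
  shows "four_block_mat (1\<^sub>m k) (- X) (0\<^sub>m m k) (1\<^sub>m m) *
    four_block_mat (1\<^sub>m k) X (0\<^sub>m m k) (1\<^sub>m m) = 1\<^sub>m (k + m)"
proof -
  have "1\<^sub>m k * X + (- X) * 1\<^sub>m m = 0\<^sub>m k m"
    using assms by (intro eq_matI) auto
  then show ?thesis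
    using assms by (subst mult_four_block_mat[of _ k k _ m _ m _ _ k _ m]) simp_all
qed

text \<open>
  A nondegenerate subspace \<open>E\<close> splits off: with \<open>A\<close> in block form \<open>(E, F; F\<^sup>t, G)\<close> its orthogonal
  complement has the Gram matrix \<open>S = G - F\<^sup>t E\<inverse> F\<close>.
\<close>

lemma nondeg_split:
  fixes A E :: "'a::field mat"
  assumes A: "nondeg_form A" "dim_row A = k + m" and E: "nondeg_form E" "dim_row E = k"
    and AE: "\<And>i j. i < k \<Longrightarrow> j < k \<Longrightarrow> A $$ (i, j) = E $$ (i, j)"
  obtains S where "nondeg_form S" "dim_row S = m" "abs_witt A = abs_witt E + abs_witt S"
proof -
  have Ac: "A \<in> carrier_mat (k + m) (k + m)" using nondeg_form_carrier[OF A(1)] A(2) by simp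
  have Ec: "E \<in> carrier_mat k k" using nondeg_form_carrier[OF E(1)] E(2) by simp
  obtain E' where E': "E' \<in> carrier_mat k k" "E * E' = 1\<^sub>m k" "E' * E = 1\<^sub>m k"
    using E Ec by (auto simp: nondeg_form_def elim: invertible_matE)
  have Et: "transpose_mat E = E" using E by (simp add: nondeg_form_def)
  have Et': "transpose_mat E' = E'"
  proof -
    have "transpose_mat E' * E = 1\<^sub>m k" using transpose_mult[OF Ec E'(1)] E'(2) Et by simp
    then have "transpose_mat E' * E * E' = E'" using E'(1) by simp
    moreover have "transpose_mat E' * E * E' = transpose_mat E'"
      using E' Ec by (simp add: assoc_square[where n = k])
    ultimately show ?thesis by simp
  qed
  define F where "F = mat k m (\<lambda>(i, j). A $$ (i, k + j))"
  define G where "G = mat m m (\<lambda>(i, j). A $$ (k + i, k + j))"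
  have F: "F \<in> carrier_mat k m" and G: "G \<in> carrier_mat m m" by (auto simp: F_def G_def)
  have Ft: "transpose_mat F \<in> carrier_mat m k" using F by simp
  have EF: "E' * F \<in> carrier_mat k m" using E' F by simp
  have blocks: "A = four_block_mat E F (transpose_mat F) G"
    using Ac Ec F G AE nondeg_form_sym[OF A(1)] A(2)
    by (intro eq_matI) (auto simp: F_def G_def)
  define S where "S = G + transpose_mat F * (- (E' * F))"
  have Sc: "S \<in> carrier_mat m m" using F E' G by (simp add: S_def)
  define P where "P = four_block_mat (1\<^sub>m k) (- (E' * F)) (0\<^sub>m m k) (1\<^sub>m m)"
  have P: "P \<in> carrier_mat (k + m) (k + m)" by (simp add: P_def)
  have "P * four_block_mat (1\<^sub>m k) (E' * F) (0\<^sub>m m k) (1\<^sub>m m) = 1\<^sub>m (k + m)"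
    unfolding P_def by (rule unipotent_block_inverse[OF EF])
  then have inv: "invertible_mat P"
    by (rule invertible_matI[where n = "k + m", rotated 2]) (use P in auto)
  have Pt: "transpose_mat P = four_block_mat (1\<^sub>m k) (0\<^sub>m k m) (- (transpose_mat F * E')) (1\<^sub>m m)"
    unfolding P_def using EF F E' Et'
    by (subst transpose_four_block_mat[of _ k k _ m _ m]) (auto simp: transpose_uminus transpose_mult[of _ k k _ m])
  have cancel: "transpose_mat F * E' * E = transpose_mat F"
    using Ft E' Ec by (simp add: assoc_mult_mat[of _ m k _ k _ k])
  have cancel': "E * (E' * F) = F"
    using F E' Ec by (simp flip: assoc_mult_mat[of _ k k _ k _ m])
  have X: "- (transpose_mat F * E') \<in> carrier_mat m k" using Ft E' by simp
  have e1: "1\<^sub>m k * E + 0\<^sub>m k m * transpose_mat F = E" using Ec Ft by simp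
  have e2: "1\<^sub>m k * F + 0\<^sub>m k m * G = F" using F G by simp
  have e3: "- (transpose_mat F * E') * E + 1\<^sub>m m * transpose_mat F = 0\<^sub>m m k"
    using cancel Ft E' Ec by simp
  have "- (transpose_mat F * E') * F = transpose_mat F * (- (E' * F))"
    using Ft E' F by (simp add: assoc_mult_mat[of _ m k _ k _ m])
  then have e4: "- (transpose_mat F * E') * F + 1\<^sub>m m * G = S"
    unfolding S_def using G Ft EF comm_add_mat[of G m m "transpose_mat F * (- (E' * F))"] by simp
  have PA: "transpose_mat P * A = four_block_mat E F (0\<^sub>m m k) S"
    unfolding Pt blocks
      mult_four_block_mat[OF one_carrier_mat zero_carrier_mat X one_carrier_mat Ec F Ft G] e1 e2 e3 e4 ..
  have f1: "E * 1\<^sub>m k + F * 0\<^sub>m m k = E" using Ec F by simp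
  have f2: "E * (- (E' * F)) + F * 1\<^sub>m m = 0\<^sub>m k m" using cancel' Ec E'(1) EF F by simp
  have f3: "0\<^sub>m m k * 1\<^sub>m k + S * 0\<^sub>m m k = 0\<^sub>m m k" using Sc by simp
  have f4: "0\<^sub>m m k * - (E' * F) + S * 1\<^sub>m m = S"
    using Sc left_mult_zero_mat[OF uminus_carrier_mat[OF EF], of m] by simp
  have "transpose_mat P * A * P = orth_sum E S"
    unfolding PA unfolding P_def orth_sum_def
      mult_four_block_mat[OF Ec F zero_carrier_mat Sc one_carrier_mat uminus_carrier_mat[OF EF] zero_carrier_mat one_carrier_mat]
      f1 f2 f3 f4 using Ec Sc by simp
  then have iso: "isometric_forms A (orth_sum E S)"
    by (intro isometricI[OF Ac P inv]) simp
  have nd: "nondeg_form (orth_sum E S)" by (rule isometric_nondeg[OF A(1) iso])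
  have ndS: "nondeg_form S"
  proof -
    have "transpose_mat S = S"
    proof (rule eq_matI)
      fix i j assume "i < dim_row S" "j < dim_col S"
      then show "transpose_mat S $$ (i, j) = S $$ (i, j)"
        using nondeg_form_sym[OF nd, of "k + i" "k + j"] Sc Ec by (simp add: orth_sum_index)
    qed (use Sc in auto)
    moreover obtain R where R: "R \<in> carrier_mat (k + m) (k + m)" "orth_sum E S * R = 1\<^sub>m (k + m)"
      using nd orth_sum_carrier[OF Ec Sc] by (auto simp: nondeg_form_def elim: invertible_matE)
    define R' where "R' = mat m m (\<lambda>(i, j). R $$ (k + i, k + j))"
    have "S * R' = 1\<^sub>m m"
    proof (rule eq_matI)
      fix i j assume "i < dim_row (1\<^sub>m m)" "j < dim_col (1\<^sub>m m)"
      then have ij: "i < m" "j < m" by simp_all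
      have "(\<Sum>l\<in>{0..<k + m}. orth_sum E S $$ (k + i, l) * R $$ (l, k + j)) = 1\<^sub>m (k + m) $$ (k + i, k + j)"
        using arg_cong[OF R(2), of "\<lambda>X. X $$ (k + i, k + j)"] ij R(1) Ec Sc by (simp add: scalar_prod_def)
      also have "(\<Sum>l\<in>{0..<k + m}. orth_sum E S $$ (k + i, l) * R $$ (l, k + j)) =
        (\<Sum>l\<in>{0..<k}. orth_sum E S $$ (k + i, l) * R $$ (l, k + j)) +
        (\<Sum>l\<in>{k..<k + m}. orth_sum E S $$ (k + i, l) * R $$ (l, k + j))"
        by (simp add: sum.atLeastLessThan_concat)
      also have "(\<Sum>l\<in>{0..<k}. orth_sum E S $$ (k + i, l) * R $$ (l, k + j)) = 0"
        using Ec Sc ij by (intro sum.neutral) (auto simp: orth_sum_index)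
      also have "(\<Sum>l\<in>{k..<k + m}. orth_sum E S $$ (k + i, l) * R $$ (l, k + j)) =
        (\<Sum>l\<in>{0..<m}. orth_sum E S $$ (k + i, k + l) * R $$ (k + l, k + j))"
        using sum.shift_bounds_nat_ivl[of "\<lambda>l. orth_sum E S $$ (k + i, l) * R $$ (l, k + j)" 0 k m]
        by (simp add: add.commute)
      also have "\<dots> = (S * R') $$ (i, j)"
        using Ec Sc ij by (auto simp: orth_sum_index scalar_prod_def R'_def intro!: sum.cong)
      finally show "(S * R') $$ (i, j) = 1\<^sub>m m $$ (i, j)" using ij by simp
    qed (use Sc in \<open>auto simp: R'_def\<close>)
    then have "invertible_mat S" using Sc by (intro invertible_matI[of S m R']) (auto simp: R'_def)
    ultimately show ?thesis by (simp add: nondeg_form_def)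
  qed
  show thesis
    using that[OF ndS] Sc abs_witt_isometric[OF A(1) iso] abs_witt_orth_sum[OF E(1) ndS] by simp
qed

lemma swap_basis:
  fixes A :: "'a::field mat"
  assumes A: "nondeg_form A" and ij: "i < dim_row A" "j < dim_row A"
  defines "B \<equiv> mat (dim_row A) (dim_row A) (\<lambda>(k, l). A $$ (transpose i j k, transpose i j l))"
  shows "nondeg_form B" "abs_witt B = abs_witt A"
proof -
  let ?n = "dim_row A"
  have lt: "transpose i j k < ?n" if "k < ?n" for k using that ij by (auto simp: transpose_def)
  have iso: "isometric_forms A B"
    using lt by (intro isometric_permI[OF nondeg_form_carrier[OF A], where s = "transpose i j" and t = "transpose i j"])
      (auto simp: B_def)
  show "nondeg_form B" "abs_witt B = abs_witt A"
    using isometric_nondeg[OF A iso] abs_witt_isometric[OF A iso] by simp_all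
qed

text \<open>
  In characteristic \<open>2\<close> the form itself need not be diagonalisable, but its Witt class still is a sum
  of lines: a nonzero diagonal entry splits off as a line, and if all diagonal entries vanish, two
  basis vectors span a plane \<open>(0, a; a, 0)\<close>, which is metabolic and contributes nothing.
\<close>

lemma abs_witt_eq_line_sum:
  fixes A :: "'a::field mat"
  assumes "nondeg_form A"
  shows "\<exists>as. 0 \<notin> set as \<and> abs_witt A = line_sum as \<and> (even (length as) \<longleftrightarrow> even (dim_row A))"
  using assms
proof (induction "dim_row A" arbitrary: A rule: less_induct)
  case less
  note A = less.prems
  let ?n = "dim_row A"
  consider (zero) "?n = 0" | (diagonal) i where "i < ?n" "A $$ (i, i) \<noteq> 0"
    | (alternating) "?n > 0" "\<And>i. i < ?n \<Longrightarrow> A $$ (i, i) = 0" by blast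
  then show ?case
  proof cases
    case zero
    have "A = 1\<^sub>m 0"
      by (rule eq_matI) (use zero nondeg_form_dim_col[OF A] in simp_all)
    then show ?thesis by (intro exI[of _ "[]"]) (simp add: abs_witt_zero)
  next
    case diagonal
    then have n: "0 < ?n" by simp
    define B where "B = mat ?n ?n (\<lambda>(k, l). A $$ (transpose 0 i k, transpose 0 i l))"
    have B: "nondeg_form B" "dim_row B = ?n" "abs_witt B = abs_witt A"
      "\<And>k l. k < ?n \<Longrightarrow> l < ?n \<Longrightarrow> B $$ (k, l) = A $$ (transpose 0 i k, transpose 0 i l)"
      using swap_basis[OF A n diagonal(1)] by (simp_all add: B_def)
    have "B $$ (0, 0) = A $$ (i, i)" using B(4) n by simp
    obtain S where S: "nondeg_form S" "dim_row S = ?n - 1" "abs_witt B = abs_witt (line_form (A $$ (i, i))) + abs_witt S"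
      using n B line_form_nondeg[OF diagonal(2)] by (elim nondeg_split[of B 1 "?n - 1"]) auto
    obtain as where as: "0 \<notin> set as" "abs_witt S = line_sum as" "even (length as) \<longleftrightarrow> even (dim_row S)"
      using less.hyps[of S] S n by auto
    show ?thesis using as S B(3) n diagonal(2)
      by (intro exI[of _ "A $$ (i, i) # as"]) (auto simp: abs_witt_line)
  next
    case alternating
    have "\<exists>j<?n. A $$ (0, j) \<noteq> 0"
    proof (rule ccontr)
      assume *: "\<not> ?thesis"
      obtain R where R: "R \<in> carrier_mat ?n ?n" "A * R = 1\<^sub>m ?n"
        using invertible_matE[OF _ nondeg_form_carrier[OF A]] A unfolding nondeg_form_def by metis
      have "(A * R) $$ (0, 0) = (\<Sum>l\<in>{0..<?n}. A $$ (0, l) * R $$ (l, 0))"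
        using alternating(1) carrier_matD[OF R(1)] A by (simp add: scalar_prod_def)
      also have "\<dots> = 0" using * by (intro sum.neutral) auto
      finally show False using R(2) alternating(1) by simp
    qed
    then obtain j where j: "j < ?n" "A $$ (0, j) \<noteq> 0" by blast
    then have j0: "j \<noteq> 0" using alternating by metis
    then have n: "1 < ?n" using j by simp
    define B where "B = mat ?n ?n (\<lambda>(k, l). A $$ (transpose 1 j k, transpose 1 j l))"
    have B: "nondeg_form B" "dim_row B = ?n" "abs_witt B = abs_witt A"
      "\<And>k l. k < ?n \<Longrightarrow> l < ?n \<Longrightarrow> B $$ (k, l) = A $$ (transpose 1 j k, transpose 1 j l)"
      using swap_basis[OF A n j(1)] by (simp_all add: B_def)
    define a where "a = A $$ (0, j)"
    have Bij: "B $$ (k, l) = mat2 0 a a 0 $$ (k, l)" if "k < 2" "l < 2" for k l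
      using that j j0 n alternating B(4)[of k l] nondeg_form_sym[OF A, of j 0]
      by (auto simp: less_2_cases_iff a_def transpose_def)
    have "mat2 0 a a 0 * mat2 0 (1 / a) (1 / a) 0 = 1\<^sub>m 2"
      using j by (simp add: a_def one_mat2)
    then have "invertible_mat (mat2 0 a a 0)"
      by (rule invertible_matI[where n = 2, rotated 2]) auto
    then have plane: "nondeg_form (mat2 0 a a 0)" by (simp add: nondeg_form_def transpose_mat2)
    have "metabolic (mat2 0 a a 0)"
      by (rule metabolicI[OF plane, of 1]) auto
    then have "abs_witt (mat2 0 a a 0) = 0" by (rule abs_witt_metabolic)
    moreover obtain S where S: "nondeg_form S" "dim_row S = ?n - 2" "abs_witt B = abs_witt (mat2 0 a a 0) + abs_witt S"
      using n B(1,2) plane Bij by (elim nondeg_split[of B 2 "?n - 2"]) auto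
    moreover obtain as where as: "0 \<notin> set as" "abs_witt S = line_sum as" "even (length as) \<longleftrightarrow> even (dim_row S)"
      using less.hyps[of S] S n by auto
    ultimately show ?thesis using B(3) n by auto
  qed
qed

section \<open>The dimension of an anisotropic form\<close>

lemma bilinear_congruence:
  fixes S G :: "'a::field mat"
  assumes S: "S \<in> carrier_mat n n" and G: "G \<in> carrier_mat n n"
    and v: "v \<in> carrier_vec n" and w: "w \<in> carrier_vec n"
  shows "w \<bullet> ((transpose_mat S * G * S) *\<^sub>v v) = (S *\<^sub>v w) \<bullet> (G *\<^sub>v (S *\<^sub>v v))"
proof -
  have "(transpose_mat S * G * S) *\<^sub>v v = transpose_mat S *\<^sub>v (G *\<^sub>v (S *\<^sub>v v))"
    using S G v by (simp add: assoc_mult_mat_vec[of _ n n _ n])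
  then show ?thesis
    using transpose_vec_mult_scalar[OF S w, of "G *\<^sub>v (S *\<^sub>v v)"] S G v w
      comm_scalar_prod[of w n] comm_scalar_prod[of "S *\<^sub>v w" n]
    by (simp add: mult_mat_vec_carrier[of _ n n])
qed

lemma invertible_mult_vec_eq_zero:
  fixes A :: "'a::field mat"
  assumes A: "invertible_mat A" "A \<in> carrier_mat n n" and v: "v \<in> carrier_vec n" "A *\<^sub>v v = 0\<^sub>v n"
  shows "v = 0\<^sub>v n"
proof -
  obtain B where B: "B \<in> carrier_mat n n" "B * A = 1\<^sub>m n" using invertible_matE[OF A] .
  have "v = B * A *\<^sub>v v" using B v by simp
  also have "\<dots> = B *\<^sub>v (A *\<^sub>v v)" by (rule assoc_mult_mat_vec[OF B(1) A(2) v(1)])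
  also have "\<dots> = 0\<^sub>v n" unfolding v(2) using B(1) by (intro eq_vecI) auto
  finally show ?thesis .
qed

text \<open>
  If \<open>A \<bottom> M\<close> and \<open>B \<bottom> N\<close> are isometric and \<open>M\<close>, \<open>N\<close> have Lagrangians of dimension \<open>m\<close>, \<open>n\<close>, it suffices
  that \<open>n \<le> m\<close>. The Lagrangian of \<open>N\<close> becomes a totally isotropic subspace \<open>U\<close> of \<open>A \<bottom> M\<close>. Let \<open>L\<close>
  be the Lagrangian of \<open>M\<close>. An isotropic vector of \<open>L\<^sup>\<bottom> = A \<oplus> L\<close> has no component in \<open>A\<close>,
  as \<open>A\<close> is anisotropic, so \<open>U \<inter> L\<^sup>\<bottom> \<subseteq> L\<close>. Below, \<open>f\<close> gives the coordinates of a
  vector of \<open>U\<close> in a complement of \<open>L\<close> in \<open>M\<close>, and \<open>g\<close> the products of its component in \<open>L\<close> with a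
  basis of that complement; for them the count of functionals applies.
\<close>

lemma anisotropic_dim_le:
  fixes A B :: "'a::field mat"
  assumes A: "anisotropic A" and AB: "witt_equiv A B"
  shows "dim_row A \<le> dim_row B"
proof -
  obtain M\<^sub>0 N\<^sub>0 where MN: "metabolic M\<^sub>0" "metabolic N\<^sub>0" "isometric_forms (orth_sum A M\<^sub>0) (orth_sum B N\<^sub>0)"
    using AB by (auto simp: witt_equiv_def)
  have ndA: "nondeg_form A" and ndB: "nondeg_form B" using AB by (auto simp: witt_equiv_def)
  obtain m M where M: "dim_row M\<^sub>0 = 2 * m" "isometric_forms M\<^sub>0 M" "nondeg_form M"
    "dim_row M = 2 * m" "\<And>i j. i < m \<Longrightarrow> j < m \<Longrightarrow> M $$ (i, j) = 0"
    using MN(1) by (rule metabolicE) blast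
  obtain n N where N: "dim_row N\<^sub>0 = 2 * n" "isometric_forms N\<^sub>0 N" "nondeg_form N"
    "dim_row N = 2 * n" "\<And>i j. i < n \<Longrightarrow> j < n \<Longrightarrow> N $$ (i, j) = 0"
    using MN(2) by (rule metabolicE) blast
  define a b T where "a = dim_row A" and "b = dim_row B" and "T = a + 2 * m"
  have Ac: "A \<in> carrier_mat a a" and Bc: "B \<in> carrier_mat b b"
    unfolding a_def b_def by (rule nondeg_form_carrier[OF ndA], rule nondeg_form_carrier[OF ndB])
  have Mc: "M \<in> carrier_mat (2 * m) (2 * m)" and Nc: "N \<in> carrier_mat (2 * n) (2 * n)"
    using nondeg_form_carrier[OF M(3)] nondeg_form_carrier[OF N(3)] unfolding M(4) N(4) by blast+
  define G where "G = orth_sum A M"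
  have Gc: "G \<in> carrier_mat T T" unfolding G_def T_def by (rule orth_sum_carrier[OF Ac Mc])
  have ndG: "nondeg_form G" unfolding G_def by (rule orth_sum_nondeg[OF ndA M(3)])
  have "isometric_forms G (orth_sum A M\<^sub>0)"
    unfolding G_def using ndA M(2,3) metabolic_nondeg[OF MN(1)]
    by (intro orth_sum_isometric isometric_refl nondeg_isometric_sym[of M\<^sub>0 M])
  moreover have "isometric_forms (orth_sum B N\<^sub>0) (orth_sum B N)"
    using ndB N(2) metabolic_nondeg[OF MN(2)] by (intro orth_sum_isometric isometric_refl)
  ultimately have "isometric_forms G (orth_sum B N)"
    using nondeg_isometric_trans[OF ndG] MN(3) by metis
  then obtain S where S: "S \<in> carrier_mat T T" "invertible_mat S" "orth_sum B N = transpose_mat S * G * S"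
    using Gc by (auto simp: isometric_forms_def)
  have T: "T = b + 2 * n" using arg_cong[OF S(3), of dim_row] S(1) Bc Nc by simp
  define I J where "I = {..<m}" and "J = {b..<b + n}"
  define f where "f i j = S $$ (a + m + i, j)" for i j
  define g where "g i j = (\<Sum>k\<in>{a..<a + m}. G $$ (a + m + i, k) * S $$ (k, j))" for i j
  define V where "V v = vec T (\<lambda>j. if j \<in> J then v j else 0)" for v :: "nat \<Rightarrow> 'a"
  have V: "V v \<in> carrier_vec T" for v by (simp add: V_def)
  define X where "X v = S *\<^sub>v V v" for v
  have X: "X v \<in> carrier_vec T" for v using S(1) by (simp add: X_def V)
  have JT: "J \<subseteq> {0..<T}" unfolding J_def T by auto
  have X_index: "X v $ i = (\<Sum>j\<in>J. S $$ (i, j) * v j)" if "i < T" for v i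
  proof -
    have "X v $ i = (\<Sum>j\<in>{0..<T}. S $$ (i, j) * (if j \<in> J then v j else 0))"
      using that S(1) by (simp add: X_def V_def scalar_prod_def)
    also have "\<dots> = (\<Sum>j\<in>{0..<T}. if j \<in> J then S $$ (i, j) * v j else 0)"
      by (intro sum.cong) auto
    also have "\<dots> = (\<Sum>j\<in>J. S $$ (i, j) * v j)"
      using JT by (simp add: sum.If_cases Int_absorb1)
    finally show ?thesis .
  qed
  have isotropic: "X w \<bullet> (G *\<^sub>v X v) = 0" for v w
  proof -
    have "X w \<bullet> (G *\<^sub>v X v) = V w \<bullet> (orth_sum B N *\<^sub>v V v)"
      unfolding S(3) X_def by (rule bilinear_congruence[OF S(1) Gc V V, symmetric])
    also have "\<dots> = (\<Sum>i\<in>{0..<T}. V w $ i * (\<Sum>j\<in>{0..<T}. orth_sum B N $$ (i, j) * V v $ j))"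
      using Bc Nc T by (simp add: scalar_prod_def V_def)
    also have "\<dots> = 0"
    proof (rule sum.neutral, rule ballI)
      fix i assume i: "i \<in> {0..<T}"
      show "V w $ i * (\<Sum>j\<in>{0..<T}. orth_sum B N $$ (i, j) * V v $ j) = 0"
      proof (cases "i \<in> J")
        case True
        have "(\<Sum>j\<in>{0..<T}. orth_sum B N $$ (i, j) * V v $ j) = 0"
        proof (rule sum.neutral, rule ballI)
          fix j assume j: "j \<in> {0..<T}"
          show "orth_sum B N $$ (i, j) * V v $ j = 0"
            using True i j Bc Nc T N(5)[of "i - b" "j - b"]
            by (cases "j \<in> J") (auto simp: V_def J_def orth_sum_index)
        qed
        then show ?thesis by simp
      qed (use i in \<open>simp add: V_def\<close>)
    qed
    finally show ?thesis .
  qed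
  have fX: "(\<Sum>j\<in>J. f i j * v j) = X v $ (a + m + i)" if "i \<in> I" for i v
    using that X_index[of "a + m + i"] by (simp add: f_def I_def T_def)
  \<comment> \<open>where \<open>f\<close> vanishes, \<open>X v\<close> lies in \<open>L\<^sup>\<bottom>\<close> and has no component in \<open>A\<close>\<close>
  have kernel: "G *\<^sub>v X v = vec T (\<lambda>i. if i < a then 0 else if i < a + m then 0 else \<Sum>j\<in>J. g (i - a - m) j * v j)
      \<and> (\<forall>i<a. X v $ i = 0)"
    if f0: "\<And>i. i \<in> I \<Longrightarrow> (\<Sum>j\<in>J. f i j * v j) = 0" for v
  proof -
    have X0: "X v $ k = 0" if "a + m \<le> k" "k < T" for k
      using f0[of "k - (a + m)"] fX[of "k - (a + m)" v] that by (auto simp: I_def T_def)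
    define x where "x = vec a (\<lambda>i. X v $ i)"
    have GX: "(G *\<^sub>v X v) $ i = (\<Sum>k\<in>{0..<a}. G $$ (i, k) * X v $ k) + (\<Sum>k\<in>{a..<a + m}. G $$ (i, k) * X v $ k)"
      if "i < T" for i
    proof -
      have "(G *\<^sub>v X v) $ i = (\<Sum>k\<in>{0..<T}. G $$ (i, k) * X v $ k)"
        using that Gc X[of v] by (simp add: scalar_prod_def)
      also have "\<dots> = (\<Sum>k\<in>{0..<a + m}. G $$ (i, k) * X v $ k) + (\<Sum>k\<in>{a + m..<T}. G $$ (i, k) * X v $ k)"
        by (rule sum.atLeastLessThan_concat[symmetric]) (auto simp: T_def)
      also have "(\<Sum>k\<in>{a + m..<T}. G $$ (i, k) * X v $ k) = 0"
        using X0 by (intro sum.neutral) auto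
      finally show ?thesis by (simp add: sum.atLeastLessThan_concat)
    qed
    have top: "(G *\<^sub>v X v) $ i = (A *\<^sub>v x) $ i" if "i < a" for i
    proof -
      have "(\<Sum>k\<in>{a..<a + m}. G $$ (i, k) * X v $ k) = 0"
        using that Ac Mc by (intro sum.neutral) (auto simp: G_def orth_sum_index)
      then show ?thesis
        using that GX[of i] Ac Mc
        by (auto simp: T_def G_def orth_sum_index scalar_prod_def x_def intro!: sum.cong)
    qed
    have middle: "(G *\<^sub>v X v) $ i = 0" if "a \<le> i" "i < a + m" for i
    proof -
      have "(\<Sum>k\<in>{a..<a + m}. G $$ (i, k) * X v $ k) = 0"
        using that Ac Mc M(5)[of "i - a"] by (intro sum.neutral) (auto simp: G_def orth_sum_index)
      moreover have "(\<Sum>k\<in>{0..<a}. G $$ (i, k) * X v $ k) = 0"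
        using that Ac Mc by (intro sum.neutral) (auto simp: G_def orth_sum_index)
      ultimately show ?thesis using GX[of i] that by (simp add: T_def)
    qed
    have bottom: "(G *\<^sub>v X v) $ i = (\<Sum>j\<in>J. g (i - a - m) j * v j)" if "a + m \<le> i" "i < T" for i
    proof -
      have "(\<Sum>k\<in>{0..<a}. G $$ (i, k) * X v $ k) = 0"
        using that Ac Mc by (intro sum.neutral) (auto simp: G_def orth_sum_index T_def)
      moreover have "(\<Sum>k\<in>{a..<a + m}. G $$ (i, k) * X v $ k) =
          (\<Sum>k\<in>{a..<a + m}. \<Sum>j\<in>J. G $$ (i, k) * S $$ (k, j) * v j)"
        by (intro sum.cong) (auto simp: X_index T_def sum_distrib_left mult.assoc)
      moreover have "\<dots> = (\<Sum>j\<in>J. g (i - a - m) j * v j)"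
        using that by (subst sum.swap) (simp add: g_def sum_distrib_right)
      ultimately show ?thesis using GX[of i] that by simp
    qed
    have "X v \<bullet> (G *\<^sub>v X v) = (\<Sum>i\<in>{0..<T}. X v $ i * (G *\<^sub>v X v) $ i)"
      using Gc by (simp add: scalar_prod_def)
    also have "\<dots> = (\<Sum>i\<in>{0..<a}. X v $ i * (G *\<^sub>v X v) $ i) + (\<Sum>i\<in>{a..<T}. X v $ i * (G *\<^sub>v X v) $ i)"
      by (rule sum.atLeastLessThan_concat[symmetric]) (auto simp: T_def)
    also have "(\<Sum>i\<in>{a..<T}. X v $ i * (G *\<^sub>v X v) $ i) = 0"
    proof (rule sum.neutral, rule ballI)
      fix i assume "i \<in> {a..<T}"
      then show "X v $ i * (G *\<^sub>v X v) $ i = 0"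
        using middle[of i] X0[of i] by (cases "i < a + m") auto
    qed
    also have "(\<Sum>i\<in>{0..<a}. X v $ i * (G *\<^sub>v X v) $ i) = x \<bullet> (A *\<^sub>v x)"
    proof -
      have "x \<bullet> (A *\<^sub>v x) = (\<Sum>i\<in>{0..<a}. x $ i * (A *\<^sub>v x) $ i)"
        using Ac by (simp add: scalar_prod_def)
      then show ?thesis using top by (simp add: x_def)
    qed
    finally have "x \<bullet> (A *\<^sub>v x) = 0" using isotropic[of v v] by simp
    then have "x = 0\<^sub>v a" using A Ac unfolding anisotropic_def x_def by (metis a_def vec_carrier)
    then have x0: "X v $ i = 0" if "i < a" for i
      using that by (metis index_vec index_zero_vec(1) x_def)
    have "G *\<^sub>v X v = vec T (\<lambda>i. if i < a then 0 else if i < a + m then 0 else \<Sum>j\<in>J. g (i - a - m) j * v j)"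
    proof (rule eq_vecI)
      fix i assume "i < dim_vec (vec T (\<lambda>i. if i < a then 0 else if i < a + m then 0 else \<Sum>j\<in>J. g (i - a - m) j * v j))"
      then have i: "i < T" by simp
      have "(A *\<^sub>v x) $ i = 0" if "i < a"
        using that Ac unfolding \<open>x = 0\<^sub>v a\<close> by simp
      then show "(G *\<^sub>v X v) $ i = vec T (\<lambda>i. if i < a then 0 else if i < a + m then 0 else \<Sum>j\<in>J. g (i - a - m) j * v j) $ i"
        using i top[of i] middle[of i] bottom[of i] by simp
    qed (use Gc in simp)
    then show ?thesis using x0 by blast
  qed
  have "card J \<le> card I"
  proof (rule card_le_of_isotropic_functionals[of I J f g])
    fix v j
    assume f0: "\<And>i. i \<in> I \<Longrightarrow> (\<Sum>j\<in>J. f i j * v j) = 0"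
      and g0: "\<And>i. i \<in> I \<Longrightarrow> (\<Sum>j\<in>J. g i j * v j) = 0" and j: "j \<in> J"
    have "(\<Sum>j\<in>J. g (i - a - m) j * v j) = 0" if "a + m \<le> i" "i < T" for i
      using g0[of "i - a - m"] that by (auto simp: I_def T_def)
    then have "G *\<^sub>v X v = 0\<^sub>v T"
      using kernel[OF f0] by (intro eq_vecI) auto
    then have "X v = 0\<^sub>v T"
      using invertible_mult_vec_eq_zero[OF _ Gc X] ndG by (simp add: nondeg_form_def)
    then have "V v = 0\<^sub>v T"
      using invertible_mult_vec_eq_zero[OF S(2,1) V] by (simp add: X_def)
    moreover have jT: "j < T" using j JT by auto
    moreover have "v j = V v $ j" using j jT by (simp add: V_def)
    ultimately show "v j = 0" by simp
  next
    fix v w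
    assume f0: "\<And>i. i \<in> I \<Longrightarrow> (\<Sum>j\<in>J. f i j * v j) = 0"
    have GX: "G *\<^sub>v X v = vec T (\<lambda>i. if i < a then 0 else if i < a + m then 0 else \<Sum>j\<in>J. g (i - a - m) j * v j)"
      using kernel[of v] f0 by blast
    have "0 = X w \<bullet> (G *\<^sub>v X v)" using isotropic by simp
    also have "\<dots> = (\<Sum>i\<in>{0..<T}. X w $ i * (if i < a then 0 else if i < a + m then 0 else \<Sum>j\<in>J. g (i - a - m) j * v j))"
      unfolding GX by (simp add: scalar_prod_def)
    also have "\<dots> = (\<Sum>i\<in>{a + m..<T}. X w $ i * (\<Sum>j\<in>J. g (i - a - m) j * v j))"
      by (rule sum.mono_neutral_cong_right) auto
    also have "\<dots> = (\<Sum>i\<in>I. X w $ (a + m + i) * (\<Sum>j\<in>J. g i j * v j))"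
      by (rule sum.reindex_bij_witness[of _ "\<lambda>i. a + m + i" "\<lambda>i. i - (a + m)"]) (auto simp: I_def T_def)
    also have "\<dots> = (\<Sum>i\<in>I. (\<Sum>j\<in>J. f i j * w j) * (\<Sum>j\<in>J. g i j * v j))"
      by (intro sum.cong) (auto simp: fX)
    finally show "(\<Sum>i\<in>I. (\<Sum>j\<in>J. f i j * w j) * (\<Sum>j\<in>J. g i j * v j)) = 0" by simp
  qed (auto simp: I_def J_def)
  then show ?thesis using T by (simp add: I_def J_def T_def a_def b_def)
qed

section \<open>The norm and the square of the fundamental ideal\<close>

lemma anisotropic_diag_form:
  fixes as :: "'a::field list"
  assumes "\<not> isotropic_list as"
  shows "anisotropic (diag_form as)"
  unfolding anisotropic_def
proof (intro ballI impI)
  fix v :: "'a vec" assume v: "v \<in> carrier_vec (dim_row (diag_form as))" "v \<noteq> 0\<^sub>v (dim_row (diag_form as))"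
  let ?n = "length as"
  define vs where "vs = map (\<lambda>i. v $ i) [0..<?n]"
  have "(diag_form as *\<^sub>v v) $ i = as ! i * v $ i" if "i < ?n" for i
  proof -
    have "(diag_form as *\<^sub>v v) $ i = (\<Sum>j\<in>{0..<?n}. (if i = j then as ! i else 0) * v $ j)"
      using that v by (auto simp: scalar_prod_def index_diag_form intro!: sum.cong)
    also have "\<dots> = (\<Sum>j\<in>{0..<?n}. if j = i then as ! i * v $ j else 0)"
      by (intro sum.cong) auto
    finally show ?thesis using that by simp
  qed
  then have "v \<bullet> (diag_form as *\<^sub>v v) = (\<Sum>i\<in>{0..<?n}. v $ i * (as ! i * v $ i))"
    by (simp add: scalar_prod_def)
  also have "\<dots> = (\<Sum>(a, v)\<leftarrow>zip as vs. a * v * v)"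
    by (simp add: vs_def sum_list_sum_nth mult_ac)
  finally have "v \<bullet> (diag_form as *\<^sub>v v) = (\<Sum>(a, v)\<leftarrow>zip as vs. a * v * v)" .
  moreover have "\<exists>x\<in>set vs. x \<noteq> 0"
  proof (rule ccontr)
    assume "\<not> ?thesis"
    then have "v = 0\<^sub>v ?n" using v by (intro eq_vecI) (auto simp: vs_def)
    then show False using v by simp
  qed
  moreover have "length vs = length as" by (simp add: vs_def)
  ultimately have "isotropic_list as" if "v \<bullet> (diag_form as *\<^sub>v v) = 0"
    unfolding isotropic_list_def using that by (intro exI[of _ vs]) simp
  then show "v \<bullet> (diag_form as *\<^sub>v v) \<noteq> 0" using assms by blast
qed

text \<open>
  The norm is defined by a definite description; the bound for the dimension of an anisotropic form,
  used in both directions, makes it well defined.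
\<close>

lemma witt_norm_line_sum:
  fixes as :: "'a::field list"
  assumes as: "0 \<notin> set as" "\<not> isotropic_list as"
  shows "witt_norm (line_sum as) = length as"
  unfolding witt_norm_def
proof (rule the_equality)
  note D = nondeg_diag_form[OF as(1)] anisotropic_diag_form[OF as(2)] abs_witt_diag_form[OF as(1)]
  show "\<exists>A. nondeg_form A \<and> anisotropic A \<and> abs_witt A = line_sum as \<and> dim_row A = length as"
    using D by (intro exI[of _ "diag_form as"]) simp
  fix n assume "\<exists>A. nondeg_form A \<and> anisotropic A \<and> abs_witt A = line_sum as \<and> dim_row A = n"
  then obtain A where A: "nondeg_form A" "anisotropic A" "abs_witt A = line_sum as" "dim_row A = n" by blast
  have "witt_equiv A (diag_form as)" using abs_witt_eq_iff[OF A(1) D(1)] A(3) D(3) by simp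
  then have "dim_row A = dim_row (diag_form as)"
    using anisotropic_dim_le A(2) D(2) witt_equiv_sym by (metis le_antisym)
  then show "n = length as" using A(4) by simp
qed

lemma witt_norm_line_sum_le: "witt_norm (line_sum as) \<le> length (as :: 'a::field list)"
proof -
  have "line_sum (filter (\<lambda>a. a \<noteq> 0) as) = line_sum as" by (induction as) auto
  moreover obtain cs k t where "0 \<notin> set cs" "\<not> isotropic_list cs"
    "length (filter (\<lambda>a. a \<noteq> 0) as) = length cs + 2 * k" "line_sum cs = line_sum (filter (\<lambda>a. a \<noteq> 0) as)"
    using anisotropic_reduction[of "filter (\<lambda>a. a \<noteq> 0) as"] by auto
  ultimately show ?thesis
    using witt_norm_line_sum[of cs] length_filter_le[of "\<lambda>a. a \<noteq> 0" as] by simp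
qed

lemma fund_ideal_line_sum:
  assumes "x \<in> fund_ideal"
  shows "\<exists>as. 0 \<notin> set as \<and> even (length as) \<and> x = line_sum as"
proof -
  have "\<exists>A. x = abs_witt A \<and> nondeg_form A \<and> even (dim_row A)"
    using assms unfolding fund_ideal_def mem_Collect_eq .
  then obtain A where A: "x = abs_witt A" "nondeg_form A" "even (dim_row A)" by (elim exE conjE)
  obtain as where "0 \<notin> set as" "abs_witt A = line_sum as" "even (length as) \<longleftrightarrow> even (dim_row A)"
    using abs_witt_eq_line_sum[OF A(2)] by (elim exE conjE)
  then show ?thesis using A(1,3) by (intro exI[of _ as]) simp
qed

lemma line_sum_map_mult:
  fixes a :: "'a::field"
  shows "line_sum (map ((*) a) bs) = witt_line a * line_sum bs"
  by (induction bs) (auto simp: witt_line_times distrib_left)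

lemma prod_list_map_mult:
  fixes a :: "'a::field"
  shows "prod_list (map ((*) a) bs) = a ^ length bs * prod_list bs"
  by (induction bs) (auto simp: mult_ac)

lemma line_sum_mult:
  fixes as bs :: "'a::field list"
  assumes "0 \<notin> set as" "0 \<notin> set bs"
  shows "\<exists>cs. 0 \<notin> set cs \<and> length cs = length as * length bs \<and> line_sum cs = line_sum as * line_sum bs
     \<and> prod_list cs = prod_list as ^ length bs * prod_list bs ^ length as"
  using assms(1)
proof (induction as)
  case Nil
  show ?case by (intro exI[of _ "[]"]) simp
next
  case (Cons a as)
  then obtain cs where cs: "0 \<notin> set cs" "length cs = length as * length bs"
    "line_sum cs = line_sum as * line_sum bs"
    "prod_list cs = prod_list as ^ length bs * prod_list bs ^ length as" by auto
  show ?case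
    using cs Cons.prems assms(2)
    by (intro exI[of _ "map ((*) a) bs @ cs"])
       (auto simp: line_sum_map_mult prod_list_map_mult power_mult_distrib algebra_simps)
qed

lemma fund_ideal_mult_line_sum:
  fixes x y :: "'a::field witt"
  assumes "x \<in> fund_ideal" "y \<in> fund_ideal"
  shows "\<exists>cs t. 0 \<notin> set cs \<and> 4 dvd length cs \<and> line_sum cs = x * y \<and> prod_list cs = t * t"
proof -
  obtain as where as: "0 \<notin> set as" "even (length as)" "x = line_sum as"
    using fund_ideal_line_sum[OF assms(1)] by (elim exE conjE)
  obtain bs where bs: "0 \<notin> set bs" "even (length bs)" "y = line_sum bs"
    using fund_ideal_line_sum[OF assms(2)] by (elim exE conjE)
  obtain k l where kl: "length as = 2 * k" "length bs = 2 * l" using as(2) bs(2) by (auto simp: dvd_def)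
  obtain cs where cs: "0 \<notin> set cs" "length cs = length as * length bs" "line_sum cs = x * y"
    "prod_list cs = prod_list as ^ length bs * prod_list bs ^ length as"
    using line_sum_mult[OF as(1) bs(1)] as bs by blast
  have "prod_list cs = (prod_list as ^ l * prod_list bs ^ k) * (prod_list as ^ l * prod_list bs ^ k)"
    unfolding cs(4) kl mult_2 power_add by (simp only: mult_ac)
  moreover have "4 dvd length cs" unfolding cs(2) kl by simp
  ultimately show ?thesis using cs by blast
qed

text \<open>
  A product of two even-dimensional forms has trivial signed discriminant: its dimension is divisible
  by \<open>4\<close>, and in the product of its entries every entry of either factor has an even exponent.
\<close>

lemma fund_ideal_sq_line_sum:
  fixes x :: "'a::field witt"
  assumes "x \<in> fund_ideal_sq"
  shows "\<exists>cs t. 0 \<notin> set cs \<and> 4 dvd length cs \<and> line_sum cs = x \<and> prod_list cs = t * t"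
proof -
  obtain ps where "x = (\<Sum>(x, y)\<leftarrow>ps. x * y)" "set ps \<subseteq> fund_ideal \<times> fund_ideal"
    using assms by (auto simp: fund_ideal_sq_def)
  then show ?thesis
  proof (induction ps arbitrary: x)
    case Nil
    show ?case by (intro exI[of _ "[]"] exI[of _ 1]) (simp add: Nil)
  next
    case (Cons p ps)
    obtain y z where p: "p = (y, z)" "y \<in> fund_ideal" "z \<in> fund_ideal" using Cons.prems by (cases p) auto
    obtain cs t where cs: "0 \<notin> set cs" "4 dvd length cs" "line_sum cs = y * z" "prod_list cs = t * t"
      using fund_ideal_mult_line_sum[OF p(2,3)] by blast
    obtain ds u where ds: "0 \<notin> set ds" "4 dvd length ds" "line_sum ds = (\<Sum>(x, y)\<leftarrow>ps. x * y)" "prod_list ds = u * u"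
      using Cons.IH[OF HOL.refl] Cons.prems by auto
    show ?case using cs ds Cons.prems(1) p
      by (intro exI[of _ "cs @ ds"] exI[of _ "t * u"]) (auto simp: mult_ac)
  qed
qed

text \<open>
  The anisotropic form that represents \<open>x\<close> has trivial signed discriminant; padding it with hyperbolic
  planes \<open>\<langle>1, - 1\<rangle>\<close> to dimension \<open>4 n\<close> gives entries whose product is a square.
\<close>

lemma fund_ideal_sq_line_sum_of_norm_le:
  fixes x :: "'a::field witt"
  assumes x: "x \<in> fund_ideal_sq" "witt_norm x \<le> 4 * n"
  shows "\<exists>cs t. 0 \<notin> set cs \<and> length cs = 4 * n \<and> line_sum cs = x \<and> prod_list cs = t * t"
proof -
  obtain as s where as: "0 \<notin> set as" "4 dvd length as" "line_sum as = x" "prod_list as = s * s"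
    using fund_ideal_sq_line_sum[OF x(1)] by blast
  obtain cs k t where cs: "0 \<notin> set cs" "\<not> isotropic_list cs" "length as = length cs + 2 * k"
    "line_sum cs = line_sum as" "prod_list cs = (- 1) ^ k * prod_list as * t * t"
    using anisotropic_reduction[OF as(1)] by blast
  have le: "length cs \<le> 4 * n" using witt_norm_line_sum[OF cs(1,2)] cs(4) as(3) x(2) by simp
  obtain m where m: "length as = 4 * m" using as(2) by blast
  have "even (length cs)" using m cs(3) by presburger
  then have "even (4 * n - length cs)" by simp
  then obtain l where "4 * n - length cs = 2 * l" by (rule evenE)
  then have l: "4 * n = length cs + 2 * l" using le by linarith
  have kl: "even k \<longleftrightarrow> even l" using m l cs(3) by presburger
  define ds where "ds = concat (replicate l [1, - 1 :: 'a])"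
  have ds: "0 \<notin> set ds" "length ds = 2 * l" "line_sum ds = 0" "prod_list ds = (- 1) ^ l"
    unfolding ds_def by (induction l) (auto simp: witt_line_uminus)
  have "prod_list (ds @ cs) = (s * t) * (s * t)"
    using cs(5) as(4) ds(4) kl by (cases "even k") (auto simp: mult_ac)
  then show ?thesis using cs as ds l
    by (intro exI[of _ "ds @ cs"] exI[of _ "s * t"]) auto
qed

section \<open>Products of commutators in the Witt extension\<close>

lemma det_mat2: "det (mat2 a b c d) = a * d - b * (c :: 'a::comm_ring_1)"
proof -
  have minor: "det (mat_delete (mat2 a b c d) 0 j) = mat2 a b c d $$ (1, 1 - j)" if "j < 2" for j
    using that
    by (subst det_single) (auto simp: mat_delete_def less_2_cases_iff)
  show ?thesis
    using laplace_expansion_row[OF mat2_carrier[of a b c d], of 0]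
    by (simp add: cofactor_def minor lessThan_Suc numeral_2_eq_2)
qed

lemma mat2_in_SL2 [simp]: "mat2 a b c d \<in> carrier SL2 \<longleftrightarrow> a * d - b * c = 1"
  by (simp add: SL2_def det_mat2)

lemma SL2_simps [simp]: "\<one>\<^bsub>SL2\<^esub> = mat2 1 0 0 1" "x \<otimes>\<^bsub>SL2\<^esub> y = x * y"
  by (simp_all add: SL2_def one_mat2)

lemma SL2_cases [elim]:
  assumes "m \<in> carrier SL2"
  obtains a b c d where "m = mat2 a b c d" "a * d - b * c = 1"
proof -
  have "m \<in> carrier_mat 2 2" using assms by (simp add: SL2_def)
  note e = eq_mat2[OF this]
  show thesis using that[OF e] assms e by (metis mat2_in_SL2)
qed

lemma group_SL2: "group (SL2 :: 'a::field mat monoid)"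
proof (rule groupI)
  fix x :: "'a mat" assume "x \<in> carrier SL2"
  then obtain a b c d where x: "x = mat2 a b c d" "a * d - b * c = 1" by (rule SL2_cases)
  show "\<exists>y\<in>carrier SL2. y \<otimes>\<^bsub>SL2\<^esub> x = \<one>\<^bsub>SL2\<^esub>"
    using x by (intro bexI[of _ "mat2 d (- b) (- c) a"]) (auto simp: mat2_eq_iff algebra_simps)
  show "\<one>\<^bsub>SL2\<^esub> \<otimes>\<^bsub>SL2\<^esub> x = x" using x by simp
next
  fix x y :: "'a mat" assume "x \<in> carrier SL2" "y \<in> carrier SL2"
  then show "x \<otimes>\<^bsub>SL2\<^esub> y \<in> carrier SL2" by (auto simp: SL2_def det_mult)
next
  fix x y z :: "'a mat" assume "x \<in> carrier SL2" "y \<in> carrier SL2" "z \<in> carrier SL2"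
  then show "x \<otimes>\<^bsub>SL2\<^esub> y \<otimes>\<^bsub>SL2\<^esub> z = x \<otimes>\<^bsub>SL2\<^esub> (y \<otimes>\<^bsub>SL2\<^esub> z)"
    by (auto simp: SL2_def assoc_mult_mat[of _ 2 2 _ 2 _ 2])
qed simp

lemma inv_SL2:
  fixes a b c d :: "'a::field"
  assumes "a * d - b * c = 1"
  shows "inv\<^bsub>SL2\<^esub> (mat2 a b c d) = mat2 d (- b) (- c) a"
  using assms by (intro group.inv_equality[OF group_SL2]) (auto simp: mat2_eq_iff algebra_simps)

lemma witt_cocycle_mat2:
  "witt_cocycle (mat2 a b c d) (mat2 a' b' c' d') = witt_line (- c * (c * a' + d * c') * c')"
  by (simp add: witt_cocycle_def)

lemma witt_cocycle_of_mult_eq_one: "a * b = mat2 1 0 0 1 \<Longrightarrow> witt_cocycle a b = 0"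
  by (simp add: witt_cocycle_def)

lemma witt_extension_simps [simp]:
  "carrier witt_extension = carrier SL2 \<times> UNIV"
  "(g, u) \<otimes>\<^bsub>witt_extension\<^esub> (h, v) = (g * h, u + v + witt_cocycle g h)"
  "\<one>\<^bsub>witt_extension\<^esub> = (mat2 1 0 0 1, 0)"
  by (simp_all add: witt_extension_def one_mat2)

text \<open>
  An inverse is determined by its matrix part, since the cocycle vanishes on two matrices whose product is
  the identity.
\<close>

lemma inv_witt_extension:
  fixes m :: "'a::field mat"
  assumes m: "m \<in> carrier SL2"
  shows "inv\<^bsub>witt_extension\<^esub> (m, 0) = (inv\<^bsub>SL2\<^esub> m, 0)"
proof -
  interpret group "SL2 :: 'a mat monoid" by (rule group_SL2)
  have mm: "m * inv\<^bsub>SL2\<^esub> m = mat2 1 0 0 1" "inv\<^bsub>SL2\<^esub> m * m = mat2 1 0 0 1"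
    using r_inv[OF m] l_inv[OF m] by simp_all
  show ?thesis
    unfolding m_inv_def[of witt_extension]
  proof (rule the_equality)
    show "(inv\<^bsub>SL2\<^esub> m, 0) \<in> carrier witt_extension \<and>
       (m, 0) \<otimes>\<^bsub>witt_extension\<^esub> (inv\<^bsub>SL2\<^esub> m, 0) = \<one>\<^bsub>witt_extension\<^esub> \<and>
       (inv\<^bsub>SL2\<^esub> m, 0) \<otimes>\<^bsub>witt_extension\<^esub> (m, 0) = \<one>\<^bsub>witt_extension\<^esub>"
      using mm m by (simp add: witt_cocycle_of_mult_eq_one)
    fix y
    assume y: "y \<in> carrier witt_extension \<and> (m, 0) \<otimes>\<^bsub>witt_extension\<^esub> y = \<one>\<^bsub>witt_extension\<^esub> \<and>
       y \<otimes>\<^bsub>witt_extension\<^esub> (m, 0) = \<one>\<^bsub>witt_extension\<^esub>"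
    obtain n v where nv: "y = (n, v)" by (cases y)
    have n: "n \<in> carrier SL2" "n * m = mat2 1 0 0 1" "m * n = mat2 1 0 0 1" "v + witt_cocycle m n = 0"
      using y nv by auto
    have "inv\<^bsub>SL2\<^esub> m = n" using n m by (intro inv_equality) simp_all
    then show "y = (inv\<^bsub>SL2\<^esub> m, 0)" using n(3,4) nv by (simp add: witt_cocycle_of_mult_eq_one)
  qed
qed

text \<open>
  The sum over the three triangles that a commutator cuts off from the fan triangulation of the \<open>4g\<close>-gon.
\<close>

definition commutator_class :: "'a::field mat \<Rightarrow> 'a mat \<Rightarrow> 'a witt" where
  "commutator_class A B = witt_cocycle A B + witt_cocycle (A * B) (inv\<^bsub>SL2\<^esub> A)
     + witt_cocycle (A * B * inv\<^bsub>SL2\<^esub> A) (inv\<^bsub>SL2\<^esub> B)"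

lemma commutator_witt_extension:
  fixes A B :: "'a::field mat"
  assumes "A \<in> carrier SL2" "B \<in> carrier SL2"
  shows "commutator witt_extension (A, 0) (B, 0) = (commutator SL2 A B, commutator_class A B)"
  using assms
  by (simp add: commutator_def[where G = witt_extension] inv_witt_extension commutator_class_def)
     (simp add: commutator_def)

lemma commutator_SL2_closed:
  fixes A B :: "'a::field mat"
  assumes "A \<in> carrier SL2" "B \<in> carrier SL2"
  shows "commutator SL2 A B \<in> carrier SL2"
proof -
  interpret group "SL2 :: 'a mat monoid" by (rule group_SL2)
  show ?thesis using assms unfolding commutator_def by blast
qed

definition commutator_product :: "('a::field mat \<times> 'a mat) list \<Rightarrow> 'a mat \<times> 'a witt" where
  "commutator_product ps = foldr (\<lambda>(A, B) p. commutator witt_extension (A, 0) (B, 0)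
     \<otimes>\<^bsub>witt_extension\<^esub> p) ps \<one>\<^bsub>witt_extension\<^esub>"

lemma commutator_product_Nil: "commutator_product [] = (mat2 1 0 0 1, 0)"
  by (simp add: commutator_product_def)

lemma commutator_product_Cons:
  assumes "A \<in> carrier SL2" "B \<in> carrier SL2" "commutator_product ps = (m, u)"
  shows "commutator_product ((A, B) # ps) =
    (commutator SL2 A B * m, commutator_class A B + u + witt_cocycle (commutator SL2 A B) m)"
  using assms by (simp add: commutator_product_def commutator_witt_extension)

lemma fst_commutator_product:
  fixes ps :: "('a::field mat \<times> 'a mat) list"
  assumes "set ps \<subseteq> carrier SL2 \<times> carrier SL2"
  shows "fst (commutator_product ps) =
      foldr (\<lambda>(A, B) m. commutator SL2 A B \<otimes>\<^bsub>SL2\<^esub> m) ps \<one>\<^bsub>SL2\<^esub>"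
    and "fst (commutator_product ps) \<in> carrier SL2"
proof -
  interpret group "SL2 :: 'a mat monoid" by (rule group_SL2)
  have "fst (commutator_product ps) =
      foldr (\<lambda>(A, B) m. commutator SL2 A B \<otimes>\<^bsub>SL2\<^esub> m) ps \<one>\<^bsub>SL2\<^esub>
    \<and> fst (commutator_product ps) \<in> carrier SL2"
    using assms
  proof (induction ps)
    case Nil
    show ?case by (simp add: commutator_product_Nil)
  next
    case (Cons p ps)
    obtain A B where p: "p = (A, B)" "A \<in> carrier SL2" "B \<in> carrier SL2" using Cons.prems by auto
    obtain m u where mu: "commutator_product ps = (m, u)" by (cases "commutator_product ps")
    have IH: "m = foldr (\<lambda>(A, B) m. commutator SL2 A B \<otimes>\<^bsub>SL2\<^esub> m) ps \<one>\<^bsub>SL2\<^esub>" "m \<in> carrier SL2"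
      using Cons.IH Cons.prems mu by auto
    show ?case
      unfolding p(1) commutator_product_Cons[OF p(2,3) mu]
      using IH m_closed[OF commutator_SL2_closed[OF p(2,3)] IH(2)] by simp
  qed
  then show "fst (commutator_product ps) =
      foldr (\<lambda>(A, B) m. commutator SL2 A B \<otimes>\<^bsub>SL2\<^esub> m) ps \<one>\<^bsub>SL2\<^esub>"
    "fst (commutator_product ps) \<in> carrier SL2" by blast+
qed

lemma witt_cocycle_eq_line_sum: "\<exists>a. witt_cocycle A B = line_sum [a]"
  unfolding witt_cocycle_def by simp blast

lemma commutator_class_eq_line_sum: "\<exists>as. length as = 3 \<and> commutator_class A B = line_sum as"
proof -
  obtain a b c where "witt_cocycle A B = line_sum [a]" "witt_cocycle (A * B) (inv\<^bsub>SL2\<^esub> A) = line_sum [b]"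
    "witt_cocycle (A * B * inv\<^bsub>SL2\<^esub> A) (inv\<^bsub>SL2\<^esub> B) = line_sum [c]"
    using witt_cocycle_eq_line_sum by metis
  then show ?thesis
    unfolding commutator_class_def by (intro exI[of _ "[a, b, c]"]) (simp add: add.assoc)
qed

lemma snd_commutator_product_eq_line_sum:
  fixes ps :: "('a::field mat \<times> 'a mat) list"
  assumes "set ps \<subseteq> carrier SL2 \<times> carrier SL2" "ps \<noteq> []"
  shows "\<exists>as. length as = 4 * length ps - 1 \<and> snd (commutator_product ps) = line_sum as"
  using assms
proof (induction ps)
  case (Cons p ps)
  obtain A B where p: "p = (A, B)" "A \<in> carrier SL2" "B \<in> carrier SL2" using Cons.prems by auto
  obtain m u where mu: "commutator_product ps = (m, u)" by (cases "commutator_product ps")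
  obtain as where as: "length as = 3" "commutator_class A B = line_sum as"
    using commutator_class_eq_line_sum by blast
  obtain a where a: "witt_cocycle (commutator SL2 A B) m = line_sum [a]"
    using witt_cocycle_eq_line_sum by blast
  show ?case
  proof (cases "ps = []")
    case True
    then have "m = mat2 1 0 0 1" "u = 0" using mu by (auto simp: commutator_product_Nil)
    then have "snd (commutator_product (p # ps)) = line_sum as"
      unfolding p(1) commutator_product_Cons[OF p(2,3) mu] by (simp add: as witt_cocycle_def)
    then show ?thesis using as True by auto
  next
    case False
    then obtain bs where bs: "length bs = 4 * length ps - 1" "u = line_sum bs"
      using Cons.IH Cons.prems mu by auto
    have "snd (commutator_product (p # ps)) = line_sum (as @ bs @ [a])"
      unfolding p(1) commutator_product_Cons[OF p(2,3) mu] using as bs a by (simp add: add.assoc)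
    moreover have "length (as @ bs @ [a]) = 4 * length (p # ps) - 1"
      using as bs False by (cases ps) auto
    ultimately show ?thesis by blast
  qed
qed simp

text \<open>
  Each commutator contributes three lines and each of the multiplications joining them one. The last
  of these operations has the identity matrix as its result, whose \<open>(2,1)\<close> entry is zero, so that its
  line is \<open>[0] = 0\<close>. For a single commutator this last operation is the last multiplication inside it.
\<close>

lemma closed_commutator_product_eq_line_sum:
  fixes ps :: "('a::field mat \<times> 'a mat) list"
  assumes ps: "set ps \<subseteq> carrier SL2 \<times> carrier SL2" "ps \<noteq> []"
    and closed: "fst (commutator_product ps) = \<one>\<^bsub>SL2\<^esub>"
  shows "\<exists>as. length as = 4 * (length ps - 1) + 2 \<and> snd (commutator_product ps) = line_sum as"
proof -
  obtain p qs where pq: "ps = p # qs" using ps(2) by (cases ps) auto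
  obtain A B where p: "p = (A, B)" "A \<in> carrier SL2" "B \<in> carrier SL2" using ps pq by auto
  obtain m u where mu: "commutator_product qs = (m, u)" by (cases "commutator_product qs")
  have one: "commutator SL2 A B * m = mat2 1 0 0 1"
    using closed unfolding pq p(1) commutator_product_Cons[OF p(2,3) mu] by simp
  have w: "snd (commutator_product ps) = commutator_class A B + u"
    unfolding pq p(1) commutator_product_Cons[OF p(2,3) mu]
    using witt_cocycle_of_mult_eq_one[OF one] by simp
  show ?thesis
  proof (cases "qs = []")
    case True
    then have mu': "m = mat2 1 0 0 1" "u = 0" using mu by (auto simp: commutator_product_Nil)
    have "commutator SL2 A B \<in> carrier_mat 2 2"
      using commutator_SL2_closed[OF p(2,3)] by (simp add: SL2_def)
    then have "commutator SL2 A B = mat2 1 0 0 1" using one by (simp add: mu' flip: one_mat2)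
    then have "A * B * inv\<^bsub>SL2\<^esub> A * inv\<^bsub>SL2\<^esub> B = mat2 1 0 0 1" by (simp add: commutator_def)
    then have "commutator_class A B = witt_cocycle A B + witt_cocycle (A * B) (inv\<^bsub>SL2\<^esub> A)"
      by (simp add: commutator_class_def witt_cocycle_of_mult_eq_one)
    moreover obtain a b where "witt_cocycle A B = line_sum [a]" "witt_cocycle (A * B) (inv\<^bsub>SL2\<^esub> A) = line_sum [b]"
      using witt_cocycle_eq_line_sum by metis
    ultimately show ?thesis
      unfolding w mu' using pq True by (intro exI[of _ "[a, b]"]) simp
  next
    case False
    obtain as where as: "length as = 3" "commutator_class A B = line_sum as"
      using commutator_class_eq_line_sum by blast
    obtain bs where bs: "length bs = 4 * length qs - 1" "u = line_sum bs"
      using snd_commutator_product_eq_line_sum[of qs] False ps pq mu by auto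
    show ?thesis
      using as bs w pq False by (intro exI[of _ "as @ bs"]) (cases qs; simp)
  qed
qed

section \<open>Realising prescribed lines by commutators\<close>

text \<open>
  Conjugation by an upper unipotent matrix. It fixes the vector \<open>(1, 0)\<close>, hence the \<open>(2,1)\<close> entries and the
  cocycle, but it moves the remaining entries; this is the freedom in joining commutators.
\<close>

definition shear :: "'a::field \<Rightarrow> 'a mat \<Rightarrow> 'a mat" where
  "shear \<beta> m = mat2 1 \<beta> 0 1 * m * mat2 1 (- \<beta>) 0 1"

lemma shear_mat2:
  "shear \<beta> (mat2 a b c d) = mat2 (a + \<beta> * c) (b + \<beta> * d - \<beta> * (a + \<beta> * c)) c (d - \<beta> * c)"
  by (simp add: shear_def mat2_eq_iff algebra_simps)

lemma shear_closed: "m \<in> carrier SL2 \<Longrightarrow> shear \<beta> m \<in> carrier SL2"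
  by (erule SL2_cases) (simp add: shear_mat2 algebra_simps)

lemma shear_mult:
  assumes "m \<in> carrier SL2" "n \<in> carrier SL2"
  shows "shear \<beta> m * shear \<beta> n = shear \<beta> (m * n)"
  using assms by (elim SL2_cases) (simp add: shear_mat2 mat2_eq_iff algebra_simps)

lemma shear_inv: "m \<in> carrier SL2 \<Longrightarrow> inv\<^bsub>SL2\<^esub> (shear \<beta> m) = shear \<beta> (inv\<^bsub>SL2\<^esub> m)"
  by (erule SL2_cases) (simp add: shear_mat2 inv_SL2 mat2_eq_iff algebra_simps)

lemma witt_cocycle_shear:
  assumes "m \<in> carrier SL2" "n \<in> carrier SL2"
  shows "witt_cocycle (shear \<beta> m) (shear \<beta> n) = witt_cocycle m n"
proof -
  have "shear \<beta> k $$ (1, 0) = k $$ (1, 0)" if "k \<in> carrier SL2" for k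
    using that by (elim SL2_cases) (simp add: shear_mat2)
  moreover have "m * n \<in> carrier SL2" using group_SL2 assms group.is_monoid monoid.m_closed
    by (metis SL2_simps(2))
  ultimately show ?thesis using assms by (simp add: witt_cocycle_def shear_mult)
qed

lemma commutator_shear:
  fixes A B :: "'a::field mat"
  assumes "A \<in> carrier SL2" "B \<in> carrier SL2"
  shows "commutator SL2 (shear \<beta> A) (shear \<beta> B) = shear \<beta> (commutator SL2 A B)"
    and "commutator_class (shear \<beta> A) (shear \<beta> B) = commutator_class A B"
proof -
  interpret group "SL2 :: 'a mat monoid" by (rule group_SL2)
  have c: "inv\<^bsub>SL2\<^esub> A \<in> carrier SL2" "inv\<^bsub>SL2\<^esub> B \<in> carrier SL2" "A * B \<in> carrier SL2"
    "A * B * inv\<^bsub>SL2\<^esub> A \<in> carrier SL2"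
    using assms m_closed[of A B] m_closed[of "A * B" "inv\<^bsub>SL2\<^esub> A"] by simp_all
  show "commutator SL2 (shear \<beta> A) (shear \<beta> B) = shear \<beta> (commutator SL2 A B)"
    using assms c by (simp add: commutator_def shear_mult shear_inv)
  show "commutator_class (shear \<beta> A) (shear \<beta> B) = commutator_class A B"
    using assms c by (simp add: commutator_class_def shear_mult shear_inv witt_cocycle_shear)
qed

text \<open>
  Put \<open>U t = (1, t; 0, 1)\<close> and \<open>s = (0, - 1; 1, 0)\<close>. For \<open>A = U x s\<close> and \<open>B = U y s U y'\<close> the commutator is,
  up to unipotent factors at both ends, \<open>s U(y) s U(y') s\<inverse> U(- x - y') s\<inverse>\<close>. Multiplying such a word out
  from the left gives lines \<open>[- t]\<close>, where each exponent \<open>t\<close> is corrected by the preceding ones as in a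
  continued fraction: the exponents are \<open>y\<close>, \<open>y' - 1 / y\<close> and \<open>- x - y' - 1 / (y' - 1 / y)\<close>. They
  equal \<open>- p\<close>, \<open>- q\<close> and \<open>- r\<close> for \<open>y = - p\<close>, \<open>y' = - q - 1 / p\<close> and the \<open>x\<close> below.
\<close>

lemma three_line_commutator:
  fixes p q r :: "'a::field"
  assumes "p \<noteq> 0" "q \<noteq> 0" "r \<noteq> 0"
  shows "\<exists>A\<in>carrier SL2. \<exists>B\<in>carrier SL2. commutator_class A B = line_sum [p, q, r] \<and>
    commutator SL2 A B $$ (1, 0) = - (p * q * r)"
proof -
  define x where "x = r + q + 1 / p + 1 / q"
  define A where "A = mat2 x (- 1) 1 0"
  define B where "B = mat2 (- p) (p * q) 1 (- q - 1 / p)"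
  have AB: "A \<in> carrier SL2" "B \<in> carrier SL2" using assms by (simp_all add: A_def B_def field_simps)
  have inv: "inv\<^bsub>SL2\<^esub> A = mat2 0 1 (- 1) x" "inv\<^bsub>SL2\<^esub> B = mat2 (- q - 1 / p) (- (p * q)) (- 1) (- p)"
    unfolding A_def B_def using assms by (subst inv_SL2; simp add: field_simps)+
  have AB1: "A * B = mat2 (- (p * x) - 1) (p * q * x + q + 1 / p) (- p) (p * q)"
    by (simp add: A_def B_def mat2_eq_iff algebra_simps)
  have AB2: "A * B * inv\<^bsub>SL2\<^esub> A = mat2 (- (p * q * x + q + 1 / p)) (- (p * x) - 1 + (p * q * x + q + 1 / p) * x) (- (p * q)) (- p + p * q * x)"
    unfolding AB1 inv by (simp add: mat2_eq_iff algebra_simps)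
  have x: "p * q * x = p * q * r + p * q * q + q + p" using assms by (simp add: x_def field_simps)
  have AB3: "(A * B * inv\<^bsub>SL2\<^esub> A * inv\<^bsub>SL2\<^esub> B) $$ (1, 0) = - (p * q * r)"
    unfolding AB2 unfolding inv mat2_mult mat2_index using x assms by (simp add: field_simps)
  have "witt_cocycle A B = witt_line p"
    unfolding A_def B_def witt_cocycle_mat2 by simp
  moreover have "witt_cocycle (A * B) (inv\<^bsub>SL2\<^esub> A) = witt_line (q * p * p)"
    unfolding AB1 unfolding inv witt_cocycle_mat2 by (simp add: mult_ac)
  moreover have "witt_cocycle (A * B * inv\<^bsub>SL2\<^esub> A) (inv\<^bsub>SL2\<^esub> B) = witt_line (r * (p * q) * (p * q))"
    using AB3 unfolding witt_cocycle_def unfolding AB2 unfolding inv by (simp add: mult_ac)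
  ultimately have "commutator_class A B = line_sum [p, q, r]"
    using assms by (simp add: commutator_class_def witt_line_mult_square add.assoc)
  then show ?thesis using AB AB3 by (auto simp: commutator_def)
qed

text \<open>
  Every further commutator adds four arbitrary lines: three of its own, and one from the
  multiplication by the product of the others, which is adjusted by a shear. The \<open>(2,1)\<close> entry
  records the discriminant of the form obtained.
\<close>

lemma exists_commutator_product:
  fixes ps :: "'a::field list"
  assumes "0 \<notin> set ps" "length ps = 4 * k + 3"
  shows "\<exists>L. length L = Suc k \<and> set L \<subseteq> carrier SL2 \<times> carrier SL2 \<and>
    snd (commutator_product L) = line_sum ps \<and> fst (commutator_product L) $$ (1, 0) = - prod_list ps"
  using assms
proof (induction k arbitrary: ps)
  case 0
  then obtain p q r where ps: "ps = [p, q, r]" by (auto simp: length_Suc_conv eval_nat_numeral)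
  obtain A B where AB: "A \<in> carrier SL2" "B \<in> carrier SL2" "commutator_class A B = line_sum [p, q, r]"
    "commutator SL2 A B $$ (1, 0) = - (p * q * r)"
    using three_line_commutator[of p q r] 0 ps by auto
  obtain a b c d where m: "commutator SL2 A B = mat2 a b c d"
    using commutator_SL2_closed[OF AB(1,2)] by (rule SL2_cases)
  show ?case
    using AB m commutator_product_Cons[OF AB(1,2) commutator_product_Nil]
    by (intro exI[of _ "[(A, B)]"]) (simp add: ps witt_cocycle_def mult.assoc)
next
  case (Suc k)
  then have "length ps = Suc (Suc (Suc (Suc (4 * k + 3))))" by simp
  then obtain p q r s qs where ps: "ps = p # q # r # s # qs" by (auto simp only: length_Suc_conv)
  have nz: "p \<noteq> 0" "q \<noteq> 0" "r \<noteq> 0" "s \<noteq> 0" "0 \<notin> set qs" "length qs = 4 * k + 3"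
    using Suc.prems ps by auto
  obtain L where L: "length L = Suc k" "set L \<subseteq> carrier SL2 \<times> carrier SL2"
    "snd (commutator_product L) = line_sum qs" "fst (commutator_product L) $$ (1, 0) = - prod_list qs"
    using Suc.IH[OF nz(5,6)] by blast
  obtain A B where AB: "A \<in> carrier SL2" "B \<in> carrier SL2" "commutator_class A B = line_sum [p, q, r]"
    "commutator SL2 A B $$ (1, 0) = - (p * q * r)"
    using three_line_commutator[of p q r] nz by auto
  obtain a b c d where m: "commutator SL2 A B = mat2 a b c d"
    using commutator_SL2_closed[OF AB(1,2)] by (rule SL2_cases)
  obtain a' b' c' d' where n: "fst (commutator_product L) = mat2 a' b' c' d'"
    using fst_commutator_product(2)[OF L(2)] by (rule SL2_cases)
  have P: "commutator_product L = (mat2 a' b' c' d', line_sum qs)"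
    using n L(3) by (metis prod.collapse)
  have c: "c = - (p * q * r)" "c' = - prod_list qs" using AB(4) m L(4) n by simp_all
  then have c0: "c \<noteq> 0" "c' \<noteq> 0" using nz by (auto simp: prod_list_zero_iff)
  \<comment> \<open>chosen so that the product below has \<open>(2,1)\<close> entry \<open>- (c c' s)\<close>, which turns the cocycle into \<open>[s]\<close>\<close>
  define \<beta> where "\<beta> = (c * a' + d * c' + c * c' * s) / (c * c')"
  have \<beta>: "c * a' + (d - \<beta> * c) * c' = - (c * c' * s)"
    using c0 by (simp add: \<beta>_def field_simps)
  note sh = commutator_shear[OF AB(1,2), of \<beta>]
  have C: "commutator_product ((shear \<beta> A, shear \<beta> B) # L) =
      (shear \<beta> (mat2 a b c d) * mat2 a' b' c' d',
       line_sum [p, q, r] + line_sum qs + witt_cocycle (shear \<beta> (mat2 a b c d)) (mat2 a' b' c' d'))"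
    using commutator_product_Cons[OF shear_closed[OF AB(1)] shear_closed[OF AB(2)] P, of \<beta> \<beta>]
    unfolding sh AB(3) m .
  have "witt_cocycle (shear \<beta> (mat2 a b c d)) (mat2 a' b' c' d') = witt_line (s * (c * c') * (c * c'))"
    unfolding shear_mat2 witt_cocycle_mat2 \<beta> by (simp add: mult_ac)
  also have "\<dots> = witt_line s" using c0 by (intro witt_line_mult_square) simp
  finally have "snd (commutator_product ((shear \<beta> A, shear \<beta> B) # L)) = line_sum ps"
    unfolding C by (simp add: ps algebra_simps)
  moreover have "fst (commutator_product ((shear \<beta> A, shear \<beta> B) # L)) $$ (1, 0) = - prod_list ps"
    unfolding C shear_mat2 using \<beta> c by (simp add: ps mult_ac)
  moreover have "set ((shear \<beta> A, shear \<beta> B) # L) \<subseteq> carrier SL2 \<times> carrier SL2"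
    using L(2) AB(1,2) by (simp add: shear_closed)
  ultimately show ?case using L(1)
    by (intro exI[of _ "(shear \<beta> A, shear \<beta> B) # L"] conjI) simp_all
qed

text \<open>
  For \<open>A = U x s\<close> and \<open>B = (\<beta> y, - 1 / \<beta>; \<beta>, 0)\<close>, with \<open>U\<close> and \<open>s\<close> as above, two of the three lines cancel.
  The choice of \<open>x\<close> gives the commutator the \<open>(2,1)\<close> entry of \<open>m\<close>, and then its trace is a polynomial of
  degree one in \<open>y\<close> with leading coefficient \<open>p (\<beta>\<^sup>2 - 1)\<close>. This is where the field has to contain a \<open>\<beta>\<close> with
  \<open>\<beta>\<^sup>2 \<noteq> 0, 1\<close>. Two matrices in \<open>SL2\<close> with equal trace and equal nonzero \<open>(2,1)\<close> entry differ by a shear.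
\<close>

lemma commutator_with_one_line:
  fixes m :: "'a::field mat"
  assumes inf: "infinite (UNIV :: 'a set)" and m: "m \<in> carrier SL2" "m $$ (1, 0) \<noteq> 0"
  shows "\<exists>A\<in>carrier SL2. \<exists>B\<in>carrier SL2. commutator SL2 A B = m \<and>
    commutator_class A B = witt_line (m $$ (1, 0))"
proof -
  obtain a b p d where mm: "m = mat2 a b p d" "a * d - b * p = 1" using m(1) by (rule SL2_cases)
  have p: "p \<noteq> 0" using m mm by simp
  obtain \<beta> :: 'a where "\<beta> \<notin> {0, 1, - 1}" using ex_new_if_finite[OF inf, of "{0, 1, - 1}"] by auto
  then have \<beta>: "\<beta> \<noteq> 0" "\<beta> * \<beta> - 1 \<noteq> 0" using square_eq_1_iff[of \<beta>] by auto
  define y where "y = (a + d - 1 / (\<beta> * \<beta>) - \<beta> * \<beta> - p * p) / (p * (\<beta> * \<beta> - 1))"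
  define x where "x = y * \<beta> * \<beta> + p"
  define A where "A = mat2 x (- 1) 1 0"
  define B where "B = mat2 (\<beta> * y) (- 1 / \<beta>) \<beta> 0"
  have AB: "A \<in> carrier SL2" "B \<in> carrier SL2" using \<beta> by (simp_all add: A_def B_def)
  have inv: "inv\<^bsub>SL2\<^esub> A = mat2 0 1 (- 1) x" "inv\<^bsub>SL2\<^esub> B = mat2 0 (1 / \<beta>) (- \<beta>) (\<beta> * y)"
    unfolding A_def B_def using \<beta> by (subst inv_SL2; simp)+
  have AB1: "A * B = mat2 (x * \<beta> * y - \<beta>) (- x / \<beta>) (\<beta> * y) (- 1 / \<beta>)"
    by (simp add: A_def B_def mat2_eq_iff algebra_simps)
  have AB2: "A * B * inv\<^bsub>SL2\<^esub> A = mat2 (x / \<beta>) (x * \<beta> * y - \<beta> - x * x / \<beta>) (1 / \<beta>) (\<beta> * y - x / \<beta>)"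
    unfolding AB1 inv by (simp add: mat2_eq_iff algebra_simps)
  define b' where "b' = x / \<beta> * (1 / \<beta>) + (x * \<beta> * y - \<beta> - x * x / \<beta>) * (\<beta> * y)"
  have AB3: "A * B * inv\<^bsub>SL2\<^esub> A * inv\<^bsub>SL2\<^esub> B = mat2 (\<beta> * \<beta> + x * p) b' p (1 / (\<beta> * \<beta>) - p * y)"
    unfolding AB2 unfolding inv b'_def using \<beta> by (simp add: mat2_eq_iff x_def field_simps)
  have "witt_cocycle A B = witt_line (- (y * \<beta> * \<beta>))"
    unfolding A_def B_def witt_cocycle_mat2 by (simp add: mult_ac)
  moreover have "witt_cocycle (A * B) (inv\<^bsub>SL2\<^esub> A) = witt_line y"
    unfolding AB1 unfolding inv witt_cocycle_mat2 using \<beta> by (simp add: mult_ac)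
  moreover have "witt_cocycle (A * B * inv\<^bsub>SL2\<^esub> A) (inv\<^bsub>SL2\<^esub> B) = witt_line p"
    unfolding witt_cocycle_def AB3 unfolding AB2 unfolding inv using \<beta> by (simp add: mult_ac)
  ultimately have cls: "commutator_class A B = witt_line p"
    using \<beta> by (simp add: commutator_class_def witt_line_uminus witt_line_mult_square)
  have comm: "commutator SL2 A B = mat2 (\<beta> * \<beta> + x * p) b' p (1 / (\<beta> * \<beta>) - p * y)"
    using AB3 by (simp add: commutator_def)
  have trace: "\<beta> * \<beta> + x * p + (1 / (\<beta> * \<beta>) - p * y) = a + d"
  proof -
    have "y * p * (\<beta> * \<beta> - 1) = a + d - 1 / (\<beta> * \<beta>) - \<beta> * \<beta> - p * p"
      using p \<beta> by (simp add: y_def)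
    then show ?thesis by (simp add: x_def algebra_simps)
  qed
  \<comment> \<open>the shear by \<open>\<gamma>\<close> corrects the \<open>(1,1)\<close> entry; trace and determinant then force the others\<close>
  define \<gamma> where "\<gamma> = (a - (\<beta> * \<beta> + x * p)) / p"
  have e11: "\<beta> * \<beta> + x * p + \<gamma> * p = a" using p by (simp add: \<gamma>_def)
  have e22: "1 / (\<beta> * \<beta>) - p * y - \<gamma> * p = d"
  proof -
    have "1 / (\<beta> * \<beta>) - p * y - \<gamma> * p =
        (\<beta> * \<beta> + x * p + (1 / (\<beta> * \<beta>) - p * y)) - (\<beta> * \<beta> + x * p + \<gamma> * p)" by simp
    then show ?thesis unfolding trace e11 by simp
  qed
  obtain b'' where sh: "shear \<gamma> (commutator SL2 A B) = mat2 a b'' p d"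
    unfolding comm shear_mat2 e11 e22 by blast
  have "a * d - b'' * p = 1"
    using shear_closed[OF commutator_SL2_closed[OF AB], of \<gamma>] sh by simp
  then have "a * d - b'' * p = a * d - b * p" using mm(2) by simp
  then have "b'' = b" using p by simp
  then show ?thesis
    using sh cls mm commutator_shear[OF AB, of \<gamma>] shear_closed[OF AB(1), of \<gamma>] shear_closed[OF AB(2), of \<gamma>]
    by (intro bexI[of _ "shear \<gamma> A"] bexI[of _ "shear \<gamma> B"]) simp_all
qed

text \<open>
  If \<open>n > 0\<close>, all lines but the first are realised by \<open>n\<close> commutators with product \<open>m\<close>. One more
  commutator, equal to the inverse of \<open>m\<close>, closes the surface. Its line is given by the \<open>(2,1)\<close> entry
  of \<open>m\<inverse>\<close>, which is the product of the entries already present and hence equal to the missing one up to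
  a square.
\<close>

lemma exists_closed_commutator_product:
  fixes cs :: "'a::field list"
  assumes inf: "infinite (UNIV :: 'a set)"
    and cs: "0 \<notin> set cs" "length cs = 4 * n" "prod_list cs = t * t"
  shows "\<exists>L. length L = Suc n \<and> set L \<subseteq> carrier SL2 \<times> carrier SL2 \<and>
    commutator_product L = (\<one>\<^bsub>SL2\<^esub>, line_sum cs)"
proof (cases n)
  case 0
  have "inv\<^bsub>SL2\<^esub> (mat2 1 0 0 1 :: 'a mat) = mat2 1 0 0 1" by (simp add: inv_SL2)
  then have "commutator_product [(mat2 1 0 0 1 :: 'a mat, mat2 1 0 0 1)] = (mat2 1 0 0 1, 0)"
    by (subst commutator_product_Cons[OF _ _ commutator_product_Nil])
       (simp_all add: commutator_def commutator_class_def witt_cocycle_mat2)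
  then show ?thesis using 0 cs(2) by (intro exI[of _ "[(mat2 1 0 0 1, mat2 1 0 0 1)]"]) simp
next
  case (Suc k)
  obtain p ps where ps: "cs = p # ps" "length ps = 4 * k + 3"
    using cs(2) Suc by (cases cs) auto
  have nz: "p \<noteq> 0" "0 \<notin> set ps" using cs(1) ps by auto
  obtain L where L: "length L = Suc k" "set L \<subseteq> carrier SL2 \<times> carrier SL2"
    "snd (commutator_product L) = line_sum ps" "fst (commutator_product L) $$ (1, 0) = - prod_list ps"
    using exists_commutator_product[OF nz(2) ps(2)] by blast
  obtain a b c d where n: "fst (commutator_product L) = mat2 a b c d" "a * d - b * c = 1"
    using fst_commutator_product(2)[OF L(2)] by (rule SL2_cases)
  have P: "commutator_product L = (mat2 a b c d, line_sum ps)"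
    using n L(3) by (metis prod.collapse)
  have c: "- c = prod_list ps" using L(4) n by simp
  then have c0: "- c \<noteq> 0" using nz by (metis prod_list_zero_iff)
  obtain A B where AB: "A \<in> carrier SL2" "B \<in> carrier SL2" "commutator SL2 A B = mat2 d (- b) (- c) a"
    "commutator_class A B = witt_line (- c)"
    using commutator_with_one_line[OF inf, of "mat2 d (- b) (- c) a"] n(2) c0
    by (auto simp: algebra_simps)
  have "witt_line (- c) = witt_line p"
    using c c0 nz cs(3) ps by (intro witt_line_cong_square[of _ _ t]) (simp_all add: mult.commute)
  moreover have one: "mat2 d (- b) (- c) a * mat2 a b c d = mat2 1 0 0 1"
    using n(2) by (simp add: mat2_eq_iff algebra_simps)
  ultimately have "commutator_product ((A, B) # L) = (mat2 1 0 0 1, line_sum cs)"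
    unfolding commutator_product_Cons[OF AB(1,2) P] AB(3,4) witt_cocycle_of_mult_eq_one[OF one] one
    by (simp add: ps)
  then show ?thesis using L(1,2) AB(1,2) Suc by (intro exI[of _ "(A, B) # L"]) simp
qed

section \<open>Homomorphisms from a presented group\<close>

lemma words_simps [simp]:
  "[] \<in> words S" "p # w \<in> words S \<longleftrightarrow> fst p \<in> S \<and> w \<in> words S"
  "v @ w \<in> words S \<longleftrightarrow> v \<in> words S \<and> w \<in> words S"
  by (cases p; auto simp: words_def)+

lemma presented_eq_words:
  assumes "R \<subseteq> words S" "presented_eq S R v w"
  shows "v \<in> words S \<and> w \<in> words S"
  using assms(2,1) by (induction rule: presented_eq.induct) auto

lemma presented_eq_context:
  assumes "presented_eq S R v w" "x \<in> words S" "y \<in> words S"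
  shows "presented_eq S R (x @ v @ y) (x @ w @ y)"
  using assms
proof (induction rule: presented_eq.induct)
  case (refl w)
  then show ?case by (intro presented_eq.refl) simp
next
  case (sym v w)
  show ?case by (rule presented_eq.sym[OF sym.IH[OF sym.prems]])
next
  case (trans u v w)
  show ?case by (rule presented_eq.trans[OF trans.IH(1)[OF trans.prems] trans.IH(2)[OF trans.prems]])
next
  case (cancel u v z e)
  then show ?case using presented_eq.cancel[of "x @ u" S "v @ y" z R e] by simp
next
  case (relator u v r)
  then show ?case using presented_eq.relator[of "x @ u" S "v @ y" r R] by simp
qed

lemma presented_eq_append:
  assumes R: "R \<subseteq> words S" and v: "presented_eq S R v v'" and w: "presented_eq S R w w'"
  shows "presented_eq S R (v @ w) (v' @ w')"
proof -
  have "presented_eq S R (v @ w) (v' @ w)"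
    using presented_eq_context[OF v, of "[]" w] presented_eq_words[OF R w] by simp
  moreover have "presented_eq S R (v' @ w) (v' @ w')"
    using presented_eq_context[OF w, of v' "[]"] presented_eq_words[OF R v] by simp
  ultimately show ?thesis by (rule presented_eq.trans)
qed

lemma word_class_eq: "presented_eq S R v w \<Longrightarrow> word_class S R v = word_class S R w"
  unfolding word_class_def by (auto intro: presented_eq.trans presented_eq.sym)

lemma mult_word_class:
  assumes R: "R \<subseteq> words S" and v: "v \<in> words S" and w: "w \<in> words S"
  shows "word_class S R v \<otimes>\<^bsub>presented_group S R\<^esub> word_class S R w = word_class S R (v @ w)"
proof -
  have eq: "word_class S R (v' @ w') = word_class S R (v @ w)"
    if "v' \<in> word_class S R v" "w' \<in> word_class S R w" for v' w'
    using that presented_eq_append[OF R, of v v' w w'] word_class_eq unfolding word_class_def by blast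
  have ne: "v \<in> word_class S R v" "w \<in> word_class S R w"
    using v w by (simp_all add: word_class_def presented_eq.refl)
  have "word_class S R v \<otimes>\<^bsub>presented_group S R\<^esub> word_class S R w =
      (\<Union>v'\<in>word_class S R v. \<Union>w'\<in>word_class S R w. word_class S R (v' @ w'))"
    by (simp add: presented_group_def)
  also have "\<dots> = (\<Union>v'\<in>word_class S R v. \<Union>w'\<in>word_class S R w. word_class S R (v @ w))"
    by (intro SUP_cong HOL.refl eq)
  also have "\<dots> = word_class S R (v @ w)" using ne by blast
  finally show ?thesis .
qed

definition eval_word :: "('g, 'b) monoid_scheme \<Rightarrow> ('x \<Rightarrow> 'g) \<Rightarrow> ('x \<times> bool) list \<Rightarrow> 'g" where
  "eval_word G \<phi> w = foldr (\<lambda>(x, e) m. (if e then \<phi> x else inv\<^bsub>G\<^esub> \<phi> x) \<otimes>\<^bsub>G\<^esub> m) w \<one>\<^bsub>G\<^esub>"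

lemma eval_word_simps [simp]:
  "eval_word G \<phi> [] = \<one>\<^bsub>G\<^esub>"
  "eval_word G \<phi> ((x, e) # w) = (if e then \<phi> x else inv\<^bsub>G\<^esub> \<phi> x) \<otimes>\<^bsub>G\<^esub> eval_word G \<phi> w"
  by (simp_all add: eval_word_def)

context group
begin

lemma eval_word_closed:
  "\<phi> \<in> S \<rightarrow> carrier G \<Longrightarrow> w \<in> words S \<Longrightarrow> eval_word G \<phi> w \<in> carrier G"
  by (induction w) (auto simp: Pi_iff)

lemma eval_word_append:
  "\<phi> \<in> S \<rightarrow> carrier G \<Longrightarrow> v \<in> words S \<Longrightarrow> w \<in> words S \<Longrightarrow>
     eval_word G \<phi> (v @ w) = eval_word G \<phi> v \<otimes> eval_word G \<phi> w"
proof (induction v)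
  case (Cons p v)
  obtain x e where p: "p = (x, e)" by (cases p)
  have "\<phi> x \<in> carrier G" using Cons.prems p by auto
  then show ?case
    using Cons p eval_word_closed[of \<phi> S v] eval_word_closed[of \<phi> S w] by (simp add: m_assoc)
qed (simp add: eval_word_closed)

lemma eval_word_presented_eq:
  assumes \<phi>: "\<phi> \<in> S \<rightarrow> carrier G" and R: "R \<subseteq> words S" "\<And>r. r \<in> R \<Longrightarrow> eval_word G \<phi> r = \<one>"
    and eq: "presented_eq S R v w"
  shows "eval_word G \<phi> v = eval_word G \<phi> w"
  using eq
proof (induction rule: presented_eq.induct)
  case (cancel u v x e)
  have "\<phi> x \<in> carrier G" using \<phi> cancel by auto
  then have "eval_word G \<phi> ([(x, e), (x, \<not> e)] @ v) = eval_word G \<phi> v"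
    using eval_word_closed[OF \<phi>, of v] cancel by (cases e) (simp_all flip: m_assoc)
  then show ?case
    using cancel by (subst (1 2) eval_word_append[OF \<phi>]) simp_all
next
  case (relator u v r)
  have "r \<in> words S" using relator R by blast
  then show ?case
    using relator R eval_word_closed[OF \<phi>, of v] by (simp add: eval_word_append[OF \<phi>])
qed simp_all

text \<open>
  The universal property of a presentation: a homomorphism can be prescribed on the generators as soon as the
  relators are mapped to the identity.
\<close>

lemma presented_group_hom_exists:
  assumes \<phi>: "\<phi> \<in> S \<rightarrow> carrier G" and R: "R \<subseteq> words S" "\<And>r. r \<in> R \<Longrightarrow> eval_word G \<phi> r = \<one>"
  shows "\<exists>\<rho>\<in>hom (presented_group S R) G. \<forall>x\<in>S. \<rho> (word_class S R [(x, True)]) = \<phi> x"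
proof -
  define \<rho> where "\<rho> X = eval_word G \<phi> (SOME w. w \<in> X)" for X
  have \<rho>: "\<rho> (word_class S R w) = eval_word G \<phi> w" if "w \<in> words S" for w
  proof -
    have "w \<in> word_class S R w" using that by (simp add: word_class_def presented_eq.refl)
    then have "(SOME w'. w' \<in> word_class S R w) \<in> word_class S R w" by (rule someI)
    then show ?thesis
      using eval_word_presented_eq[OF \<phi> R] unfolding \<rho>_def word_class_def by simp
  qed
  have "\<rho> \<in> hom (presented_group S R) G"
  proof (rule homI)
    fix X assume "X \<in> carrier (presented_group S R)"
    then show "\<rho> X \<in> carrier G" using \<rho> eval_word_closed[OF \<phi>] by (auto simp: presented_group_def)
  next
    fix X Y assume "X \<in> carrier (presented_group S R)" "Y \<in> carrier (presented_group S R)"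
    then obtain v w where vw: "v \<in> words S" "w \<in> words S" "X = word_class S R v" "Y = word_class S R w"
      by (auto simp: presented_group_def)
    show "\<rho> (X \<otimes>\<^bsub>presented_group S R\<^esub> Y) = \<rho> X \<otimes> \<rho> Y"
      using vw by (simp add: mult_word_class[OF R(1)] \<rho> eval_word_append[OF \<phi>])
  qed
  moreover have "\<rho> (word_class S R [(x, True)]) = \<phi> x" if "x \<in> S" for x
    using that \<phi> \<rho>[of "[(x, True)]"] by (auto simp: Pi_iff)
  ultimately show ?thesis by blast
qed

text \<open>
  The uniqueness part of the universal property: a homomorphism is determined by the images of the
  generators.
\<close>

lemma presented_group_hom_eq_eval_word:
  assumes R: "R \<subseteq> words S" and \<rho>: "\<rho> \<in> hom (presented_group S R) G" and w: "w \<in> words S"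
  shows "\<rho> (word_class S R w) = eval_word G (\<lambda>x. \<rho> (word_class S R [(x, True)])) w"
proof -
  have cl: "\<rho> (word_class S R v) \<in> carrier G" if "v \<in> words S" for v
    using \<rho> that by (auto simp: hom_def presented_group_def)
  have mult: "\<rho> (word_class S R (u @ v)) = \<rho> (word_class S R u) \<otimes> \<rho> (word_class S R v)"
    if "u \<in> words S" "v \<in> words S" for u v
  proof -
    have "word_class S R u \<in> carrier (presented_group S R)" "word_class S R v \<in> carrier (presented_group S R)"
      using that by (simp_all add: presented_group_def)
    from hom_mult[OF \<rho> this] show ?thesis unfolding mult_word_class[OF R that] .
  qed
  have one: "\<rho> (word_class S R []) = \<one>"
    using mult[of "[]" "[]"] cl[of "[]"] by (simp add: l_cancel_one')
  have inv: "\<rho> (word_class S R [(x, False)]) = inv \<rho> (word_class S R [(x, True)])" if x: "x \<in> S" for x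
  proof -
    have "presented_eq S R ([] @ [(x, False), (x, \<not> False)] @ []) ([] @ [])"
      using x by (intro presented_eq.cancel) simp_all
    from word_class_eq[OF this]
    have "\<rho> (word_class S R [(x, False)]) \<otimes> \<rho> (word_class S R [(x, True)]) = \<one>"
      using mult[of "[(x, False)]" "[(x, True)]"] one x by simp
    then show ?thesis using cl x by (intro inv_equality[symmetric]) simp_all
  qed
  show ?thesis
    using w
  proof (induction w)
    case (Cons p w)
    obtain x e where p: "p = (x, e)" by (cases p)
    show ?case using Cons mult[of "[(x, e)]" w] inv[of x] by (cases e) (simp_all add: p)
  qed (simp add: one)
qed

lemma eval_word_surface_relator:
  assumes \<phi>: "\<phi> \<in> surface_loops g \<rightarrow> carrier G"
  shows "eval_word G \<phi> (surface_relator g) =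
    foldr (\<lambda>i m. commutator G (\<phi> (LoopA i)) (\<phi> (LoopB i)) \<otimes> m) [0..<g] \<one>"
proof -
  have "eval_word G \<phi> (concat (map (\<lambda>i. [(LoopA i, True), (LoopB i, True), (LoopA i, False), (LoopB i, False)]) is)) =
      foldr (\<lambda>i m. commutator G (\<phi> (LoopA i)) (\<phi> (LoopB i)) \<otimes> m) is \<one>
    \<and> foldr (\<lambda>i m. commutator G (\<phi> (LoopA i)) (\<phi> (LoopB i)) \<otimes> m) is \<one> \<in> carrier G"
    if "set is \<subseteq> {..<g}" for "is"
    using that
  proof (induction "is")
    case (Cons i "is")
    have "\<phi> (LoopA i) \<in> carrier G" "\<phi> (LoopB i) \<in> carrier G"
      using \<phi> Cons.prems by (auto simp: surface_loops_def)
    then show ?case using Cons by (simp add: commutator_def m_assoc)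
  qed simp
  from this[of "[0..<g]"] show ?thesis
    unfolding surface_relator_def by (simp add: atLeast0LessThan)
qed

end

lemma surface_relator_words: "{surface_relator g} \<subseteq> words (surface_loops g)"
proof -
  have "concat (map (\<lambda>i. [(LoopA i, True), (LoopB i, True), (LoopA i, False), (LoopB i, False)]) is)
      \<in> words (surface_loops g)" if "set is \<subseteq> {..<g}" for "is"
    using that by (induction "is") (auto simp: surface_loops_def)
  from this[of "[0..<g]"] show ?thesis
    by (simp add: surface_relator_def atLeast0LessThan)
qed

section \<open>Flat bundles over a surface\<close>

lemma flat_bundle_witt_class_eq_commutator_product:
  "flat_bundle_witt_class g \<rho> = snd (commutator_product
     (map (\<lambda>i. (\<rho> (loop_class g (LoopA i)), \<rho> (loop_class g (LoopB i)))) [0..<g]))"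
  by (simp add: flat_bundle_witt_class_def commutator_product_def foldr_map comp_def)

lemma eval_surface_relator_SL2:
  fixes \<phi> :: "surface_loop \<Rightarrow> 'a::field mat"
  assumes \<phi>: "\<phi> \<in> surface_loops g \<rightarrow> carrier SL2"
  defines "L \<equiv> map (\<lambda>i. (\<phi> (LoopA i), \<phi> (LoopB i))) [0..<g]"
  shows "set L \<subseteq> carrier SL2 \<times> carrier SL2"
    and "eval_word SL2 \<phi> (surface_relator g) = fst (commutator_product L)"
proof -
  show L: "set L \<subseteq> carrier SL2 \<times> carrier SL2"
    using \<phi> by (auto simp: L_def surface_loops_def)
  show "eval_word SL2 \<phi> (surface_relator g) = fst (commutator_product L)"
    unfolding group.eval_word_surface_relator[OF group_SL2 \<phi>] fst_commutator_product(1)[OF L]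
    by (simp add: L_def foldr_map comp_def)
qed

lemma witt_norm_flat_bundle_le:
  fixes \<rho> :: "(surface_loop \<times> bool) list set \<Rightarrow> 'a::field mat"
  assumes \<rho>: "\<rho> \<in> hom (surface_group g) SL2" and g: "g \<ge> 1"
  shows "witt_norm (flat_bundle_witt_class g \<rho>) \<le> 4 * (g - 1) + 2"
proof -
  interpret group "SL2 :: 'a mat monoid" by (rule group_SL2)
  define \<phi> where "\<phi> x = \<rho> (loop_class g x)" for x
  define L where "L = map (\<lambda>i. (\<phi> (LoopA i), \<phi> (LoopB i))) [0..<g]"
  note R = surface_relator_words[of g]
  note \<rho>' = \<rho>[unfolded surface_group_def]
  have \<phi>: "\<phi> \<in> surface_loops g \<rightarrow> carrier SL2"
  proof
    fix x assume "x \<in> surface_loops g"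
    then have "loop_class g x \<in> carrier (surface_group g)"
      by (simp add: loop_class_def surface_group_def presented_group_def)
    then show "\<phi> x \<in> carrier SL2" unfolding \<phi>_def by (rule hom_in_carrier[OF \<rho>])
  qed
  note eval = presented_group_hom_eq_eval_word[OF R \<rho>', folded loop_class_def, folded \<phi>_def]
  have "presented_eq (surface_loops g) {surface_relator g} ([] @ surface_relator g @ []) ([] @ [])"
    by (intro presented_eq.relator) simp_all
  from word_class_eq[OF this] have "eval_word SL2 \<phi> (surface_relator g) = \<one>\<^bsub>SL2\<^esub>"
    using eval[of "surface_relator g"] eval[of "[]"] R by simp
  then have "fst (commutator_product L) = \<one>\<^bsub>SL2\<^esub>"
    using eval_surface_relator_SL2(2)[OF \<phi>] by (simp add: L_def)
  moreover have "set L \<subseteq> carrier SL2 \<times> carrier SL2" "L \<noteq> []"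
    using eval_surface_relator_SL2(1)[OF \<phi>] g by (simp_all add: L_def)
  ultimately obtain as where "length as = 4 * (g - 1) + 2" "snd (commutator_product L) = line_sum as"
    using closed_commutator_product_eq_line_sum[of L] by (auto simp: L_def)
  moreover have "flat_bundle_witt_class g \<rho> = snd (commutator_product L)"
    by (simp add: flat_bundle_witt_class_eq_commutator_product L_def \<phi>_def)
  ultimately show ?thesis using witt_norm_line_sum_le[of as] by simp
qed

lemma flat_bundle_of_commutator_product:
  fixes L :: "('a::field mat \<times> 'a mat) list"
  assumes L: "length L = g" "set L \<subseteq> carrier SL2 \<times> carrier SL2" "commutator_product L = (\<one>\<^bsub>SL2\<^esub>, u)"
  shows "u \<in> flat_bundle_witt_class g ` hom (surface_group g) SL2"
proof -
  define \<phi> where "\<phi> x = (case x of LoopA i \<Rightarrow> fst (L ! i) | LoopB i \<Rightarrow> snd (L ! i))" for x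
  have L_eq: "map (\<lambda>i. (\<phi> (LoopA i), \<phi> (LoopB i))) [0..<g] = L"
    using L(1) by (intro nth_equalityI) (simp_all add: \<phi>_def)
  have nth: "L ! i \<in> carrier SL2 \<times> carrier SL2" if "i < g" for i using L(1,2) that nth_mem by blast
  have \<phi>: "\<phi> \<in> surface_loops g \<rightarrow> carrier SL2"
    using nth by (auto simp: \<phi>_def surface_loops_def mem_Times_iff)
  have "eval_word SL2 \<phi> (surface_relator g) = \<one>\<^bsub>SL2\<^esub>"
    using eval_surface_relator_SL2(2)[OF \<phi>] L(3) unfolding L_eq by simp
  then obtain \<rho> where \<rho>: "\<rho> \<in> hom (surface_group g) SL2" "\<And>x. x \<in> surface_loops g \<Longrightarrow> \<rho> (loop_class g x) = \<phi> x"
    using group.presented_group_hom_exists[OF group_SL2 \<phi> surface_relator_words]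
    unfolding surface_group_def loop_class_def by auto
  have "map (\<lambda>i. (\<rho> (loop_class g (LoopA i)), \<rho> (loop_class g (LoopB i)))) [0..<g] = L"
    unfolding L_eq[symmetric] by (intro map_cong HOL.refl) (auto simp: \<rho>(2) surface_loops_def)
  then have "flat_bundle_witt_class g \<rho> = u"
    using L(3) by (simp add: flat_bundle_witt_class_eq_commutator_product)
  then show ?thesis using \<rho>(1) by blast
qed

theorem theoremB:
  fixes g :: nat
  assumes "infinite (UNIV :: 'a::field set)" and "g \<ge> 1"
  shows "(\<forall>\<rho> \<in> hom (surface_group g) (SL2 :: 'a mat monoid).
            witt_norm (flat_bundle_witt_class g \<rho>) \<le> 4 * (g - 1) + 2)
       \<and> {x \<in> (fund_ideal_sq :: 'a witt set). witt_norm x \<le> 4 * (g - 1)}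
           \<subseteq> flat_bundle_witt_class g ` hom (surface_group g) (SL2 :: 'a mat monoid)"
proof (intro conjI ballI subsetI)
  fix \<rho> :: "(surface_loop \<times> bool) list set \<Rightarrow> 'a mat"
  assume "\<rho> \<in> hom (surface_group g) SL2"
  then show "witt_norm (flat_bundle_witt_class g \<rho>) \<le> 4 * (g - 1) + 2"
    using assms(2) by (rule witt_norm_flat_bundle_le)
next
  fix x :: "'a witt"
  assume "x \<in> {x \<in> fund_ideal_sq. witt_norm x \<le> 4 * (g - 1)}"
  then obtain cs t where cs: "0 \<notin> set cs" "length cs = 4 * (g - 1)" "line_sum cs = x" "prod_list cs = t * t"
    using fund_ideal_sq_line_sum_of_norm_le[of x "g - 1"] by blast
  obtain L :: "('a mat \<times> 'a mat) list" where "length L = Suc (g - 1)" "set L \<subseteq> carrier SL2 \<times> carrier SL2"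
    "commutator_product L = (\<one>\<^bsub>SL2\<^esub>, line_sum cs)"
    using exists_closed_commutator_product[OF assms(1) cs(1,2,4)] by blast
  then show "x \<in> flat_bundle_witt_class g ` hom (surface_group g) SL2"
    using flat_bundle_of_commutator_product[of L g x] cs(3) assms(2) by simp
qed

end
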